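(* Let $S,X_1,X_2,Y$ be zero-mean, jointly Gaussian real random variables with variances $\sigma_S,\sigma_{X_1},\sigma_{X_2},\sigma_Y>0$ and covariances $\sigma_{SX_1}=\mathrm{Cov}(S,X_1)$, $\sigma_{X_1Y}=\mathrm{Cov}(X_1,Y)$, $\sigma_{X_2Y}=\mathrm{Cov}(X_2,Y)$, such that the Markov chain $S-X_1-(X_2,Y)$ holds. Let the reconstruction alphabets be $\hat{\mathcal X}_1=\hat{\mathcal X}_2=\hat{\mathcal S}=\mathbb R$ and let $d_1,d_2,d_s$ all be squared error. If the Markov chain $X_1-Y-X_2$ holds, then for $D_1>0$, $D_2>0$ and $D_s>\mathrm{mmse}$ the rate-distortion function is $$R(D_1,D_2,D_s)=\frac12\left(\log\frac{\sigma_{X_2}-\frac{\sigma_{X_2Y}^2}{\sigma_Y}}{D_2}\right)^+ +\frac12\left[\log\max\left(\frac{\sigma_{X_1}-\frac{\sigma_{X_1Y}^2}{\sigma_Y}}{D_1},\ \frac{\sigma_{SX_1}^2\left(\sigma_{X_1}-\frac{\sigma_{X_1Y}^2}{\sigma_Y}\right)}{\sigma_{X_1}^2\,(D_s-\mathrm{mmse})}\right)\right]^+,$$ where $\mathrm{mmse}=\sigma_S-\frac{\sigma_{SX_1}^2}{\sigma_{X_1}}$ is the minimum mean squared error for estimating $S$ from $X_1$.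
   Context: Here $\sigma_S,\sigma_{X_1},\sigma_{X_2},\sigma_Y$ denote variances (not standard deviations). $(a)^+=\max\{a,0\}$, $\log$ is base 2, and $\log 0=-\infty$. Rate-distortion function: let $(S_i,X_{1,i},X_{2,i},Y_i)$ be i.i.d. copies of $(S,X_1,X_2,Y)$. For sequences, distortions are per-letter averages, e.g. $d_1(x_1^n,\hat x_1^n)=\frac1n\sum_{i=1}^n (x_{1,i}-\hat x_{1,i})^2$. An $(n,2^{nR})$ code consists of a (measurable) encoding function mapping $(X_1^n,X_2^n,Y^n)$ to an index in $\{1,2,\dots,2^{nR}\}$ and a (measurable) decoding function mapping the index and $Y^n$ to $(\hat X_1^n,\hat X_2^n,\hat S^n)$. A nonnegative tuple $(R,D_1,D_2,D_s)$ is achievable if for all sufficiently large $n$ there exist $(n,2^{nR})$ codes such that $\lim_{n\to\infty}\mathbb E d_1(X_1^n,\hat X_1^n)\le D_1$, $\lim_{n\to\infty}\mathbb E d_2(X_2^n,\hat X_2^n)\le D_2$ and $\lim_{n\to\infty}\mathbb E d_s(S^n,\hat S^n)\le D_s$. $R(D_1,D_2,D_s)$ is the infimum of all $R$ such that $(R,D_1,D_2,D_s)$ is achievable. The paper uses its single-letter form: the minimum (infimum) of $I(X_1,X_2;\hat X_1,\hat X_2,\hat S|Y)$ over conditional distributions of $(\hat X_1,\hat X_2,\hat S)$ given $(X_1,X_2,Y)$ with $\mathbb E d_1(X_1,\hat X_1)\le D_1$, $\mathbb E d_2(X_2,\hat X_2)\le D_2$, $\mathbb E d_s'(X_1,\hat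 S)\le D_s$, where $d_s'(x_1,\hat s)=\mathbb E[d_s(S,\hat s)\,|\,X_1=x_1]$. *)

theory Defs
  imports "HOL-Probability.Probability"
begin

subsection \<open>Jointly Gaussian variables, covariance, Markov chains\<close>

text \<open>Degenerate (zero-variance) Gaussians are allowed, so that a jointly Gaussian vector may have
  a singular covariance matrix.  Note that \<^const>\<open>normal_density\<close> takes the standard deviation.\<close>

definition gaussian :: "'a measure \<Rightarrow> ('a \<Rightarrow> real) \<Rightarrow> bool" where
  "gaussian M X \<longleftrightarrow> X \<in> borel_measurable M \<and>
     (\<exists>\<mu> s. (s > 0 \<and> distributed M lborel X (normal_density \<mu> s)) \<or>
            (s = 0 \<and> distr M borel X = return borel \<mu>))"

definition jointly_gaussian :: "'a measure \<Rightarrow> ('a \<Rightarrow> real) list \<Rightarrow> bool" where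
  "jointly_gaussian M Xs \<longleftrightarrow>
     (\<forall>c :: nat \<Rightarrow> real. gaussian M (\<lambda>\<omega>. \<Sum>i<length Xs. c i * (Xs ! i) \<omega>))"

definition covariance :: "'a measure \<Rightarrow> ('a \<Rightarrow> real) \<Rightarrow> ('a \<Rightarrow> real) \<Rightarrow> real" where
  "covariance M X Y = (\<integral>\<omega>. (X \<omega> - (\<integral>\<omega>'. X \<omega>' \<partial>M)) * (Y \<omega> - (\<integral>\<omega>'. Y \<omega>' \<partial>M)) \<partial>M)"

text \<open>\<open>A - B - C\<close> is a Markov chain: \<open>A\<close> and \<open>C\<close> are conditionally independent given the
  sigma-algebra generated by \<open>B\<close>.\<close>

definition markov_chain ::
  "'a measure \<Rightarrow> 'b measure \<Rightarrow> ('a \<Rightarrow> 'b) \<Rightarrow> 'c measure \<Rightarrow> ('a \<Rightarrow> 'c) \<Rightarrow> 'd measure \<Rightarrow> ('a \<Rightarrow> 'd) \<Rightarrow> bool" where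
  "markov_chain M MA A MB B MC C \<longleftrightarrow>
     A \<in> M \<rightarrow>\<^sub>M MA \<and> B \<in> M \<rightarrow>\<^sub>M MB \<and> C \<in> M \<rightarrow>\<^sub>M MC \<and>
     (let F = vimage_algebra (space M) B MB in
      \<forall>U\<in>sets MA. \<forall>V\<in>sets MC. AE \<omega> in M.
        real_cond_exp M F (\<lambda>\<omega>. indicator U (A \<omega>) * indicator V (C \<omega>)) \<omega>
        = real_cond_exp M F (\<lambda>\<omega>. indicator U (A \<omega>)) \<omega> * real_cond_exp M F (\<lambda>\<omega>. indicator V (C \<omega>)) \<omega>)"

text \<open>Infimum of the mean squared error over all measurable estimators of \<open>S\<close> from \<open>X\<close>.  Here and
  below, expected squared errors are \<^typ>\<open>ennreal\<close>-valued, since the Bochner integral of a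
  non-integrable function is \<open>0\<close>.\<close>

definition min_mean_square_error :: "'a measure \<Rightarrow> ('a \<Rightarrow> real) \<Rightarrow> ('a \<Rightarrow> real) \<Rightarrow> ennreal" where
  "min_mean_square_error M S X =
     (INF g \<in> borel_measurable (borel :: real measure). \<integral>\<^sup>+ \<omega>. ennreal ((S \<omega> - g (X \<omega>))\<^sup>2) \<partial>M)"

subsection \<open>The rate-distortion function\<close>

text \<open>A block of length \<open>n\<close> is an element of \<open>seqs n\<close>; the letters are indexed by \<open>{..<n}\<close>.\<close>

abbreviation seqs :: "nat \<Rightarrow> (nat \<Rightarrow> real) measure" where
  "seqs n \<equiv> PiM {..<n} (\<lambda>_. borel)"

definition sq_distortion :: "nat \<Rightarrow> (nat \<Rightarrow> real) \<Rightarrow> (nat \<Rightarrow> real) \<Rightarrow> real" where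
  "sq_distortion n x xh = (1 / real n) * (\<Sum>i<n. (x i - xh i)\<^sup>2)"

text \<open>The law of \<open>n\<close> i.i.d. copies of \<open>(S, X1, X2, Y)\<close>, and the four component blocks.\<close>

definition iid_source ::
  "'a measure \<Rightarrow> ('a \<Rightarrow> real) \<Rightarrow> ('a \<Rightarrow> real) \<Rightarrow> ('a \<Rightarrow> real) \<Rightarrow> ('a \<Rightarrow> real) \<Rightarrow> nat
     \<Rightarrow> (nat \<Rightarrow> real \<times> real \<times> real \<times> real) measure" where
  "iid_source M S X1 X2 Y n = PiM {..<n} (\<lambda>_. distr M borel (\<lambda>\<omega>. (S \<omega>, X1 \<omega>, X2 \<omega>, Y \<omega>)))"

definition S_block :: "nat \<Rightarrow> (nat \<Rightarrow> real \<times> real \<times> real \<times> real) \<Rightarrow> nat \<Rightarrow> real" where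
  "S_block n z = (\<lambda>i\<in>{..<n}. case z i of (s, x1, x2, y) \<Rightarrow> s)"

definition X1_block :: "nat \<Rightarrow> (nat \<Rightarrow> real \<times> real \<times> real \<times> real) \<Rightarrow> nat \<Rightarrow> real" where
  "X1_block n z = (\<lambda>i\<in>{..<n}. case z i of (s, x1, x2, y) \<Rightarrow> x1)"

definition X2_block :: "nat \<Rightarrow> (nat \<Rightarrow> real \<times> real \<times> real \<times> real) \<Rightarrow> nat \<Rightarrow> real" where
  "X2_block n z = (\<lambda>i\<in>{..<n}. case z i of (s, x1, x2, y) \<Rightarrow> x2)"

definition Y_block :: "nat \<Rightarrow> (nat \<Rightarrow> real \<times> real \<times> real \<times> real) \<Rightarrow> nat \<Rightarrow> real" where
  "Y_block n z = (\<lambda>i\<in>{..<n}. case z i of (s, x1, x2, y) \<Rightarrow> y)"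

text \<open>The index set \<open>{1, 2, \<dots>, 2\<^bsup>nR\<^esup>}\<close>, where \<open>2\<^bsup>nR\<^esup>\<close> need not be an integer.\<close>

definition code_index :: "nat \<Rightarrow> real \<Rightarrow> nat set" where
  "code_index n R = {m. 1 \<le> m \<and> real m \<le> 2 powr (real n * R)}"

type_synonym encoder = "(nat \<Rightarrow> real) \<times> (nat \<Rightarrow> real) \<times> (nat \<Rightarrow> real) \<Rightarrow> nat"

type_synonym decoder =
  "nat \<times> (nat \<Rightarrow> real) \<Rightarrow> (nat \<Rightarrow> real) \<times> (nat \<Rightarrow> real) \<times> (nat \<Rightarrow> real)"

text \<open>The encoder sees \<open>(X1\<^sup>n, X2\<^sup>n, Y\<^sup>n)\<close>; the decoder sees the index and \<open>Y\<^sup>n\<close> and outputs the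
  reconstructions of \<open>(X1\<^sup>n, X2\<^sup>n, S\<^sup>n)\<close>, in this order.\<close>

definition is_code :: "nat \<Rightarrow> real \<Rightarrow> encoder \<Rightarrow> decoder \<Rightarrow> bool" where
  "is_code n R enc dec \<longleftrightarrow>
     enc \<in> seqs n \<Otimes>\<^sub>M seqs n \<Otimes>\<^sub>M seqs n \<rightarrow>\<^sub>M count_space (code_index n R) \<and>
     dec \<in> count_space (code_index n R) \<Otimes>\<^sub>M seqs n \<rightarrow>\<^sub>M seqs n \<Otimes>\<^sub>M seqs n \<Otimes>\<^sub>M seqs n"

definition reconstruct ::
  "nat \<Rightarrow> encoder \<Rightarrow> decoder \<Rightarrow> (nat \<Rightarrow> real \<times> real \<times> real \<times> real)
     \<Rightarrow> (nat \<Rightarrow> real) \<times> (nat \<Rightarrow> real) \<times> (nat \<Rightarrow> real)" where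
  "reconstruct n enc dec z = dec (enc (X1_block n z, X2_block n z, Y_block n z), Y_block n z)"

definition expected_d1 where
  "expected_d1 P n enc dec =
     (\<integral>\<^sup>+ z. ennreal (sq_distortion n (X1_block n z) (fst (reconstruct n enc dec z))) \<partial>P)"

definition expected_d2 where
  "expected_d2 P n enc dec =
     (\<integral>\<^sup>+ z. ennreal (sq_distortion n (X2_block n z) (fst (snd (reconstruct n enc dec z)))) \<partial>P)"

definition expected_ds where
  "expected_ds P n enc dec =
     (\<integral>\<^sup>+ z. ennreal (sq_distortion n (S_block n z) (snd (snd (reconstruct n enc dec z)))) \<partial>P)"

definition achievable ::
  "'a measure \<Rightarrow> ('a \<Rightarrow> real) \<Rightarrow> ('a \<Rightarrow> real) \<Rightarrow> ('a \<Rightarrow> real) \<Rightarrow> ('a \<Rightarrow> real)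
     \<Rightarrow> real \<Rightarrow> real \<Rightarrow> real \<Rightarrow> real \<Rightarrow> bool" where
  "achievable M S X1 X2 Y R D1 D2 Ds \<longleftrightarrow>
     0 \<le> R \<and> 0 \<le> D1 \<and> 0 \<le> D2 \<and> 0 \<le> Ds \<and>
     (\<exists>(enc :: nat \<Rightarrow> encoder) (dec :: nat \<Rightarrow> decoder) L1 L2 Ls.
        (\<forall>\<^sub>F n in sequentially. is_code n R (enc n) (dec n)) \<and>
        (\<lambda>n. expected_d1 (iid_source M S X1 X2 Y n) n (enc n) (dec n)) \<longlonglongrightarrow> L1 \<and> L1 \<le> ennreal D1 \<and>
        (\<lambda>n. expected_d2 (iid_source M S X1 X2 Y n) n (enc n) (dec n)) \<longlonglongrightarrow> L2 \<and> L2 \<le> ennreal D2 \<and>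
        (\<lambda>n. expected_ds (iid_source M S X1 X2 Y n) n (enc n) (dec n)) \<longlonglongrightarrow> Ls \<and> Ls \<le> ennreal Ds)"

text \<open>Extended-real valued, so that the infimum of the empty set is \<open>\<infinity>\<close>.\<close>

definition rate_distortion ::
  "'a measure \<Rightarrow> ('a \<Rightarrow> real) \<Rightarrow> ('a \<Rightarrow> real) \<Rightarrow> ('a \<Rightarrow> real) \<Rightarrow> ('a \<Rightarrow> real)
     \<Rightarrow> real \<Rightarrow> real \<Rightarrow> real \<Rightarrow> ereal" where
  "rate_distortion M S X1 X2 Y D1 D2 Ds =
     (INF R \<in> {R. achievable M S X1 X2 Y R D1 D2 Ds}. ereal R)"

subsection \<open>Conventions for the closed form\<close>

text \<open>Base-2 logarithm of a nonnegative real, with \<open>log 0 = -\<infinity>\<close> (the library has \<open>ln 0 = 0\<close>).\<close>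

definition elog2 :: "real \<Rightarrow> ereal" where
  "elog2 x = (if x = 0 then -\<infinity> else ereal (log 2 x))"

definition pos_part :: "ereal \<Rightarrow> ereal" where
  "pos_part a = max a 0"

end

theory Submission
  imports Defs "HOL-Real_Asymp.Real_Asymp"
begin

text \<open>The Markov chains make \<open>W = S - c X1\<close>, \<open>Z1 = X1 - a Y\<close>, \<open>Z2 = X2 - b Y\<close> and \<open>Y\<close> independent
  Gaussians, where \<open>a\<close>, \<open>b\<close>, \<open>c\<close> are regression coefficients.  Encoder and decoder both know \<open>Y\<close>, so
  the problem is to describe the independent residuals \<open>Z1\<close> and \<open>Z2\<close>; since \<open>W\<close> is invisible to the encoder,
  distortion \<open>Ds\<close> for \<open>S\<close> means distortion \<open>(Ds - mmse) / c\<^sup>2\<close> for \<open>X1\<close>.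

  Converse: if \<open>\<ell>\<close> is the log-likelihood ratio of a Gaussian of variance \<open>D\<close> centred at the reproduction
  against the source, then \<open>E exp \<ell>\<close> is at most the number of indices, and Jensen's inequality turns this
  into the rate bound.  No mutual information is needed.

  Achievability: independent Gaussian codewords cover typical source blocks by the usual random coding argument,
  with Chernoff bounds for the three quadratic constraints that define typicality.\<close>

subsection \<open>Independence of Gaussian residuals\<close>

text \<open>The description of \<open>Z1\<close> has to meet two demands. A reproduction of
  \<open>X1\<close> multiplied by \<open>c\<close> reproduces \<open>S\<close>, so one codebook for
  \<open>Z1\<close> serves both, at the smaller of \<open>D1\<close> and
  \<open>(Ds - mmse) / c^2\<close>; this is the origin of the maximum in the closed form. In the
  converse the log-likelihoods of \<open>Z1\<close> and \<open>Z2\<close> are added before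
  exponentiating, which charges both rates to the same index set.

  The likelihood ratio also drives achievability. Relative to an independent source block and
  codeword it is the density of the pair in which the source is the codeword plus independent noise
  of variance \<open>D\<close>. A bound for it on typical pairs therefore bounds from below the
  probability that a fresh codeword is typical with a given source block.

  Two obstacles shape the details. Squared error is unbounded, so a small probability of covering
  failure does not alone give small distortion; an exponential moment of the block energy controls
  the remainder. Residual variances may vanish, so independence is derived from characteristic
  functions and conditional probabilities instead of Lebesgue densities.\<close>

text \<open>Normalising \<open>h\<close> to a probability density gives a measure \<open>N\<close>
  under which \<open>U\<close> has the same characteristic function as under \<open>M\<close>, so
  Levy's theorem gives the same law. The weight \<open>h\<close> is the means of bringing a second
  random variable into a one-dimensional uniqueness statement.\<close>

lemma (in prob_space) integral_mult_indicator_if_char: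
  fixes U h :: "'a \<Rightarrow> real"
  assumes [measurable]: "U \<in> borel_measurable M" "h \<in> borel_measurable M"
    and nn: "\<And>\<omega>. 0 \<le> h \<omega>" and bd: "\<And>\<omega>. h \<omega> \<le> K"
    and eq: "\<And>s. (\<integral>\<omega>. h \<omega> *\<^sub>R iexp (s * U \<omega>) \<partial>M) = expectation h *\<^sub>R (\<integral>\<omega>. iexp (s * U \<omega>) \<partial>M)"
    and A[measurable]: "A \<in> sets borel"
  shows "(\<integral>\<omega>. h \<omega> * indicator A (U \<omega>) \<partial>M) = expectation h * (\<integral>\<omega>. indicator A (U \<omega>) \<partial>M)"
proof -
  have int: "integrable M h"
    by (rule integrable_const_bound[where B=K]) (use nn bd in auto)
  define m where "m = expectation h"
  show ?thesis
  proof (cases "m = 0")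
    case True
    then have "AE \<omega> in M. h \<omega> = 0"
      using integral_nonneg_eq_0_iff_AE[OF int] nn by (simp add: m_def)
    then have "(\<integral>\<omega>. h \<omega> * indicator A (U \<omega>) \<partial>M) = (\<integral>\<omega>. 0 \<partial>M)"
      by (intro integral_cong_AE) auto
    then show ?thesis using True by (simp add: m_def)
  next
    case False
    then have m: "m > 0" using Bochner_Integration.integral_nonneg[of M h] nn by (simp add: m_def less_le)
    define N where "N = density M (\<lambda>\<omega>. ennreal (h \<omega> / m))"
    have N[measurable_cong]: "sets N = sets M" by (simp add: N_def)
    have "emeasure N (space N) = (\<integral>\<^sup>+\<omega>. ennreal (h \<omega> / m) \<partial>M)"
      by (simp add: N_def emeasure_density)
    also have "\<dots> = ennreal (\<integral>\<omega>. h \<omega> / m \<partial>M)"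
      by (rule nn_integral_eq_integral) (use int nn m in auto)
    also have "\<dots> = 1" using m by (simp add: m_def)
    finally interpret N: prob_space N by (rule prob_spaceI)
    have "distr N borel U = distr M borel U"
    proof (rule Levy_uniqueness)
      show "real_distribution (distr N borel U)"
        by (rule N.real_distribution_distr) simp
      show "real_distribution (distr M borel U)" by simp
      show "char (distr N borel U) = char (distr M borel U)"
      proof
        fix s
        have "char (distr N borel U) s = (\<integral>\<omega>. iexp (s * U \<omega>) \<partial>N)"
          unfolding char_def by (subst integral_distr) auto
        also have "\<dots> = (\<integral>\<omega>. (h \<omega> / m) *\<^sub>R iexp (s * U \<omega>) \<partial>M)"
          unfolding N_def by (subst integral_density) (use nn m in auto)
        also have "\<dots> = (\<integral>\<omega>. (1 / m) *\<^sub>R (h \<omega> *\<^sub>R iexp (s * U \<omega>)) \<partial>M)" by simp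
        also have "\<dots> = (1 / m) *\<^sub>R (\<integral>\<omega>. h \<omega> *\<^sub>R iexp (s * U \<omega>) \<partial>M)"
          by (rule integral_scaleR_right)
        also have "\<dots> = (\<integral>\<omega>. iexp (s * U \<omega>) \<partial>M)"
          unfolding eq using m by (simp add: m_def)
        also have "\<dots> = char (distr M borel U) s"
          unfolding char_def by (subst integral_distr) auto
        finally show "char (distr N borel U) s = char (distr M borel U) s" .
      qed
    qed
    then have "(\<integral>x. indicator A x \<partial>distr N borel U) = (\<integral>x. indicat_real A x \<partial>distr M borel U)"
      by simp
    then have "(\<integral>\<omega>. indicator A (U \<omega>) \<partial>N) = (\<integral>\<omega>. indicat_real A (U \<omega>) \<partial>M)"
      by (subst (asm) (1 2) integral_distr) auto
    moreover have "(\<integral>\<omega>. indicator A (U \<omega>) \<partial>N) = (\<integral>\<omega>. (1 / m) * (h \<omega> * indicator A (U \<omega>)) \<partial>M)"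
      unfolding N_def by (subst integral_density) (use nn m in auto)
    ultimately show ?thesis using m unfolding m_def by (simp add: field_simps)
  qed
qed

lemma iexp_eq_cos_sin: "iexp x = complex_of_real (cos x) + \<i> * complex_of_real (sin x)"
  by (simp add: exp_Euler cos_of_real sin_of_real)

lemma (in prob_space) expectation_indicator_comp:
  "(\<integral>\<omega>. indicat_real Q (f \<omega>) \<partial>M) = prob (f -` Q \<inter> space M)"
proof -
  have "(\<integral>\<omega>. indicat_real Q (f \<omega>) \<partial>M) = (\<integral>\<omega>. indicat_real (f -` Q) \<omega> \<partial>M)"
    by (simp only: indicator_def vimage_eq)
  then show ?thesis by simp
qed

text \<open>Weighting the law of \<open>U\<close> with the nonnegative densities \<open>1 + cos (t V)\<close> and \<open>1 + sin (t V)\<close>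
  reduces the two-dimensional statement to Levy's one-dimensional uniqueness theorem.\<close>

lemma (in prob_space) indep_var_if_char:
  fixes U V :: "'a \<Rightarrow> real"
  assumes [measurable]: "U \<in> borel_measurable M" "V \<in> borel_measurable M"
    and eq: "\<And>s t. (\<integral>\<omega>. iexp (s * U \<omega> + t * V \<omega>) \<partial>M)
      = (\<integral>\<omega>. iexp (s * U \<omega>) \<partial>M) * (\<integral>\<omega>. iexp (t * V \<omega>) \<partial>M)"
  shows "indep_var borel U borel V"
proof -
  let ?cU = "\<lambda>s. \<integral>\<omega>. iexp (s * U \<omega>) \<partial>M" and ?cV = "\<lambda>t. \<integral>\<omega>. iexp (t * V \<omega>) \<partial>M"
  have bnd[simp]: "integrable M f" if "f \<in> borel_measurable M" "\<And>\<omega>. norm (f \<omega>) \<le> 1" for f :: "'a \<Rightarrow> complex"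
    using that by (intro integrable_const_bound[where B=1]) auto
  have bndr[simp]: "integrable M f" if "f \<in> borel_measurable M" "\<And>\<omega>. \<bar>f \<omega>\<bar> \<le> 1" for f :: "'a \<Rightarrow> real"
    using that by (intro integrable_const_bound[where B=1]) auto
  have ie[simp]: "cmod (iexp x) = 1" for x by (metis norm_exp_i_times)
  have split: "?cV t
      = of_real (\<integral>\<omega>. cos (t * V \<omega>) \<partial>M) + \<i> * of_real (\<integral>\<omega>. sin (t * V \<omega>) \<partial>M)" for t
  proof -
    have "?cV t = (\<integral>\<omega>. complex_of_real (cos (t * V \<omega>)) + \<i> * of_real (sin (t * V \<omega>)) \<partial>M)"
      unfolding iexp_eq_cos_sin ..
    also have "\<dots> = (\<integral>\<omega>. complex_of_real (cos (t * V \<omega>)) \<partial>M) + (\<integral>\<omega>. \<i> * of_real (sin (t * V \<omega>)) \<partial>M)"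
      by (rule Bochner_Integration.integral_add) (auto simp: norm_mult)
    finally show ?thesis by simp
  qed
  have cosE: "(\<integral>\<omega>. cos (t * V \<omega>) *\<^sub>R iexp (s * U \<omega>) \<partial>M)
      = (\<integral>\<omega>. cos (t * V \<omega>) \<partial>M) *\<^sub>R ?cU s" for s t
  proof -
    have "(\<integral>\<omega>. cos (t * V \<omega>) *\<^sub>R iexp (s * U \<omega>) \<partial>M)
        = (\<integral>\<omega>. (1/2) *\<^sub>R (iexp (s * U \<omega> + t * V \<omega>) + iexp (s * U \<omega> + (-t) * V \<omega>)) \<partial>M)"
    proof (rule Bochner_Integration.integral_cong[OF refl])
      fix \<omega>
      show "cos (t * V \<omega>) *\<^sub>R iexp (s * U \<omega>)
        = (1/2) *\<^sub>R (iexp (s * U \<omega> + t * V \<omega>) + iexp (s * U \<omega> + (-t) * V \<omega>))"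
        unfolding iexp_eq_cos_sin by (simp add: complex_eq_iff cos_add sin_add cos_diff sin_diff del: of_real_mult of_real_add)
    qed
    also have "\<dots> = (1/2) *\<^sub>R ((\<integral>\<omega>. iexp (s * U \<omega> + t * V \<omega>) \<partial>M) + (\<integral>\<omega>. iexp (s * U \<omega> + (-t) * V \<omega>) \<partial>M))"
      by (subst integral_scaleR_right, subst Bochner_Integration.integral_add) auto
    also have "\<dots> = (\<integral>\<omega>. cos (t * V \<omega>) \<partial>M) *\<^sub>R ?cU s"
      unfolding eq split by (simp add: algebra_simps scaleR_conv_of_real)
    finally show ?thesis .
  qed
  have sinE: "(\<integral>\<omega>. sin (t * V \<omega>) *\<^sub>R iexp (s * U \<omega>) \<partial>M)
      = (\<integral>\<omega>. sin (t * V \<omega>) \<partial>M) *\<^sub>R ?cU s" for s t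
  proof -
    have "(\<integral>\<omega>. sin (t * V \<omega>) *\<^sub>R iexp (s * U \<omega>) \<partial>M)
        = (\<integral>\<omega>. (-\<i>/2) * (iexp (s * U \<omega> + t * V \<omega>) - iexp (s * U \<omega> + (-t) * V \<omega>)) \<partial>M)"
    proof (rule Bochner_Integration.integral_cong[OF refl])
      fix \<omega>
      show "sin (t * V \<omega>) *\<^sub>R iexp (s * U \<omega>)
        = (-\<i>/2) * (iexp (s * U \<omega> + t * V \<omega>) - iexp (s * U \<omega> + (-t) * V \<omega>))"
        unfolding iexp_eq_cos_sin by (simp add: complex_eq_iff cos_add sin_add cos_diff sin_diff del: of_real_mult of_real_add)
    qed
    also have "\<dots> = (-\<i>/2) * ((\<integral>\<omega>. iexp (s * U \<omega> + t * V \<omega>) \<partial>M) - (\<integral>\<omega>. iexp (s * U \<omega> + (-t) * V \<omega>) \<partial>M))"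
      by (subst integral_mult_right_zero, subst Bochner_Integration.integral_diff) auto
    also have "\<dots> = (\<integral>\<omega>. sin (t * V \<omega>) \<partial>M) *\<^sub>R ?cU s"
      unfolding eq split by (simp add: algebra_simps scaleR_conv_of_real)
    finally show ?thesis .
  qed
  have c_ind: "(\<integral>\<omega>. g (t * V \<omega>) * indicator A (U \<omega>) \<partial>M)
      = (\<integral>\<omega>. g (t * V \<omega>) \<partial>M) * (\<integral>\<omega>. indicator A (U \<omega>) \<partial>M)"
    if g: "\<And>s. (\<integral>\<omega>. g (t * V \<omega>) *\<^sub>R iexp (s * U \<omega>) \<partial>M) = (\<integral>\<omega>. g (t * V \<omega>) \<partial>M) *\<^sub>R ?cU s"
      and [measurable]: "g \<in> borel_measurable borel" and g1: "\<And>x. \<bar>g x\<bar> \<le> 1"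
      and [measurable]: "A \<in> sets borel" for t A and g :: "real \<Rightarrow> real"
  proof -
    have g2: "g x \<le> 1" "-1 \<le> g x" for x using g1[of x] by auto
    have "(\<integral>\<omega>. (1 + g (t * V \<omega>)) * indicator A (U \<omega>) \<partial>M)
        = expectation (\<lambda>\<omega>. 1 + g (t * V \<omega>)) * (\<integral>\<omega>. indicator A (U \<omega>) \<partial>M)"
    proof (rule integral_mult_indicator_if_char[where K=2])
      fix s
      have "(\<integral>\<omega>. (1 + g (t * V \<omega>)) *\<^sub>R iexp (s * U \<omega>) \<partial>M)
         = ?cU s + (\<integral>\<omega>. g (t * V \<omega>) *\<^sub>R iexp (s * U \<omega>) \<partial>M)"
        by (subst Bochner_Integration.integral_add[symmetric]) (auto simp: g1 scaleR_add_left)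
      also have "\<dots> = expectation (\<lambda>\<omega>. 1 + g (t * V \<omega>)) *\<^sub>R ?cU s"
        unfolding g by (subst Bochner_Integration.integral_add) (auto simp: g1 scaleR_add_left prob_space)
      finally show "(\<integral>\<omega>. (1 + g (t * V \<omega>)) *\<^sub>R iexp (s * U \<omega>) \<partial>M)
          = expectation (\<lambda>\<omega>. 1 + g (t * V \<omega>)) *\<^sub>R ?cU s" .
    qed (use g2 in \<open>auto simp: add.commute intro: order.trans\<close>, smt (verit) g2)
    moreover have "(\<integral>\<omega>. (1 + g (t * V \<omega>)) * indicator A (U \<omega>) \<partial>M)
        = (\<integral>\<omega>. indicator A (U \<omega>) \<partial>M) + (\<integral>\<omega>. g (t * V \<omega>) * indicator A (U \<omega>) \<partial>M)"
      by (subst Bochner_Integration.integral_add[symmetric]) (auto simp: g1 algebra_simps indicator_def)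
    moreover have "expectation (\<lambda>\<omega>. 1 + g (t * V \<omega>)) = 1 + (\<integral>\<omega>. g (t * V \<omega>) \<partial>M)"
      by (subst Bochner_Integration.integral_add) (auto simp: g1 prob_space)
    ultimately show ?thesis by (simp add: algebra_simps)
  qed
  \<comment> \<open>Second use of the weighted uniqueness lemma, with the variables exchanged: the
    weight is now the indicator of \<open>U \<in> A\<close> and the variable is \<open>V\<close>.
    Its hypothesis on characteristic functions is \<open>c_ind\<close> for cosine and sine.\<close>
  have prod: "(\<integral>\<omega>. indicator A (U \<omega>) * indicator B (V \<omega>) \<partial>M)
      = (\<integral>\<omega>. indicator A (U \<omega>) \<partial>M) * (\<integral>\<omega>. indicat_real B (V \<omega>) \<partial>M)"
    if A[measurable]: "A \<in> sets borel" and [measurable]: "B \<in> sets borel" for A B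
  proof (rule integral_mult_indicator_if_char[where K=1])
    fix t
    have "(\<integral>\<omega>. (indicator A (U \<omega>) :: real) *\<^sub>R iexp (t * V \<omega>) \<partial>M)
       = (\<integral>\<omega>. complex_of_real (cos (t * V \<omega>) * indicator A (U \<omega>)) + \<i> * of_real (sin (t * V \<omega>) * indicator A (U \<omega>)) \<partial>M)"
      unfolding iexp_eq_cos_sin by (intro Bochner_Integration.integral_cong)
        (simp_all add: complex_eq_iff algebra_simps del: of_real_mult of_real_add)
    also have "\<dots> = (\<integral>\<omega>. complex_of_real (cos (t * V \<omega>) * indicator A (U \<omega>)) \<partial>M)
        + (\<integral>\<omega>. \<i> * of_real (sin (t * V \<omega>) * indicator A (U \<omega>)) \<partial>M)"
      by (rule Bochner_Integration.integral_add) (auto simp: norm_mult indicator_def)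
    also have "\<dots> = of_real (\<integral>\<omega>. cos (t * V \<omega>) * indicator A (U \<omega>) \<partial>M)
        + \<i> * of_real (\<integral>\<omega>. sin (t * V \<omega>) * indicator A (U \<omega>) \<partial>M)"
      by (simp del: of_real_mult)
    also have "\<dots> = expectation (\<lambda>\<omega>. indicator A (U \<omega>)) *\<^sub>R ?cV t"
      unfolding c_ind[of cos, OF cosE borel_measurable_cos abs_cos_le_one A]
        c_ind[of sin, OF sinE borel_measurable_sin abs_sin_le_one A] split
      by (simp add: scaleR_conv_of_real algebra_simps)
    finally show "(\<integral>\<omega>. (indicator A (U \<omega>) :: real) *\<^sub>R iexp (t * V \<omega>) \<partial>M)
       = expectation (\<lambda>\<omega>. indicator A (U \<omega>)) *\<^sub>R ?cV t" .
  qed (auto simp: indicator_def)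
  have "distr M borel U \<Otimes>\<^sub>M distr M borel V = distr M (borel \<Otimes>\<^sub>M borel) (\<lambda>x. (U x, V x))"
  proof (rule pair_measure_eqI)
    interpret U: prob_space "distr M borel U" by (rule prob_space_distr) simp
    interpret V: prob_space "distr M borel V" by (rule prob_space_distr) simp
    show "sigma_finite_measure (distr M borel U)" "sigma_finite_measure (distr M borel V)"
      by unfold_locales
    fix A B :: "real set" assume "A \<in> sets (distr M borel U)" "B \<in> sets (distr M borel V)"
    then have [measurable]: "A \<in> sets borel" "B \<in> sets borel" by auto
    have i3: "(\<integral>\<omega>. indicat_real A (U \<omega>) * indicat_real B (V \<omega>) \<partial>M) = prob ((\<lambda>x. (U x, V x)) -` (A \<times> B) \<inter> space M)"
      unfolding expectation_indicator_comp[symmetric] by (simp add: indicator_times)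
    show "emeasure (distr M borel U) A * emeasure (distr M borel V) B
        = emeasure (distr M (borel \<Otimes>\<^sub>M borel) (\<lambda>x. (U x, V x))) (A \<times> B)"
      using prod[of A B] unfolding i3 expectation_indicator_comp
      by (simp add: emeasure_distr emeasure_eq_measure ennreal_mult'[symmetric])
  qed simp
  then show ?thesis by (simp add: indep_var_distribution_eq)
qed

section \<open>Centered normal laws and linear regression\<close>

text \<open>The parameter is the variance. The value 0 gives the point mass, because a residual
  variance vanishes when one variable is an affine function of another.\<close>

definition centered_normal :: "real \<Rightarrow> real measure" where
  "centered_normal v = (if v > 0 then density lborel (normal_density 0 (sqrt v)) else return borel 0)"

lemma sets_centered_normal[simp, measurable_cong]: "sets (centered_normal v) = sets borel"
  by (simp add: centered_normal_def)

lemma space_centered_normal[simp]: "space (centered_normal v) = UNIV"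
  by (simp add: centered_normal_def)

lemma prob_space_centered_normal: "prob_space (centered_normal v)"
  by (simp add: centered_normal_def prob_space_normal_density prob_space_return)

lemma (in prob_space) gaussian_centered:
  assumes "gaussian M X" and mean: "expectation X = 0"
  shows "distr M borel X = centered_normal (variance X)" and "integrable M (\<lambda>\<omega>. (X \<omega>)\<^sup>2)"
proof -
  have [measurable]: "X \<in> borel_measurable M" using assms by (simp add: gaussian_def)
  obtain \<mu> s where "(s > 0 \<and> distributed M lborel X (normal_density \<mu> s)) \<or> (s = 0 \<and> distr M borel X = return borel \<mu>)"
    using assms by (auto simp: gaussian_def)
  then have "distr M borel X = centered_normal (variance X) \<and> integrable M (\<lambda>\<omega>. (X \<omega>)\<^sup>2)"
  proof
    assume "s > 0 \<and> distributed M lborel X (normal_density \<mu> s)"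
    then have s: "s > 0" and D: "distributed M lborel X (normal_density \<mu> s)" by auto
    have \<mu>: "\<mu> = 0" using normal_distributed_expectation[OF s D] mean by simp
    have v: "variance X = s\<^sup>2" by (rule normal_distributed_variance[OF s D])
    have "distr M borel X = distr M lborel X" by (rule distr_cong) auto
    also have "\<dots> = density lborel (normal_density \<mu> s)"
      by (rule distributed_distr_eq_density[OF D])
    finally have "distr M borel X = centered_normal (variance X)"
      unfolding v using s by (simp add: centered_normal_def \<mu>)
    moreover have "integrable lborel (\<lambda>x. normal_density \<mu> s x * (x - \<mu>)\<^sup>2)"
      by (rule integrable_normal_moment[OF s])
    then have "integrable M (\<lambda>\<omega>. (X \<omega>)\<^sup>2)"
      by (subst (asm) distributed_integrable[OF D]) (auto simp: \<mu>)
    ultimately show ?thesis by blast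
  next
    assume "s = 0 \<and> distr M borel X = return borel \<mu>"
    then have D: "distr M borel X = return borel \<mu>" by simp
    have "AE x in distr M borel X. x = \<mu>" unfolding D by (subst AE_return) auto
    then have ae: "AE \<omega> in M. X \<omega> = \<mu>" by (subst (asm) AE_distr_iff) auto
    have "expectation X = expectation (\<lambda>_. \<mu>)" using ae by (intro integral_cong_AE) auto
    then have \<mu>: "\<mu> = 0" using mean by (simp add: prob_space)
    have "variance X = expectation (\<lambda>_. 0)"
      unfolding mean using ae by (intro integral_cong_AE) (auto simp: \<mu>)
    then have "variance X = 0" by simp
    then have "distr M borel X = centered_normal (variance X)"
      unfolding D by (simp add: centered_normal_def \<mu>)
    moreover have "integrable M (\<lambda>\<omega>. (X \<omega>)\<^sup>2)"
      by (rule integrable_cong_AE_imp[of M "\<lambda>_. 0"]) (use ae \<mu> in auto)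
    ultimately show ?thesis by blast
  qed
  then show "distr M borel X = centered_normal (variance X)" "integrable M (\<lambda>\<omega>. (X \<omega>)\<^sup>2)" by auto
qed

lemma char_centered_normal:
  assumes "v \<ge> 0"
  shows "char (centered_normal v) t = of_real (exp (- (v * t\<^sup>2) / 2))"
proof (cases "v = 0")
  case True
  then show ?thesis by (simp add: centered_normal_def char_def integral_return)
next
  case False
  then have v: "v > 0" using assms by simp
  interpret prob_space std_normal_distribution
    using real_dist_normal_dist unfolding real_distribution_def by blast
  have "distributed std_normal_distribution lborel (\<lambda>x. x) std_normal_density"
    unfolding distributed_def by (auto simp: distr_id2)
  from normal_density_affine[OF this, of "sqrt v" 0]
  have "distributed std_normal_distribution lborel (\<lambda>x. sqrt v * x) (normal_density 0 (sqrt v))"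
    using v by simp
  then have "distr std_normal_distribution lborel (\<lambda>x. sqrt v * x) = density lborel (normal_density 0 (sqrt v))"
    by (simp add: distributed_def)
  then have "centered_normal v = distr std_normal_distribution lborel (\<lambda>x. sqrt v * x)"
    using v by (simp add: centered_normal_def)
  then have "char (centered_normal v) t = char std_normal_distribution (t * sqrt v)"
    unfolding char_def by (simp add: integral_distr mult.assoc)
  also have "\<dots> = of_real (exp (- (v * t\<^sup>2) / 2))"
    unfolding char_std_normal_distribution using v by (simp add: power_mult_distrib mult.commute)
  finally show ?thesis .
qed

lemma (in prob_space) gaussian_char:
  assumes "gaussian M X" "expectation X = 0"
  shows "(\<integral>\<omega>. iexp (X \<omega>) \<partial>M) = of_real (exp (- expectation (\<lambda>\<omega>. (X \<omega>)\<^sup>2) / 2))"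
proof -
  have [measurable]: "X \<in> borel_measurable M" using assms by (simp add: gaussian_def)
  have "(\<integral>\<omega>. iexp (X \<omega>) \<partial>M) = char (distr M borel X) 1"
    unfolding char_def by (subst integral_distr) auto
  also have "\<dots> = of_real (exp (- expectation (\<lambda>\<omega>. (X \<omega>)\<^sup>2) / 2))"
    unfolding gaussian_centered(1)[OF assms] by (subst char_centered_normal) (auto simp: assms)
  finally show ?thesis .
qed

lemma integrable_mult_if_square:
  fixes f g :: "'a \<Rightarrow> real"
  assumes [measurable]: "f \<in> borel_measurable M" "g \<in> borel_measurable M"
    and "integrable M (\<lambda>x. (f x)\<^sup>2)" "integrable M (\<lambda>x. (g x)\<^sup>2)"
  shows "integrable M (\<lambda>x. f x * g x)"
proof (rule Bochner_Integration.integrable_bound)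
  show "integrable M (\<lambda>x. (f x)\<^sup>2 + (g x)\<^sup>2)" using assms by simp
  have "\<bar>a * b\<bar> \<le> a\<^sup>2 + b\<^sup>2" for a b :: real
  proof -
    have "2 * (\<bar>a\<bar> * \<bar>b\<bar>) \<le> a\<^sup>2 + b\<^sup>2" using sum_squares_bound[of "\<bar>a\<bar>" "\<bar>b\<bar>"] by simp
    moreover have "0 \<le> \<bar>a\<bar> * \<bar>b\<bar>" by simp
    ultimately show ?thesis unfolding abs_mult by linarith
  qed
  then show "AE x in M. norm (f x * g x) \<le> norm ((f x)\<^sup>2 + (g x)\<^sup>2)" by simp
qed simp

text \<open>The coefficient \<open>c\<close> makes \<open>W\<close> uncorrelated with
  \<open>B\<close>. Every \<open>s W + t B\<close> is again Gaussian, with variance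
  \<open>s^2 E W^2 + t^2 E B^2\<close>, so its characteristic function factors; this argument covers
  a degenerate \<open>W\<close> as well.\<close>

lemma (in prob_space) gaussian_regression:
  fixes A B :: "'a \<Rightarrow> real"
  assumes g: "\<And>s t. gaussian M (\<lambda>\<omega>. s * A \<omega> + t * B \<omega>)"
    and mA: "expectation A = 0" and mB: "expectation B = 0"
    and vB: "variance B > 0"
  defines "c \<equiv> covariance M A B / variance B"
  defines "W \<equiv> \<lambda>\<omega>. A \<omega> - c * B \<omega>"
  shows "indep_var borel W borel B"
    and "distr M borel W = centered_normal (variance A - (covariance M A B)\<^sup>2 / variance B)"
    and "0 \<le> variance A - (covariance M A B)\<^sup>2 / variance B"
proof -
  have gA: "gaussian M A" using g[of 1 0] by simp
  have gB: "gaussian M B" using g[of 0 1] by simp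
  have gW: "gaussian M (\<lambda>\<omega>. s * W \<omega> + t * B \<omega>)" for s t
  proof -
    have "(\<lambda>\<omega>. s * W \<omega> + t * B \<omega>) = (\<lambda>\<omega>. s * A \<omega> + (t - s * c) * B \<omega>)"
      by (simp add: W_def algebra_simps)
    then show ?thesis using g by simp
  qed
  have [measurable]: "A \<in> borel_measurable M" "B \<in> borel_measurable M"
    using gA gB by (auto simp: gaussian_def)
  have [measurable]: "W \<in> borel_measurable M" by (simp add: W_def)
  note sA = gaussian_centered(2)[OF gA mA] and sB = gaussian_centered(2)[OF gB mB]
  have [simp]: "integrable M A" "integrable M B"
    using sA sB by (auto intro: square_integrable_imp_integrable)
  have [simp]: "integrable M (\<lambda>\<omega>. (A \<omega>)\<^sup>2)" "integrable M (\<lambda>\<omega>. (B \<omega>)\<^sup>2)" "integrable M (\<lambda>\<omega>. A \<omega> * B \<omega>)"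
    using sA sB by (auto intro: integrable_mult_if_square)
  define K where "K = expectation (\<lambda>\<omega>. A \<omega> * B \<omega>)"
  have cov: "covariance M A B = K" by (simp add: covariance_def K_def mA mB)
  have vA: "variance A = expectation (\<lambda>\<omega>. (A \<omega>)\<^sup>2)" by (simp add: mA)
  define b where "b = expectation (\<lambda>\<omega>. (B \<omega>)\<^sup>2)"
  have vb: "variance B = b" by (simp add: b_def mB)
  have b: "b > 0" using vB by (simp only: vb)
  have c: "c = K / b" by (simp only: c_def cov vb)
  have [simp]: "integrable M W" by (simp add: W_def)
  have mW: "expectation W = 0" by (simp add: W_def mA mB)
  have WB: "(\<lambda>\<omega>. W \<omega> * B \<omega>) = (\<lambda>\<omega>. A \<omega> * B \<omega> - c * (B \<omega>)\<^sup>2)"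
    by (simp add: W_def power2_eq_square algebra_simps)
  have [simp]: "integrable M (\<lambda>\<omega>. W \<omega> * B \<omega>)" by (simp add: WB)
  have EWB: "expectation (\<lambda>\<omega>. W \<omega> * B \<omega>) = 0" using b by (simp add: WB c flip: K_def b_def)
  have WW: "(\<lambda>\<omega>. (W \<omega>)\<^sup>2) = (\<lambda>\<omega>. (A \<omega>)\<^sup>2 - 2 * c * (A \<omega> * B \<omega>) + c\<^sup>2 * (B \<omega>)\<^sup>2)"
    by (simp add: W_def power2_eq_square algebra_simps)
  have [simp]: "integrable M (\<lambda>\<omega>. (W \<omega>)\<^sup>2)" by (simp add: WW)
  have "expectation (\<lambda>\<omega>. (W \<omega>)\<^sup>2) = variance A - 2 * c * K + c\<^sup>2 * b"
    by (simp add: WW vA flip: K_def b_def)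
  also have "\<dots> = variance A - K\<^sup>2 / b" using b by (simp add: c power2_eq_square field_simps)
  finally have EWW: "expectation (\<lambda>\<omega>. (W \<omega>)\<^sup>2) = variance A - (covariance M A B)\<^sup>2 / variance B"
    by (simp only: cov vb)
  show "0 \<le> variance A - (covariance M A B)\<^sup>2 / variance B"
    unfolding EWW[symmetric] by simp
  show "distr M borel W = centered_normal (variance A - (covariance M A B)\<^sup>2 / variance B)"
    unfolding EWW[symmetric] using gaussian_centered(1)[of W] gW[of 1 0] by (simp add: mW)
  have chr: "(\<integral>\<omega>. iexp (s * W \<omega> + t * B \<omega>) \<partial>M)
      = of_real (exp (- (s\<^sup>2 * expectation (\<lambda>\<omega>. (W \<omega>)\<^sup>2) + t\<^sup>2 * b) / 2))" for s t
  proof -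
    have "(\<lambda>\<omega>. (s * W \<omega> + t * B \<omega>)\<^sup>2) = (\<lambda>\<omega>. s\<^sup>2 * (W \<omega>)\<^sup>2 + 2 * s * t * (W \<omega> * B \<omega>) + t\<^sup>2 * (B \<omega>)\<^sup>2)"
      by (simp add: power2_eq_square algebra_simps)
    then have "expectation (\<lambda>\<omega>. (s * W \<omega> + t * B \<omega>)\<^sup>2) = s\<^sup>2 * expectation (\<lambda>\<omega>. (W \<omega>)\<^sup>2) + t\<^sup>2 * b"
      by (simp add: EWB flip: b_def)
    then show ?thesis by (subst gaussian_char[OF gW]) (auto simp: mW mB)
  qed
  show "indep_var borel W borel B"
  proof (rule indep_var_if_char)
    fix s t
    show "(\<integral>\<omega>. iexp (s * W \<omega> + t * B \<omega>) \<partial>M) = (\<integral>\<omega>. iexp (s * W \<omega>) \<partial>M) * (\<integral>\<omega>. iexp (t * B \<omega>) \<partial>M)"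
      using chr[of s t] chr[of s 0] chr[of 0 t]
      by (simp add: exp_add[symmetric] add_divide_distrib diff_divide_distrib flip: of_real_mult)
  qed simp_all
qed

lemma measure_eqI_pair:
  assumes "finite_measure \<mu>" and s: "sets \<mu> = sets (A \<Otimes>\<^sub>M B)" "sets \<nu> = sets (A \<Otimes>\<^sub>M B)"
    and eq: "\<And>a b. a \<in> sets A \<Longrightarrow> b \<in> sets B \<Longrightarrow> emeasure \<mu> (a \<times> b) = emeasure \<nu> (a \<times> b)"
  shows "\<mu> = \<nu>"
proof -
  interpret finite_measure \<mu> by fact
  let ?E = "{a \<times> b | a b. a \<in> sets A \<and> b \<in> sets B}"
  show ?thesis
  proof (rule measure_eqI_generator_eq[OF Int_stable_pair_measure_generator[of A B], where A="\<lambda>_. space A \<times> space B"])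
    show "?E \<subseteq> Pow (space A \<times> space B)" by (rule pair_measure_closed)
    show "sets \<mu> = sigma_sets (space A \<times> space B) ?E" "sets \<nu> = sigma_sets (space A \<times> space B) ?E"
      using s by (simp_all add: sets_pair_measure)
  qed (auto intro: eq)
qed

text \<open>Given the Markov chain \<open>A - B - C\<close> with \<open>A = c B + W\<close>, the conditional probability of
  \<open>A \<in> U\<close> given \<open>B = b\<close> is \<open>P (c b + W \<in> U)\<close>, so that conditioning on \<open>C\<close> as well leaves it unchanged.\<close>

lemma (in prob_space) markov_chain_indep_residual:
  fixes A B :: "'a \<Rightarrow> real" and c :: real
  assumes markov: "markov_chain M borel A borel B MC C"
  defines "W \<equiv> \<lambda>\<omega>. A \<omega> - c * B \<omega>"
  assumes ind: "indep_var borel W borel B"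
  shows "distr M (borel \<Otimes>\<^sub>M (borel \<Otimes>\<^sub>M MC)) (\<lambda>\<omega>. (W \<omega>, B \<omega>, C \<omega>))
    = distr M borel W \<Otimes>\<^sub>M distr M (borel \<Otimes>\<^sub>M MC) (\<lambda>\<omega>. (B \<omega>, C \<omega>))"
proof -
  have [measurable]: "A \<in> borel_measurable M" "B \<in> borel_measurable M" "C \<in> M \<rightarrow>\<^sub>M MC"
    using markov by (auto simp: markov_chain_def)
  have [measurable]: "W \<in> borel_measurable M" by (simp add: W_def)
  have joint: "distr M borel W \<Otimes>\<^sub>M distr M borel B = distr M (borel \<Otimes>\<^sub>M borel) (\<lambda>x. (W x, B x))"
    using ind by (simp add: indep_var_distribution_eq)
  interpret W: prob_space "distr M borel W" by (rule prob_space_distr) simp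
  interpret BC: prob_space "distr M (borel \<Otimes>\<^sub>M MC) (\<lambda>\<omega>. (B \<omega>, C \<omega>))" by (rule prob_space_distr) simp
  define F where "F = vimage_algebra (space M) B borel"
  have subF: "subalgebra M F"
    unfolding subalgebra_def F_def by (auto simp: sets_vimage_algebra2)
  interpret finite_measure_subalgebra M F
    by unfold_locales (rule subF)
  have BF[measurable]: "B \<in> F \<rightarrow>\<^sub>M borel" unfolding F_def by (rule measurable_vimage_algebra1) auto
  define \<kappa> where "\<kappa> U b = (\<integral>w. indicat_real U (c * b + w) \<partial>distr M borel W)" for U b
  have k_meas: "\<kappa> U \<in> borel_measurable borel" if [measurable]: "U \<in> sets borel" for U
    unfolding \<kappa>_def by measurable
  have k01: "0 \<le> \<kappa> U b" "\<kappa> U b \<le> 1" if [measurable]: "U \<in> sets borel" for U b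
  proof -
    show "0 \<le> \<kappa> U b" by (simp add: \<kappa>_def)
    have "\<kappa> U b \<le> (\<integral>w. 1 \<partial>distr M borel W)"
      unfolding \<kappa>_def
      by (intro integral_mono W.integrable_const_bound[where B=1]) (auto simp: indicator_def)
    also have "\<dots> = 1" using W.prob_space by simp
    finally show "\<kappa> U b \<le> 1" .
  qed
  have ibd[simp]: "integrable M f" if "f \<in> borel_measurable M" "\<And>x. \<bar>f x\<bar> \<le> 1" for f :: "'a \<Rightarrow> real"
    using that by (intro integrable_const_bound[where B=1]) auto
  have key: "(\<integral>\<omega>. indicat_real U (A \<omega>) * indicat_real G (B \<omega>) \<partial>M) = (\<integral>\<omega>. \<kappa> U (B \<omega>) * indicat_real G (B \<omega>) \<partial>M)"
    if [measurable]: "U \<in> sets borel" "G \<in> sets borel" for U G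
  proof -
    interpret B: prob_space "distr M borel B" by (rule prob_space_distr) simp
    interpret BW: pair_prob_space "distr M borel W" "distr M borel B" ..
    have "(\<integral>\<omega>. indicat_real U (A \<omega>) * indicat_real G (B \<omega>) \<partial>M)
        = (\<integral>x. indicat_real U (c * snd x + fst x) * indicat_real G (snd x) \<partial>distr M (borel \<Otimes>\<^sub>M borel) (\<lambda>x. (W x, B x)))"
      by (subst integral_distr) (auto simp: W_def)
    also have "\<dots> = (\<integral>x. indicat_real U (c * snd x + fst x) * indicat_real G (snd x) \<partial>(distr M borel W \<Otimes>\<^sub>M distr M borel B))"
      by (simp only: joint)
    also have "\<dots> = (\<integral>b. \<integral>w. indicat_real U (c * b + w) * indicat_real G b \<partial>distr M borel W \<partial>distr M borel B)"
      by (subst BW.integral_snd[of "\<lambda>w b. indicat_real U (c * b + w) * indicat_real G b"])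
        (auto intro!: BW.integrable_const_bound[where B=1] simp: indicator_def split_beta')
    also have "\<dots> = (\<integral>b. \<kappa> U b * indicat_real G b \<partial>distr M borel B)"
      by (simp add: \<kappa>_def)
    also have "\<dots> = (\<integral>\<omega>. \<kappa> U (B \<omega>) * indicat_real G (B \<omega>) \<partial>M)"
      using k_meas by (subst integral_distr) auto
    finally show ?thesis .
  qed
  have ce: "AE \<omega> in M. real_cond_exp M F (\<lambda>\<omega>. indicat_real U (A \<omega>)) \<omega> = \<kappa> U (B \<omega>)"
    if U[measurable]: "U \<in> sets borel" for U
  proof (rule real_cond_exp_charact)
    note k_meas[measurable]
    fix X assume "X \<in> sets F"
    then obtain G where G[measurable]: "G \<in> sets borel" and X: "X = B -` G \<inter> space M"
      by (auto simp: F_def sets_vimage_algebra2)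
    have "(\<integral>\<omega>\<in>X. indicat_real U (A \<omega>) \<partial>M) = (\<integral>\<omega>. indicat_real U (A \<omega>) * indicat_real G (B \<omega>) \<partial>M)"
      unfolding set_lebesgue_integral_def
      by (intro Bochner_Integration.integral_cong) (auto simp: X indicator_def)
    also have "\<dots> = (\<integral>\<omega>\<in>X. \<kappa> U (B \<omega>) \<partial>M)"
      unfolding set_lebesgue_integral_def key[OF U G]
      by (intro Bochner_Integration.integral_cong) (auto simp: X indicator_def)
    finally show "(\<integral>\<omega>\<in>X. indicat_real U (A \<omega>) \<partial>M) = (\<integral>\<omega>\<in>X. \<kappa> U (B \<omega>) \<partial>M)" .
  qed (use k_meas k01 in \<open>auto simp: abs_le_iff intro: order.trans[of _ 0]\<close>)
  \<comment> \<open>The Markov property enters here. Given \<open>B\<close>, the conditional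
    expectation of the product splits, its first factor is \<open>\<kappa> U (B \<omega>)\<close>,
    and integrating against a function of \<open>B\<close> removes the remaining conditional
    expectation.\<close>
  have full: "(\<integral>\<omega>. indicat_real G (B \<omega>) * (indicat_real U (A \<omega>) * indicat_real V (C \<omega>)) \<partial>M)
      = (\<integral>\<omega>. \<kappa> U (B \<omega>) * indicat_real G (B \<omega>) * indicat_real V (C \<omega>) \<partial>M)"
    if [measurable]: "U \<in> sets borel" "G \<in> sets borel" "V \<in> sets MC" for U G V
  proof -
    note k_meas[measurable]
    have m: "AE \<omega> in M. real_cond_exp M F (\<lambda>\<omega>. indicator U (A \<omega>) * indicator V (C \<omega>)) \<omega>
        = real_cond_exp M F (\<lambda>\<omega>. indicator U (A \<omega>)) \<omega> * real_cond_exp M F (\<lambda>\<omega>. indicator V (C \<omega>)) \<omega>"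
      using markov that unfolding markov_chain_def Let_def F_def by blast
    have "(\<integral>\<omega>. indicat_real G (B \<omega>) * (indicat_real U (A \<omega>) * indicat_real V (C \<omega>)) \<partial>M)
       = (\<integral>\<omega>. indicat_real G (B \<omega>) * real_cond_exp M F (\<lambda>\<omega>. indicat_real U (A \<omega>) * indicat_real V (C \<omega>)) \<omega> \<partial>M)"
      by (rule real_cond_exp_intg(2)[symmetric]) (auto simp: indicator_def)
    also have "\<dots> = (\<integral>\<omega>. (\<kappa> U (B \<omega>) * indicat_real G (B \<omega>)) * real_cond_exp M F (\<lambda>\<omega>. indicat_real V (C \<omega>)) \<omega> \<partial>M)"
    proof (rule integral_cong_AE)
      show "AE \<omega> in M. indicat_real G (B \<omega>) * real_cond_exp M F (\<lambda>\<omega>. indicat_real U (A \<omega>) * indicat_real V (C \<omega>)) \<omega>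
          = (\<kappa> U (B \<omega>) * indicat_real G (B \<omega>)) * real_cond_exp M F (\<lambda>\<omega>. indicat_real V (C \<omega>)) \<omega>"
        using m ce[OF that(1)] by eventually_elim (simp add: mult_ac)
    qed (auto intro!: borel_measurable_times borel_measurable_cond_exp2)
    also have "\<dots> = (\<integral>\<omega>. (\<kappa> U (B \<omega>) * indicat_real G (B \<omega>)) * indicat_real V (C \<omega>) \<partial>M)"
      using k01[OF that(1)] by (intro real_cond_exp_intg(2)) (auto simp: indicator_def abs_le_iff intro: order.trans[of _ 0])
    finally show ?thesis by simp
  qed
  \<comment> \<open>Both sides are measures in \<open>E\<close>, finite with total mass at most 1,
    and \<open>full\<close> says that they agree on the rectangles
    \<open>G \<times> V\<close>.\<close>
  have kE: "(\<integral>\<^sup>+\<omega>. indicator U (A \<omega>) * indicator E (B \<omega>, C \<omega>) \<partial>M)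
      = (\<integral>\<^sup>+\<omega>. ennreal (\<kappa> U (B \<omega>)) * indicator E (B \<omega>, C \<omega>) \<partial>M)"
    if U[measurable]: "U \<in> sets borel" and [measurable]: "E \<in> sets (borel \<Otimes>\<^sub>M MC)" for U E
  proof -
    note k_meas[measurable]
    let ?\<mu> = "distr (density M (\<lambda>\<omega>. indicator U (A \<omega>))) (borel \<Otimes>\<^sub>M MC) (\<lambda>\<omega>. (B \<omega>, C \<omega>))"
    let ?\<nu> = "distr (density M (\<lambda>\<omega>. ennreal (\<kappa> U (B \<omega>)))) (borel \<Otimes>\<^sub>M MC) (\<lambda>\<omega>. (B \<omega>, C \<omega>))"
    have m: "emeasure (distr (density M f) (borel \<Otimes>\<^sub>M MC) (\<lambda>\<omega>. (B \<omega>, C \<omega>))) Q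
        = (\<integral>\<^sup>+\<omega>. f \<omega> * indicator Q (B \<omega>, C \<omega>) \<partial>M)"
      if [measurable]: "f \<in> borel_measurable M" "Q \<in> sets (borel \<Otimes>\<^sub>M MC)" for f Q
      by (subst emeasure_distr)
        (auto simp: emeasure_density intro!: nn_integral_cong split: split_indicator)
    have "?\<mu> = ?\<nu>"
    proof (rule measure_eqI_pair)
      have "emeasure ?\<mu> (space ?\<mu>) \<le> (\<integral>\<^sup>+\<omega>. 1 \<partial>M)"
        using m[of "\<lambda>\<omega>. indicator U (A \<omega>)" "space (borel \<Otimes>\<^sub>M MC)"]
        by (auto simp del: nn_integral_const intro!: nn_integral_mono split: split_indicator)
      also have "\<dots> < \<infinity>" by (simp add: emeasure_space_1)
      finally show "finite_measure ?\<mu>" by (intro finite_measureI) auto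
      fix G :: "real set" and V assume [measurable]: "G \<in> sets borel" "V \<in> sets MC"
      have "emeasure ?\<mu> (G \<times> V) = (\<integral>\<^sup>+\<omega>. ennreal (indicat_real G (B \<omega>) * (indicat_real U (A \<omega>) * indicat_real V (C \<omega>))) \<partial>M)"
        by (subst m) (auto intro!: nn_integral_cong split: split_indicator)
      also have "\<dots> = ennreal (\<integral>\<omega>. indicat_real G (B \<omega>) * (indicat_real U (A \<omega>) * indicat_real V (C \<omega>)) \<partial>M)"
        by (rule nn_integral_eq_integral) (auto split: split_indicator)
      also have "\<dots> = ennreal (\<integral>\<omega>. \<kappa> U (B \<omega>) * indicat_real G (B \<omega>) * indicat_real V (C \<omega>) \<partial>M)"
        by (subst full) auto
      also have "\<dots> = (\<integral>\<^sup>+\<omega>. ennreal (\<kappa> U (B \<omega>) * indicat_real G (B \<omega>) * indicat_real V (C \<omega>)) \<partial>M)"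
        using k01[OF U] by (intro nn_integral_eq_integral[symmetric]) (auto split: split_indicator)
      also have "\<dots> = emeasure ?\<nu> (G \<times> V)"
        by (subst m) (auto intro!: nn_integral_cong split: split_indicator)
      finally show "emeasure ?\<mu> (G \<times> V) = emeasure ?\<nu> (G \<times> V)" .
    qed auto
    then have "emeasure ?\<mu> E = emeasure ?\<nu> E" by simp
    then show ?thesis by (subst (asm) (1 2) m) auto
  qed
  let ?LW = "distr M borel W" and ?LBC = "distr M (borel \<Otimes>\<^sub>M MC) (\<lambda>\<omega>. (B \<omega>, C \<omega>))"
  let ?T = "borel \<Otimes>\<^sub>M (borel \<Otimes>\<^sub>M MC)"
  \<comment> \<open>The law of \<open>(A, B, C)\<close> is the image of a product measure under the
    shear that adds \<open>c * b\<close> to the first coordinate. Applying the inverse shear to both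
    sides then gives the product form for the residual.\<close>
  have law: "distr M ?T (\<lambda>\<omega>. (A \<omega>, B \<omega>, C \<omega>)) = distr (?LW \<Otimes>\<^sub>M ?LBC) ?T (\<lambda>(w, b, x). (c * b + w, b, x))"
  proof (rule measure_eqI_pair)
    interpret D: prob_space "distr M ?T (\<lambda>\<omega>. (A \<omega>, B \<omega>, C \<omega>))" by (rule prob_space_distr) simp
    show "finite_measure (distr M ?T (\<lambda>\<omega>. (A \<omega>, B \<omega>, C \<omega>)))" by unfold_locales
    fix U :: "real set" and E :: "(real \<times> 'b) set" assume U[measurable]: "U \<in> sets borel" and [measurable]: "E \<in> sets (borel \<Otimes>\<^sub>M MC)"
    note k_meas[measurable]
    interpret P: pair_prob_space ?LW ?LBC ..
    have k: "ennreal (\<kappa> U b) = (\<integral>\<^sup>+w. indicator U (c * b + w) \<partial>?LW)" for b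
    proof -
      have "(\<integral>\<^sup>+w. ennreal (indicat_real U (c * b + w)) \<partial>?LW) = ennreal (\<kappa> U b)"
        unfolding \<kappa>_def by (intro nn_integral_eq_integral W.integrable_const_bound[where B=1]) auto
      then show ?thesis by (simp add: ennreal_indicator)
    qed
    have "emeasure (distr (?LW \<Otimes>\<^sub>M ?LBC) ?T (\<lambda>(w, b, x). (c * b + w, b, x))) (U \<times> E)
        = (\<integral>\<^sup>+z. indicator U (c * fst (snd z) + fst z) * indicator E (snd z) \<partial>(?LW \<Otimes>\<^sub>M ?LBC))"
      by (subst nn_integral_indicator[symmetric], simp, subst nn_integral_distr)
        (auto intro!: nn_integral_cong split: split_indicator)
    also have "\<dots> = (\<integral>\<^sup>+bx. \<integral>\<^sup>+w. indicator U (c * fst bx + w) * indicator E bx \<partial>?LW \<partial>?LBC)"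
      by (subst P.nn_integral_snd[symmetric]) auto
    also have "\<dots> = (\<integral>\<^sup>+bx. ennreal (\<kappa> U (fst bx)) * indicator E bx \<partial>?LBC)"
      unfolding k by (subst nn_integral_multc) auto
    also have "\<dots> = (\<integral>\<^sup>+\<omega>. ennreal (\<kappa> U (B \<omega>)) * indicator E (B \<omega>, C \<omega>) \<partial>M)"
      by (subst nn_integral_distr) auto
    also have "\<dots> = (\<integral>\<^sup>+\<omega>. indicator U (A \<omega>) * indicator E (B \<omega>, C \<omega>) \<partial>M)"
      by (rule kE[symmetric]) auto
    also have "\<dots> = emeasure (distr M ?T (\<lambda>\<omega>. (A \<omega>, B \<omega>, C \<omega>))) (U \<times> E)"
      by (subst nn_integral_indicator[symmetric], simp, subst nn_integral_distr)
        (auto intro!: nn_integral_cong split: split_indicator)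
    finally show "emeasure (distr M ?T (\<lambda>\<omega>. (A \<omega>, B \<omega>, C \<omega>))) (U \<times> E)
        = emeasure (distr (?LW \<Otimes>\<^sub>M ?LBC) ?T (\<lambda>(w, b, x). (c * b + w, b, x))) (U \<times> E)" ..
  qed auto
  have "distr M ?T (\<lambda>\<omega>. (W \<omega>, B \<omega>, C \<omega>))
      = distr (distr M ?T (\<lambda>\<omega>. (A \<omega>, B \<omega>, C \<omega>))) ?T (\<lambda>(a, b, x). (a - c * b, b, x))"
    by (subst distr_distr) (auto simp: W_def comp_def)
  also have "\<dots> = distr (?LW \<Otimes>\<^sub>M ?LBC) ?T (\<lambda>z. z)"
    unfolding law by (subst distr_distr) (auto simp: comp_def split_beta')
  also have "\<dots> = ?LW \<Otimes>\<^sub>M ?LBC"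
    by (rule distr_id2) (simp cong: sets_pair_measure_cong)
  finally show ?thesis .
qed

subsection \<open>The law of the source\<close>

lemma (in prob_space) product_law_compose:
  assumes [measurable]: "X \<in> M \<rightarrow>\<^sub>M S" "Y \<in> M \<rightarrow>\<^sub>M T" "f \<in> T \<rightarrow>\<^sub>M T'"
    and law: "distr M (S \<Otimes>\<^sub>M T) (\<lambda>\<omega>. (X \<omega>, Y \<omega>)) = distr M S X \<Otimes>\<^sub>M distr M T Y"
  shows "distr M (S \<Otimes>\<^sub>M T') (\<lambda>\<omega>. (X \<omega>, f (Y \<omega>))) = distr M S X \<Otimes>\<^sub>M distr M T' (\<lambda>\<omega>. f (Y \<omega>))"
proof -
  interpret T': prob_space "distr M T' (\<lambda>\<omega>. f (Y \<omega>))" by (rule prob_space_distr) simp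
  have sf: "sigma_finite_measure (distr (distr M T Y) T' f)"
    by (subst distr_distr) (auto simp: comp_def intro: T'.sigma_finite_measure_axioms)
  have "distr M (S \<Otimes>\<^sub>M T') (\<lambda>\<omega>. (X \<omega>, f (Y \<omega>)))
      = distr (distr M (S \<Otimes>\<^sub>M T) (\<lambda>\<omega>. (X \<omega>, Y \<omega>))) (S \<Otimes>\<^sub>M T') (\<lambda>(x, y). (x, f y))"
    by (subst distr_distr) (auto simp: comp_def)
  also have "\<dots> = distr (distr M S X) S (\<lambda>x. x) \<Otimes>\<^sub>M distr (distr M T Y) T' f"
    unfolding law by (rule pair_measure_distr[symmetric]) (auto intro: sf)
  also have "\<dots> = distr M S X \<Otimes>\<^sub>M distr M T' (\<lambda>\<omega>. f (Y \<omega>))"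
    by (simp add: distr_distr comp_def)
  finally show ?thesis .
qed

lemma jointly_gaussian_pairs:
  assumes "jointly_gaussian M [S, X1, X2, Y]"
  shows "gaussian M (\<lambda>\<omega>. s * S \<omega> + t * X1 \<omega>)"
    and "gaussian M (\<lambda>\<omega>. s * X1 \<omega> + t * Y \<omega>)"
    and "gaussian M (\<lambda>\<omega>. s * X2 \<omega> + t * Y \<omega>)"
proof -
  have *: "gaussian M (\<lambda>\<omega>. c0 * S \<omega> + c1 * X1 \<omega> + c2 * X2 \<omega> + c3 * Y \<omega>)" for c0 c1 c2 c3
  proof -
    define c where "c = (\<lambda>i::nat. [c0, c1, c2, c3] ! i)"
    have "gaussian M (\<lambda>\<omega>. \<Sum>i<length [S, X1, X2, Y]. c i * ([S, X1, X2, Y] ! i) \<omega>)"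
      using assms unfolding jointly_gaussian_def by blast
    then show ?thesis by (simp add: c_def eval_nat_numeral add.assoc)
  qed
  show "gaussian M (\<lambda>\<omega>. s * S \<omega> + t * X1 \<omega>)" using *[of s t 0 0] by simp
  show "gaussian M (\<lambda>\<omega>. s * X1 \<omega> + t * Y \<omega>)" using *[of 0 s 0 t] by simp
  show "gaussian M (\<lambda>\<omega>. s * X2 \<omega> + t * Y \<omega>)" using *[of 0 0 s t] by simp
qed

text \<open>The inverse of passing to residuals: it rebuilds \<open>(S, X1, X2, Y)\<close> from the
  independent quadruple \<open>(W, Z1, Z2, Y)\<close>. The argument \<open>c\<close> multiplies the
  rebuilt \<open>X1\<close>, not \<open>z1\<close>.\<close>

definition source_map :: "real \<Rightarrow> real \<Rightarrow> real \<Rightarrow> real \<times> real \<times> real \<times> real \<Rightarrow> real \<times> real \<times> real \<times> real" where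
  "source_map a b c = (\<lambda>(w, z1, z2, y). (c * (a * y + z1) + w, a * y + z1, b * y + z2, y))"

abbreviation source_law where
  "source_law M S X1 X2 Y w v1 v2 vY a b c \<equiv> distr M borel (\<lambda>\<omega>. (S \<omega>, X1 \<omega>, X2 \<omega>, Y \<omega>)) =
      distr (centered_normal w \<Otimes>\<^sub>M (centered_normal v1 \<Otimes>\<^sub>M (centered_normal v2 \<Otimes>\<^sub>M centered_normal vY)))
        borel (source_map a b c)"

text \<open>Independence is built up from the right. Regression makes \<open>Z2\<close> independent
  of \<open>Y\<close>; the chain \<open>X1 - Y - X2\<close> makes \<open>Z1\<close> independent of
  \<open>(Y, X2)\<close>, hence of \<open>(Z2, Y)\<close>; the chain \<open>S - X1 - (X2, Y)\<close>
  makes \<open>W\<close> independent of \<open>(X1, X2, Y)\<close>, hence of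
  \<open>(Z1, Z2, Y)\<close>.\<close>

lemma (in prob_space) gaussian_source_law:
  fixes S X1 X2 Y :: "'a \<Rightarrow> real"
  assumes jg: "jointly_gaussian M [S, X1, X2, Y]"
    and mean: "expectation S = 0" "expectation X1 = 0" "expectation X2 = 0" "expectation Y = 0"
    and pos: "variance X1 > 0" "variance Y > 0"
    and mc1: "markov_chain M borel S borel X1 borel (\<lambda>\<omega>. (X2 \<omega>, Y \<omega>))"
    and mc2: "markov_chain M borel X1 borel Y borel X2"
  defines "a \<equiv> covariance M X1 Y / variance Y"
    and "b \<equiv> covariance M X2 Y / variance Y"
    and "c \<equiv> covariance M S X1 / variance X1"
    and "w \<equiv> variance S - (covariance M S X1)\<^sup>2 / variance X1"
    and "v1 \<equiv> variance X1 - (covariance M X1 Y)\<^sup>2 / variance Y"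
    and "v2 \<equiv> variance X2 - (covariance M X2 Y)\<^sup>2 / variance Y"
  shows "source_law M S X1 X2 Y w v1 v2 (variance Y) a b c"
    and "0 \<le> w" "0 \<le> v1" "0 \<le> v2"
    and "distr M (borel \<Otimes>\<^sub>M borel) (\<lambda>\<omega>. (S \<omega> - c * X1 \<omega>, X1 \<omega>)) = centered_normal w \<Otimes>\<^sub>M distr M borel X1"
proof -
  note g = jointly_gaussian_pairs[OF jg]
  have gau: "gaussian M S" "gaussian M X1" "gaussian M X2" "gaussian M Y"
    using g(1)[of 1 0] g(1)[of 0 1] g(3)[of 1 0] g(3)[of 0 1] by simp_all
  then have [measurable]: "S \<in> borel_measurable M" "X1 \<in> borel_measurable M"
      "X2 \<in> borel_measurable M" "Y \<in> borel_measurable M"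
    by (auto simp: gaussian_def)
  note r1 = gaussian_regression[OF g(1) mean(1,2) pos(1), folded w_def c_def]
  note r2 = gaussian_regression[OF g(2) mean(2,4) pos(2), folded v1_def a_def]
  note r3 = gaussian_regression[OF g(3) mean(3,4) pos(2), folded v2_def b_def]
  show "0 \<le> w" "0 \<le> v1" "0 \<le> v2" using r1 r2 r3 by auto
  define W where "W = (\<lambda>\<omega>. S \<omega> - c * X1 \<omega>)"
  define Z1 where "Z1 = (\<lambda>\<omega>. X1 \<omega> - a * Y \<omega>)"
  define Z2 where "Z2 = (\<lambda>\<omega>. X2 \<omega> - b * Y \<omega>)"
  have [measurable]: "W \<in> borel_measurable M" "Z1 \<in> borel_measurable M" "Z2 \<in> borel_measurable M"
    by (auto simp: W_def Z1_def Z2_def)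
  show "distr M (borel \<Otimes>\<^sub>M borel) (\<lambda>\<omega>. (S \<omega> - c * X1 \<omega>, X1 \<omega>)) = centered_normal w \<Otimes>\<^sub>M distr M borel X1"
    using r1(1) unfolding indep_var_distribution_eq r1(2) by simp
  have LY: "distr M borel Y = centered_normal (variance Y)"
    by (rule gaussian_centered(1)[OF gau(4) mean(4)])
  have LW: "distr M borel W = centered_normal w" using r1(2) by (simp add: W_def)
  have LZ1: "distr M borel Z1 = centered_normal v1" using r2(2) by (simp add: Z1_def)
  have LZ2: "distr M borel Z2 = centered_normal v2" using r3(2) by (simp add: Z2_def)
  have 3: "distr M borel (\<lambda>\<omega>. (Z2 \<omega>, Y \<omega>)) = centered_normal v2 \<Otimes>\<^sub>M centered_normal (variance Y)"
    using r3(1) unfolding Z2_def[symmetric] indep_var_distribution_eq LZ2 LY by (simp add: borel_prod)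
  have 2: "distr M borel (\<lambda>\<omega>. (Z1 \<omega>, Z2 \<omega>, Y \<omega>))
      = centered_normal v1 \<Otimes>\<^sub>M (centered_normal v2 \<Otimes>\<^sub>M centered_normal (variance Y))"
  proof -
    have "distr M (borel \<Otimes>\<^sub>M (borel \<Otimes>\<^sub>M borel)) (\<lambda>\<omega>. (Z1 \<omega>, Y \<omega>, X2 \<omega>))
        = distr M borel Z1 \<Otimes>\<^sub>M distr M (borel \<Otimes>\<^sub>M borel) (\<lambda>\<omega>. (Y \<omega>, X2 \<omega>))"
      using markov_chain_indep_residual[OF mc2 r2(1)] by (simp add: Z1_def)
    from product_law_compose[OF _ _ _ this, of "\<lambda>(y, x2). (x2 - b * y, y)" borel]
    have "distr M (borel \<Otimes>\<^sub>M borel) (\<lambda>\<omega>. (Z1 \<omega>, Z2 \<omega>, Y \<omega>))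
        = distr M borel Z1 \<Otimes>\<^sub>M distr M borel (\<lambda>\<omega>. (Z2 \<omega>, Y \<omega>))"
      by (simp add: Z2_def borel_prod[symmetric])
    then show ?thesis by (simp add: LZ1 3 borel_prod)
  qed
  have 1: "distr M borel (\<lambda>\<omega>. (W \<omega>, Z1 \<omega>, Z2 \<omega>, Y \<omega>))
      = centered_normal w \<Otimes>\<^sub>M (centered_normal v1 \<Otimes>\<^sub>M (centered_normal v2 \<Otimes>\<^sub>M centered_normal (variance Y)))"
  proof -
    have "distr M (borel \<Otimes>\<^sub>M (borel \<Otimes>\<^sub>M borel)) (\<lambda>\<omega>. (W \<omega>, X1 \<omega>, (X2 \<omega>, Y \<omega>)))
        = distr M borel W \<Otimes>\<^sub>M distr M (borel \<Otimes>\<^sub>M borel) (\<lambda>\<omega>. (X1 \<omega>, (X2 \<omega>, Y \<omega>)))"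
      using markov_chain_indep_residual[OF mc1 r1(1)] by (simp add: W_def)
    from product_law_compose[OF _ _ _ this, of "\<lambda>(x1, x2, y). (x1 - a * y, x2 - b * y, y)" borel]
    have "distr M (borel \<Otimes>\<^sub>M borel) (\<lambda>\<omega>. (W \<omega>, Z1 \<omega>, Z2 \<omega>, Y \<omega>))
        = distr M borel W \<Otimes>\<^sub>M distr M borel (\<lambda>\<omega>. (Z1 \<omega>, Z2 \<omega>, Y \<omega>))"
      by (simp add: Z1_def Z2_def borel_prod[symmetric])
    then show ?thesis by (simp add: LW 2 borel_prod)
  qed
  show "source_law M S X1 X2 Y w v1 v2 (variance Y) a b c"
    unfolding 1[symmetric] source_map_def
    by (subst distr_distr)
      (auto simp: comp_def W_def Z1_def Z2_def borel_prod[symmetric] intro!: measurable_Pair)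
qed

section \<open>Blocks of tuples as tuples of blocks\<close>

text \<open>Zipping two independent blocks gives an i.i.d. block of pairs. The second block is
  presented as the image \<open>g\<close> of an arbitrary space \<open>Q\<close>, so that the lemma
  can be iterated: \<open>Q\<close> may itself be a product of blocks that \<open>g\<close> has
  already zipped.\<close>

lemma PiM_pair_distr:
  fixes A :: "'a measure" and B :: "'b measure" and Q :: "'q measure"
  assumes "prob_space A" "prob_space B" "prob_space Q" and I: "finite I"
    and g[measurable]: "g \<in> Q \<rightarrow>\<^sub>M PiM I (\<lambda>_. B)"
    and law: "distr Q (PiM I (\<lambda>_. B)) g = PiM I (\<lambda>_. B)"
  shows "distr (PiM I (\<lambda>_. A) \<Otimes>\<^sub>M Q) (PiM I (\<lambda>_. A \<Otimes>\<^sub>M B)) (\<lambda>(x, q). \<lambda>i\<in>I. (x i, g q i))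
    = PiM I (\<lambda>_. A \<Otimes>\<^sub>M B)"
proof -
  interpret A: prob_space A by fact
  interpret B: prob_space B by fact
  interpret Q: prob_space Q by fact
  interpret AB: pair_prob_space A B ..
  interpret PA: product_prob_space "\<lambda>_. A" I by unfold_locales
  interpret PB: product_prob_space "\<lambda>_. B" I by unfold_locales
  interpret PAB: product_prob_space "\<lambda>_. A \<Otimes>\<^sub>M B" I by unfold_locales
  interpret PP: pair_prob_space "PiM I (\<lambda>_. A)" Q ..
  have m[measurable]: "(\<lambda>(x, q). \<lambda>i\<in>I. (x i, g q i)) \<in> PiM I (\<lambda>_. A) \<Otimes>\<^sub>M Q \<rightarrow>\<^sub>M PiM I (\<lambda>_. A \<Otimes>\<^sub>M B)"
    unfolding split_beta' by measurable
  show ?thesis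
  proof (rule PAB.PiM_eqI[OF I])
    fix E assume E: "\<And>i. i \<in> I \<Longrightarrow> E i \<in> sets (A \<Otimes>\<^sub>M B)"
    have [measurable]: "Pi\<^sub>E I E \<in> sets (PiM I (\<lambda>_. A \<Otimes>\<^sub>M B))"
      using I E by (intro sets_PiM_I_finite) auto
    have fm: "(\<lambda>z. indicator (E i) (z i) :: ennreal) \<in> borel_measurable (PiM I (\<lambda>_. A \<Otimes>\<^sub>M B))" if "i \<in> I" for i
      using E[OF that] that by measurable
    have "emeasure (distr (PiM I (\<lambda>_. A) \<Otimes>\<^sub>M Q) (PiM I (\<lambda>_. A \<Otimes>\<^sub>M B)) (\<lambda>(x, q). \<lambda>i\<in>I. (x i, g q i))) (Pi\<^sub>E I E)
      = (\<integral>\<^sup>+z. indicator (Pi\<^sub>E I E) (case z of (x, q) \<Rightarrow> \<lambda>i\<in>I. (x i, g q i)) \<partial>(PiM I (\<lambda>_. A) \<Otimes>\<^sub>M Q))"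
      by (subst nn_integral_indicator[symmetric], simp, subst nn_integral_distr) auto
    also have "\<dots> = (\<integral>\<^sup>+x. \<integral>\<^sup>+q. indicator (Pi\<^sub>E I E) (\<lambda>i\<in>I. (x i, g q i)) \<partial>Q \<partial>PiM I (\<lambda>_. A))"
      by (subst Q.nn_integral_fst[symmetric]) (auto simp: split_beta')
    also have "\<dots> = (\<integral>\<^sup>+x. \<integral>\<^sup>+q. (\<Prod>i\<in>I. indicator (E i) (x i, g q i)) \<partial>Q \<partial>PiM I (\<lambda>_. A))"
      using I by (intro nn_integral_cong) (auto simp: PiE_iff indicator_def prod_zero_iff split: if_splits)
    also have "\<dots> = (\<integral>\<^sup>+x. (\<Prod>i\<in>I. \<integral>\<^sup>+b. indicator (E i) (x i, b) \<partial>B) \<partial>PiM I (\<lambda>_. A))"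
    proof (rule nn_integral_cong)
      fix x assume x: "x \<in> space (PiM I (\<lambda>_. A))"
      have mm: "(\<lambda>b. indicator (E i) (x i, b) :: ennreal) \<in> borel_measurable B" if "i \<in> I" for i
      proof -
        note E[OF that, measurable]
        have "x i \<in> space A" using x that by (auto simp: space_PiM)
        then show ?thesis by measurable
      qed
      have mm2: "(\<lambda>y. \<Prod>i\<in>I. indicator (E i) (x i, y i) :: ennreal) \<in> borel_measurable (PiM I (\<lambda>_. B))"
        by (intro borel_measurable_prod_ennreal measurable_compose[OF measurable_component_singleton]) (auto intro: mm)
      have "(\<integral>\<^sup>+q. (\<Prod>i\<in>I. indicator (E i) (x i, g q i)) \<partial>Q)
          = (\<integral>\<^sup>+y. (\<Prod>i\<in>I. indicator (E i) (x i, y i)) \<partial>distr Q (PiM I (\<lambda>_. B)) g)"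
        by (rule nn_integral_distr[symmetric]) (use g mm2 in simp_all)
      also have "\<dots> = (\<integral>\<^sup>+y. (\<Prod>i\<in>I. indicator (E i) (x i, y i)) \<partial>PiM I (\<lambda>_. B))"
        by (simp only: law)
      also have "\<dots> = (\<Prod>i\<in>I. \<integral>\<^sup>+b. indicator (E i) (x i, b) \<partial>B)"
        by (rule PB.product_nn_integral_prod[OF I mm])
      finally show "(\<integral>\<^sup>+q. (\<Prod>i\<in>I. indicator (E i) (x i, g q i)) \<partial>Q) = (\<Prod>i\<in>I. \<integral>\<^sup>+b. indicator (E i) (x i, b) \<partial>B)" .
    qed
    also have "\<dots> = (\<Prod>i\<in>I. \<integral>\<^sup>+x. \<integral>\<^sup>+b. indicator (E i) (x, b) \<partial>B \<partial>A)"
    proof (rule PA.product_nn_integral_prod[OF I])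
      fix i assume "i \<in> I"
      note E[OF this, measurable]
      show "(\<lambda>x. \<integral>\<^sup>+b. indicator (E i) (x, b) \<partial>B) \<in> borel_measurable A" by measurable
    qed
    also have "\<dots> = (\<Prod>i\<in>I. emeasure (A \<Otimes>\<^sub>M B) (E i))"
      using E by (intro prod.cong refl) (simp add: B.emeasure_pair_measure)
    finally show "emeasure (distr (PiM I (\<lambda>_. A) \<Otimes>\<^sub>M Q) (PiM I (\<lambda>_. A \<Otimes>\<^sub>M B)) (\<lambda>(x, q). \<lambda>i\<in>I. (x i, g q i))) (Pi\<^sub>E I E)
      = (\<Prod>i\<in>I. emeasure (A \<Otimes>\<^sub>M B) (E i))" .
  qed simp
qed

abbreviation normal_block :: "nat \<Rightarrow> real \<Rightarrow> (nat \<Rightarrow> real) measure" where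
  "normal_block n v \<equiv> PiM {..<n} (\<lambda>_. centered_normal v)"

abbreviation residual_block :: "nat \<Rightarrow> real \<Rightarrow> real \<Rightarrow> real \<Rightarrow> ((nat \<Rightarrow> real) \<times> (nat \<Rightarrow> real) \<times> (nat \<Rightarrow> real)) measure" where
  "residual_block n v1 v2 vY \<equiv> normal_block n v1 \<Otimes>\<^sub>M (normal_block n v2 \<Otimes>\<^sub>M normal_block n vY)"

lemma prob_space_normal_block: "prob_space (normal_block n v)"
  by (intro prob_space_PiM prob_space_centered_normal)

lemma iid_source_eq:
  assumes law: "source_law M S X1 X2 Y w v1 v2 vY a b c"
  shows "iid_source M S X1 X2 Y n =
      distr (normal_block n w \<Otimes>\<^sub>M residual_block n v1 v2 vY)
        (PiM {..<n} (\<lambda>_. borel))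
        (\<lambda>(w, z1, z2, y). \<lambda>i\<in>{..<n}. source_map a b c (w i, z1 i, z2 i, y i))"
proof -
  let ?A = "centered_normal w" and ?B = "centered_normal v1" and ?C = "centered_normal v2" and ?D = "centered_normal vY"
  let ?I = "{..<n}"
  note ps = prob_space_centered_normal prob_space_normal_block
  interpret A: prob_space ?A by (rule ps)
  interpret B: prob_space ?B by (rule ps)
  interpret C: prob_space ?C by (rule ps)
  interpret D: prob_space ?D by (rule ps)
  interpret PA: prob_space "normal_block n w" by (rule ps)
  interpret PB: prob_space "normal_block n v1" by (rule ps)
  interpret PC: prob_space "normal_block n v2" by (rule ps)
  interpret PD: prob_space "normal_block n vY" by (rule ps)
  interpret CD: pair_prob_space ?C ?D ..
  interpret BCD: pair_prob_space ?B "?C \<Otimes>\<^sub>M ?D" ..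
  interpret ABCD: pair_prob_space ?A "?B \<Otimes>\<^sub>M (?C \<Otimes>\<^sub>M ?D)" ..
  interpret PCD: pair_prob_space "normal_block n v2" "normal_block n vY" ..
  interpret PBCD: pair_prob_space "normal_block n v1" "normal_block n v2 \<Otimes>\<^sub>M normal_block n vY" ..
  \<comment> \<open>Each map zips one more block onto the result of the previous one, so three
    applications of \<open>PiM_pair_distr\<close> turn the nested product of blocks into a block of
    quadruples.\<close>
  define gD where "gD = (\<lambda>y::nat \<Rightarrow> real. y)"
  define gC where "gC = (\<lambda>(z, q). \<lambda>i\<in>?I. (z i :: real, gD q i))"
  define gB where "gB = (\<lambda>(z, q). \<lambda>i\<in>?I. (z i :: real, gC q i))"
  define gA where "gA = (\<lambda>(z, q). \<lambda>i\<in>?I. (z i :: real, gB q i))"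
  have D1[measurable]: "gD \<in> normal_block n vY \<rightarrow>\<^sub>M PiM ?I (\<lambda>_. ?D)" by (simp add: gD_def)
  have D2: "distr (normal_block n vY) (PiM ?I (\<lambda>_. ?D)) gD = PiM ?I (\<lambda>_. ?D)" by (simp add: gD_def)
  have C1[measurable]: "gC \<in> normal_block n v2 \<Otimes>\<^sub>M normal_block n vY \<rightarrow>\<^sub>M PiM ?I (\<lambda>_. ?C \<Otimes>\<^sub>M ?D)"
    unfolding gC_def split_beta' by measurable
  note C2 = PiM_pair_distr[OF ps(1)[of v2] ps(1)[of vY] ps(2) finite_lessThan D1 D2, folded gC_def]
  have B1[measurable]: "gB \<in> normal_block n v1 \<Otimes>\<^sub>M (normal_block n v2 \<Otimes>\<^sub>M normal_block n vY) \<rightarrow>\<^sub>M PiM ?I (\<lambda>_. ?B \<Otimes>\<^sub>M (?C \<Otimes>\<^sub>M ?D))"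
    unfolding gB_def split_beta' by measurable
  note B2 = PiM_pair_distr[OF ps(1)[of v1] CD.prob_space_axioms PCD.prob_space_axioms finite_lessThan C1 C2, folded gB_def]
  have A1[measurable]: "gA \<in> normal_block n w \<Otimes>\<^sub>M residual_block n v1 v2 vY
      \<rightarrow>\<^sub>M PiM ?I (\<lambda>_. ?A \<Otimes>\<^sub>M (?B \<Otimes>\<^sub>M (?C \<Otimes>\<^sub>M ?D)))"
    unfolding gA_def split_beta' by measurable
  note A2 = PiM_pair_distr[OF ps(1)[of w] BCD.prob_space_axioms PBCD.prob_space_axioms finite_lessThan B1 B2, folded gA_def]
  have sm[measurable]: "source_map a b c \<in> ?A \<Otimes>\<^sub>M (?B \<Otimes>\<^sub>M (?C \<Otimes>\<^sub>M ?D)) \<rightarrow>\<^sub>M borel"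
    unfolding source_map_def split_beta' borel_prod[symmetric] by measurable
  interpret L: prob_space "distr (?A \<Otimes>\<^sub>M (?B \<Otimes>\<^sub>M (?C \<Otimes>\<^sub>M ?D))) borel (source_map a b c)"
    by (rule ABCD.prob_space_distr) simp
  let ?L = "distr (?A \<Otimes>\<^sub>M (?B \<Otimes>\<^sub>M (?C \<Otimes>\<^sub>M ?D))) borel (source_map a b c)"
  let ?N = "PiM ?I (\<lambda>_. borel :: (real \<times> real \<times> real \<times> real) measure)"
  have cm: "compose ?I (source_map a b c) \<in> PiM ?I (\<lambda>_. ?A \<Otimes>\<^sub>M (?B \<Otimes>\<^sub>M (?C \<Otimes>\<^sub>M ?D))) \<rightarrow>\<^sub>M ?N"
    unfolding compose_def by measurable
  \<comment> \<open>An image measure depends on its target only through the measurable sets, so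
    \<open>?L\<close> may stand in for \<open>borel\<close>. In this form a product of image
    measures is the image of the product.\<close>
  have "iid_source M S X1 X2 Y n = PiM ?I (\<lambda>_. distr (?A \<Otimes>\<^sub>M (?B \<Otimes>\<^sub>M (?C \<Otimes>\<^sub>M ?D))) ?L (source_map a b c))"
    unfolding iid_source_def law by (intro PiM_cong refl distr_cong) simp_all
  also have "\<dots> = distr (PiM ?I (\<lambda>_. ?A \<Otimes>\<^sub>M (?B \<Otimes>\<^sub>M (?C \<Otimes>\<^sub>M ?D)))) (PiM ?I (\<lambda>_. ?L)) (compose ?I (source_map a b c))"
    by (rule distr_PiM_finite_prob_space'[symmetric]) (auto intro: ABCD.prob_space_axioms L.prob_space_axioms)
  also have "\<dots> = distr (PiM ?I (\<lambda>_. ?A \<Otimes>\<^sub>M (?B \<Otimes>\<^sub>M (?C \<Otimes>\<^sub>M ?D)))) ?N (compose ?I (source_map a b c))"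
    by (intro distr_cong refl sets_PiM_cong) simp
  also have "\<dots> = distr (normal_block n w \<Otimes>\<^sub>M residual_block n v1 v2 vY) ?N
      (compose ?I (source_map a b c) \<circ> gA)"
    unfolding distr_distr[OF cm A1, symmetric] A2 ..
  also have "\<dots> = distr (normal_block n w \<Otimes>\<^sub>M residual_block n v1 v2 vY) ?N
      (\<lambda>(w, z1, z2, y). \<lambda>i\<in>?I. source_map a b c (w i, z1 i, z2 i, y i))"
    by (intro distr_cong refl)
      (auto simp: gA_def gB_def gC_def gD_def compose_def fun_eq_iff)
  finally show ?thesis .
qed

subsection \<open>Converse\<close>

text \<open>For \<open>v > D\<close> this is the log-likelihood ratio of \<open>N(r, D)\<close> against \<open>N(0, v)\<close> at \<open>z\<close>.  For \<open>v \<le> D\<close>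
  the component costs no rate, and the value \<open>0\<close> removes it from all estimates.\<close>

definition log_lik :: "real \<Rightarrow> real \<Rightarrow> real \<Rightarrow> real \<Rightarrow> real" where
  "log_lik v D z r = (if v > D then ln (v / D) / 2 + z\<^sup>2 / (2 * v) - (z - r)\<^sup>2 / (2 * D) else 0)"

lemma log_lik_measurable[measurable (raw)]:
  assumes [measurable]: "f \<in> borel_measurable M" "g \<in> borel_measurable M"
  shows "(\<lambda>x. log_lik v D (f x) (g x)) \<in> borel_measurable M"
proof (cases "v > D")
  case True
  then show ?thesis unfolding log_lik_def if_P[OF True] by measurable
qed (simp add: log_lik_def)

lemma normal_density_log_lik:
  assumes "D > 0" "v > D"
  shows "normal_density 0 (sqrt v) z * exp (log_lik v D z r) = normal_density r (sqrt D) z"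
proof -
  have v: "v > 0" using assms by simp
  have "exp (ln (v / D) / 2) = sqrt (v / D)"
  proof -
    have q: "v / D > 0" using assms v by simp
    then show ?thesis unfolding ln_sqrt[OF less_imp_le[OF q], symmetric] by (subst exp_ln) auto
  qed
  then have "exp (log_lik v D z r) = sqrt (v / D) * exp (z\<^sup>2 / (2 * v) - (z - r)\<^sup>2 / (2 * D))"
    using assms by (simp add: log_lik_def exp_add exp_diff)
  then have "normal_density 0 (sqrt v) z * exp (log_lik v D z r)
      = (sqrt (v / D) / sqrt (2 * pi * v)) * (exp (- z\<^sup>2 / (2 * v)) * exp (z\<^sup>2 / (2 * v) - (z - r)\<^sup>2 / (2 * D)))"
    using v by (simp add: normal_density_def)
  also have "exp (- z\<^sup>2 / (2 * v)) * exp (z\<^sup>2 / (2 * v) - (z - r)\<^sup>2 / (2 * D)) = exp (- (z - r)\<^sup>2 / (2 * D))"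
    by (simp add: exp_add[symmetric])
  also have "sqrt (v / D) / sqrt (2 * pi * v) = 1 / sqrt (2 * pi * D)"
    using v assms by (simp add: real_sqrt_divide real_sqrt_mult)
  finally show ?thesis using assms by (simp add: normal_density_def)
qed

lemma nn_integral_exp_log_lik:
  assumes "D > 0"
  shows "(\<integral>\<^sup>+z. ennreal (exp (log_lik v D z r)) \<partial>centered_normal v) = 1"
proof (cases "v > D")
  case True
  then have v: "v > 0" using assms by simp
  interpret prob_space "density lborel (normal_density r (sqrt D))"
    using assms by (simp add: prob_space_normal_density)
  have "(\<integral>\<^sup>+z. ennreal (exp (log_lik v D z r)) \<partial>centered_normal v)
      = (\<integral>\<^sup>+z. ennreal (normal_density 0 (sqrt v) z * exp (log_lik v D z r)) \<partial>lborel)"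
    using v by (simp add: centered_normal_def nn_integral_density ennreal_mult')
  also have "\<dots> = (\<integral>\<^sup>+z. ennreal (normal_density r (sqrt D) z) \<partial>lborel)"
    using True assms by (simp add: normal_density_log_lik)
  also have "\<dots> = 1" using emeasure_space_1 by (simp add: emeasure_density)
  finally show ?thesis .
next
  case False
  interpret prob_space "centered_normal v" by (rule prob_space_centered_normal)
  show ?thesis using False emeasure_space_1 by (simp add: log_lik_def)
qed

text \<open>Jensen's inequality in the form that the converse uses, proved with the tangent of the
  exponential at \<open>ln N\<close>. Finiteness of the exponential moment comes from the bound
  itself.\<close>

lemma (in prob_space) expectation_le_ln:
  assumes g: "integrable M g" and N: "0 < N" and le: "(\<integral>\<^sup>+x. ennreal (exp (g x)) \<partial>M) \<le> ennreal N"
  shows "expectation g \<le> ln N"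
proof -
  have [measurable]: "g \<in> borel_measurable M" using g by auto
  have ie: "integrable M (\<lambda>x. exp (g x))"
  proof (rule integrableI_bounded)
    show "(\<integral>\<^sup>+x. ennreal (norm (exp (g x))) \<partial>M) < \<infinity>"
      using le_less_trans[OF le ennreal_less_top] by simp
  qed simp
  have "ennreal (expectation (\<lambda>x. exp (g x))) = (\<integral>\<^sup>+x. ennreal (exp (g x)) \<partial>M)"
    by (rule nn_integral_eq_integral[OF ie, symmetric]) simp
  then have e: "expectation (\<lambda>x. exp (g x)) \<le> N"
    using le N by (metis ennreal_le_iff less_imp_le)
  have "expectation g - ln N = expectation (\<lambda>x. g x - ln N)" using g by (simp add: prob_space)
  also have "\<dots> \<le> expectation (\<lambda>x. exp (g x) / N - 1)"
  proof (rule integral_mono)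
    fix x
    have "1 + (g x - ln N) \<le> exp (g x - ln N)" by (rule exp_ge_add_one_self)
    then show "g x - ln N \<le> exp (g x) / N - 1" using N by (simp add: exp_diff)
  qed (use g ie in auto)
  also have "\<dots> = expectation (\<lambda>x. exp (g x)) / N - 1" using ie by (simp add: prob_space)
  also have "\<dots> \<le> 0" using e N by simp
  finally show ?thesis by simp
qed

text \<open>For each fixed index the exponential is a product of probability densities relative to the
  source, so it integrates to at most one; summing over the indices removes the dependence on the encoder.\<close>

lemma nn_integral_exp_code_le_card:
  fixes P1 P2 :: "real measure" and PY :: "'y measure"
    and r1 r2 :: "'j \<Rightarrow> 'y \<Rightarrow> nat \<Rightarrow> real"
  assumes ps: "prob_space P1" "prob_space P2" "prob_space PY"
    and [measurable_cong, simp]: "sets P1 = sets borel" "sets P2 = sets borel"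
    and J: "finite J"
    and [measurable]: "(\<lambda>(z, r). l1 z r) \<in> borel_measurable (borel \<Otimes>\<^sub>M borel)"
      "(\<lambda>(z, r). l2 z r) \<in> borel_measurable (borel \<Otimes>\<^sub>M borel)"
    and int1: "\<And>r. (\<integral>\<^sup>+z. ennreal (exp (l1 z r)) \<partial>P1) \<le> 1"
    and int2: "\<And>r. (\<integral>\<^sup>+z. ennreal (exp (l2 z r)) \<partial>P2) \<le> 1"
    and r1[measurable]: "\<And>j. j \<in> J \<Longrightarrow> r1 j \<in> PY \<rightarrow>\<^sub>M PiM {..<n} (\<lambda>_. borel)"
    and r2[measurable]: "\<And>j. j \<in> J \<Longrightarrow> r2 j \<in> PY \<rightarrow>\<^sub>M PiM {..<n} (\<lambda>_. borel)"
  defines "Q \<equiv> PiM {..<n} (\<lambda>_. P1) \<Otimes>\<^sub>M (PiM {..<n} (\<lambda>_. P2) \<Otimes>\<^sub>M PY)"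
  assumes m: "\<And>q. q \<in> space Q \<Longrightarrow> m q \<in> J"
  shows "(\<integral>\<^sup>+q. ennreal (exp (\<Sum>i<n. l1 (fst q i) (r1 (m q) (snd (snd q)) i)
      + l2 (fst (snd q) i) (r2 (m q) (snd (snd q)) i))) \<partial>Q) \<le> of_nat (card J)"
proof -
  let ?I = "{..<n}"
  interpret P1: prob_space P1 by fact
  interpret P2: prob_space P2 by fact
  interpret PY: prob_space PY by fact
  interpret I1: product_prob_space "\<lambda>_. P1" ?I by unfold_locales
  interpret I2: product_prob_space "\<lambda>_. P2" ?I by unfold_locales
  interpret Y2: pair_prob_space "PiM ?I (\<lambda>_. P2)" PY ..
  interpret Y12: pair_prob_space "PiM ?I (\<lambda>_. P1)" "PiM ?I (\<lambda>_. P2) \<Otimes>\<^sub>M PY" ..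
  let ?f1 = "\<lambda>j z y. \<Prod>i\<in>?I. ennreal (exp (l1 (z i) (r1 j y i)))"
  let ?f2 = "\<lambda>j z y. \<Prod>i\<in>?I. ennreal (exp (l2 (z i) (r2 j y i)))"
  let ?h = "\<lambda>j q. ?f1 j (fst q) (snd (snd q)) * ?f2 j (fst (snd q)) (snd (snd q))"
  let ?G = "\<lambda>q. ennreal (exp (\<Sum>i<n. l1 (fst q i) (r1 (m q) (snd (snd q)) i)
      + l2 (fst (snd q) i) (r2 (m q) (snd (snd q)) i)))"
  have one: "(\<integral>\<^sup>+q. ?h j q \<partial>Q) \<le> 1"
    if j[simp]: "j \<in> J" for j
  proof -
    note r1[OF j, measurable] r2[OF j, measurable]
    have i1: "(\<integral>\<^sup>+z. ?f1 j z y \<partial>PiM ?I (\<lambda>_. P1)) \<le> 1" for y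
      by (subst I1.product_nn_integral_prod) (auto intro: int1 prod_le_1)
    have i2: "(\<integral>\<^sup>+z. ?f2 j z y \<partial>PiM ?I (\<lambda>_. P2)) \<le> 1" for y
      by (subst I2.product_nn_integral_prod) (auto intro: int2 prod_le_1)
    have "(\<integral>\<^sup>+q. ?h j q \<partial>Q)
       = (\<integral>\<^sup>+p. \<integral>\<^sup>+z. ?f1 j z (snd p) * ?f2 j (fst p) (snd p) \<partial>PiM ?I (\<lambda>_. P1) \<partial>(PiM ?I (\<lambda>_. P2) \<Otimes>\<^sub>M PY))"
      unfolding Q_def by (subst Y12.nn_integral_snd[symmetric]) simp_all
    also have "\<dots> = (\<integral>\<^sup>+p. (\<integral>\<^sup>+z. ?f1 j z (snd p) \<partial>PiM ?I (\<lambda>_. P1)) * ?f2 j (fst p) (snd p) \<partial>(PiM ?I (\<lambda>_. P2) \<Otimes>\<^sub>M PY))"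
    proof (rule nn_integral_cong)
      fix p assume "p \<in> space (PiM ?I (\<lambda>_. P2) \<Otimes>\<^sub>M PY)"
      show "(\<integral>\<^sup>+z. ?f1 j z (snd p) * ?f2 j (fst p) (snd p) \<partial>PiM ?I (\<lambda>_. P1))
        = (\<integral>\<^sup>+z. ?f1 j z (snd p) \<partial>PiM ?I (\<lambda>_. P1)) * ?f2 j (fst p) (snd p)"
        by (rule nn_integral_multc) measurable
    qed
    also have "\<dots> \<le> (\<integral>\<^sup>+p. ?f2 j (fst p) (snd p) \<partial>(PiM ?I (\<lambda>_. P2) \<Otimes>\<^sub>M PY))"
    proof (rule nn_integral_mono)
      fix p
      show "(\<integral>\<^sup>+z. ?f1 j z (snd p) \<partial>PiM ?I (\<lambda>_. P1)) * ?f2 j (fst p) (snd p) \<le> ?f2 j (fst p) (snd p)"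
        using mult_right_mono[OF i1[of "snd p"], of "?f2 j (fst p) (snd p)"] by simp
    qed
    also have "\<dots> = (\<integral>\<^sup>+y. \<integral>\<^sup>+z. ?f2 j z y \<partial>PiM ?I (\<lambda>_. P2) \<partial>PY)"
      by (subst Y2.nn_integral_snd[symmetric]) simp_all
    also have "\<dots> \<le> (\<integral>\<^sup>+y. 1 \<partial>PY)" by (intro nn_integral_mono i2)
    also have "\<dots> = 1" using PY.emeasure_space_1 by simp
    finally show ?thesis .
  qed
  have "(\<integral>\<^sup>+q. ?G q \<partial>Q)
    \<le> (\<integral>\<^sup>+q. (\<Sum>j\<in>J. ?h j q) \<partial>Q)"
  proof (rule nn_integral_mono)
    fix q assume "q \<in> space Q"
    then have "m q \<in> J" by (rule m)
    have "?G q
        = ?h (m q) q"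
      by (simp add: sum.distrib exp_add exp_sum prod_ennreal ennreal_mult prod_nonneg)
    also have "\<dots> \<le> (\<Sum>j\<in>J. ?h j q)"
      using J \<open>m q \<in> J\<close> by (intro member_le_sum) auto
    finally show "?G q
      \<le> (\<Sum>j\<in>J. ?h j q)" .
  qed
  also have "\<dots> = (\<Sum>j\<in>J. \<integral>\<^sup>+q. ?h j q \<partial>Q)"
  proof (rule nn_integral_sum)
    fix j assume j: "j \<in> J"
    note r1[OF j, measurable] r2[OF j, measurable]
    show "(\<lambda>q. ?h j q) \<in> borel_measurable Q"
      unfolding Q_def by measurable
  qed
  also have "\<dots> \<le> (\<Sum>j\<in>J. 1)" by (intro sum_mono one)
  finally show ?thesis by simp
qed

lemma centered_normal_moments:
  assumes v: "v \<ge> 0"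
  shows "integrable (centered_normal v) (\<lambda>z. z\<^sup>2)" and "(\<integral>z. z\<^sup>2 \<partial>centered_normal v) = v"
    and "integrable (centered_normal v) (\<lambda>z. z)" and "(\<integral>z. z \<partial>centered_normal v) = 0"
proof -
  interpret prob_space "centered_normal v" by (rule prob_space_centered_normal)
  have *: "integrable (centered_normal v) (\<lambda>z. z\<^sup>2) \<and> (\<integral>z. z\<^sup>2 \<partial>centered_normal v) = v \<and> (\<integral>z. z \<partial>centered_normal v) = 0"
  proof (cases "v = 0")
    case True
    have [simp]: "centered_normal 0 = return borel 0" by (simp add: centered_normal_def)
    have "integrable (return borel 0) (\<lambda>z::real. z\<^sup>2)"
      by (rule integrable_cong_AE_imp[of _ "\<lambda>_. 0"]) (auto simp: AE_return)
    then show ?thesis using True by (simp add: integral_return)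
  next
    case False
    then have s: "sqrt v > 0" using v by simp
    have eq: "centered_normal v = density lborel (normal_density 0 (sqrt v))"
      using s by (simp add: centered_normal_def)
    have D: "distributed (centered_normal v) lborel (\<lambda>x. x) (normal_density 0 (sqrt v))"
      unfolding distributed_def by (auto simp: eq distr_id2)
    have m: "(\<integral>z. z \<partial>centered_normal v) = 0" by (rule normal_distributed_expectation[OF s D])
    moreover have "(\<integral>z. z\<^sup>2 \<partial>centered_normal v) = v"
      using normal_distributed_variance[OF s D] v by (simp add: m)
    moreover have "integrable (centered_normal v) (\<lambda>z. z\<^sup>2)"
      using integrable_normal_moment[OF s, of 0 2] by (subst (asm) distributed_integrable[OF D]) auto
    ultimately show ?thesis by simp
  qed
  then show "integrable (centered_normal v) (\<lambda>z. z\<^sup>2)" "(\<integral>z. z\<^sup>2 \<partial>centered_normal v) = v"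
    "(\<integral>z. z \<partial>centered_normal v) = 0" by auto
  then show "integrable (centered_normal v) (\<lambda>z. z)"
    using square_integrable_imp_integrable[of "\<lambda>z. z"] by simp
qed

text \<open>Rates are measured in nats until the final theorem.\<close>

definition gaussian_rate :: "real \<Rightarrow> real \<Rightarrow> real" where
  "gaussian_rate v D = (if v > D then ln (v / D) / 2 else 0)"

lemma distr_pair_snd:
  assumes "prob_space M" "sigma_finite_measure N"
  shows "distr (M \<Otimes>\<^sub>M N) N snd = N"
proof (rule measure_eqI)
  interpret M: prob_space M by fact
  interpret N: sigma_finite_measure N by fact
  fix A assume "A \<in> sets (distr (M \<Otimes>\<^sub>M N) N snd)"
  then have A[measurable]: "A \<in> sets N" by simp
  then have "snd -` A \<inter> space (M \<Otimes>\<^sub>M N) = space M \<times> A"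
    using sets.sets_into_space[OF A] by (auto simp: space_pair_measure)
  then show "emeasure (distr (M \<Otimes>\<^sub>M N) N snd) A = emeasure N A"
    by (simp add: emeasure_distr N.emeasure_pair_measure_Times M.emeasure_space_1)
qed simp

lemma distr_normal_block_component:
  assumes "i < n"
  shows "distr (normal_block n v) borel (\<lambda>z. z i) = centered_normal v"
proof -
  have "distr (normal_block n v) borel (\<lambda>z. z i) = distr (normal_block n v) (centered_normal v) (\<lambda>z. z i)"
    by (rule distr_cong) auto
  also have "\<dots> = centered_normal v"
    using assms by (intro distr_PiM_component prob_space_centered_normal) simp
  finally show ?thesis .
qed

text \<open>At distortion exactly \<open>D\<close> the source term contributes 1/2 per letter and
  the error term -1/2, so they cancel and \<open>ln (v / D) / 2\<close> remains. A relative excess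
  \<epsilon> in the distortion costs \<epsilon>/2. For \<open>v \<le> D\<close> the sum is 0 and the
  claim is trivial.\<close>

lemma (in prob_space) expectation_log_lik_ge:
  fixes n :: nat and v D \<epsilon> :: real
  assumes [measurable]: "\<And>i. i < n \<Longrightarrow> f i \<in> borel_measurable M" "\<And>i. i < n \<Longrightarrow> r i \<in> borel_measurable M"
    and law: "\<And>i. i < n \<Longrightarrow> distr M borel (f i) = centered_normal v"
    and v: "v \<ge> 0" and D: "D > 0" and \<epsilon>: "\<epsilon> \<ge> 0"
    and dist: "(\<integral>\<^sup>+x. ennreal (\<Sum>i<n. (f i x - r i x)\<^sup>2) \<partial>M) \<le> ennreal (n * (D * (1 + \<epsilon>)))"
  shows "integrable M (\<lambda>x. \<Sum>i<n. log_lik v D (f i x) (r i x))"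
    and "n * (gaussian_rate v D - \<epsilon> / 2) \<le> expectation (\<lambda>x. \<Sum>i<n. log_lik v D (f i x) (r i x))"
proof -
  have "integrable M (\<lambda>x. \<Sum>i<n. log_lik v D (f i x) (r i x)) \<and>
    n * (gaussian_rate v D - \<epsilon> / 2) \<le> expectation (\<lambda>x. \<Sum>i<n. log_lik v D (f i x) (r i x))"
  proof (cases "v > D")
    case False
    then show ?thesis using \<epsilon> by (simp add: log_lik_def gaussian_rate_def mult_le_0_iff)
  next
    case True
    have [measurable]: "(\<lambda>x. \<Sum>i<n. (f i x - r i x)\<^sup>2) \<in> borel_measurable M"
      by (intro borel_measurable_sum) auto
    have isq: "integrable M (\<lambda>x. \<Sum>i<n. (f i x - r i x)\<^sup>2)"
    proof (rule integrableI_bounded)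
      show "(\<integral>\<^sup>+x. ennreal (norm (\<Sum>i<n. (f i x - r i x)\<^sup>2)) \<partial>M) < \<infinity>"
        using le_less_trans[OF dist ennreal_less_top] by (simp add: sum_nonneg)
    qed simp
    have "ennreal (expectation (\<lambda>x. \<Sum>i<n. (f i x - r i x)\<^sup>2)) \<le> ennreal (n * (D * (1 + \<epsilon>)))"
      using dist by (subst nn_integral_eq_integral[OF isq, symmetric]) (auto simp: sum_nonneg)
    then have es: "expectation (\<lambda>x. \<Sum>i<n. (f i x - r i x)\<^sup>2) \<le> n * (D * (1 + \<epsilon>))"
      using D \<epsilon> by (subst (asm) ennreal_le_iff) auto
    have if2: "integrable M (\<lambda>x. (f i x)\<^sup>2)" and ef2: "expectation (\<lambda>x. (f i x)\<^sup>2) = v" if "i < n" for i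
    proof -
      show "integrable M (\<lambda>x. (f i x)\<^sup>2)"
        using centered_normal_moments(1)[OF v] that
        unfolding law[OF that, symmetric] by (subst (asm) integrable_distr_eq) auto
      show "expectation (\<lambda>x. (f i x)\<^sup>2) = v"
        using centered_normal_moments(2)[OF v] that
        unfolding law[OF that, symmetric] by (subst (asm) integral_distr) auto
    qed
    have iF: "integrable M (\<lambda>x. \<Sum>i<n. (f i x)\<^sup>2)"
      by (intro Bochner_Integration.integrable_sum) (simp add: if2)
    have eq: "(\<Sum>i<n. log_lik v D (f i x) (r i x))
      = n * (ln (v / D) / 2) + (\<Sum>i<n. (f i x)\<^sup>2) / (2 * v) - (\<Sum>i<n. (f i x - r i x)\<^sup>2) / (2 * D)" for x
      using True by (simp add: log_lik_def sum.distrib sum_subtractf sum_divide_distrib)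
    have "expectation (\<lambda>x. \<Sum>i<n. log_lik v D (f i x) (r i x))
      = n * (ln (v / D) / 2) + n * v / (2 * v) - expectation (\<lambda>x. \<Sum>i<n. (f i x - r i x)\<^sup>2) / (2 * D)"
    proof -
      have "expectation (\<lambda>x. \<Sum>i<n. (f i x)\<^sup>2) = n * v"
        using if2 ef2 by (subst Bochner_Integration.integral_sum) auto
      then show ?thesis
        unfolding eq using isq iF by (simp add: prob_space del: Bochner_Integration.integral_sum)
    qed
    moreover have "expectation (\<lambda>x. \<Sum>i<n. (f i x - r i x)\<^sup>2) / (2 * D) \<le> n * (D * (1 + \<epsilon>)) / (2 * D)"
      using es D by (intro divide_right_mono) auto
    moreover have "n * (D * (1 + \<epsilon>)) / (2 * D) = n * (1 + \<epsilon>) / 2" using D by simp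
    moreover have "n * v / (2 * v) = n / 2" using True D by simp
    ultimately have "n * (ln (v / D) / 2) + n / 2 - n * (1 + \<epsilon>) / 2
        \<le> expectation (\<lambda>x. \<Sum>i<n. log_lik v D (f i x) (r i x))" by linarith
    moreover have "integrable M (\<lambda>x. \<Sum>i<n. log_lik v D (f i x) (r i x))"
      unfolding eq using isq iF by simp
    ultimately show ?thesis using True by (simp add: gaussian_rate_def field_simps)
  qed
  then show "integrable M (\<lambda>x. \<Sum>i<n. log_lik v D (f i x) (r i x))"
    "n * (gaussian_rate v D - \<epsilon> / 2) \<le> expectation (\<lambda>x. \<Sum>i<n. log_lik v D (f i x) (r i x))" by auto
qed

text \<open>Both reproductions are selected by the same index, so the sum of the two log-likelihoods
  has exponential moment at most \<open>card J\<close>. The reproductions may depend on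
  \<open>y\<close>, because \<open>y\<close> is independent of the two residual blocks and is held
  fixed while these are integrated.\<close>

lemma converse_block:
  fixes r1 r2 :: "'j \<Rightarrow> 'y \<Rightarrow> nat \<Rightarrow> real"
  assumes PY: "prob_space PY" and J: "finite J"
    and v: "v1 \<ge> 0" "v2 \<ge> 0" and D: "D1 > 0" "D2 > 0" and \<epsilon>: "\<epsilon> \<ge> 0"
    and r1: "\<And>j. j \<in> J \<Longrightarrow> r1 j \<in> PY \<rightarrow>\<^sub>M PiM {..<n} (\<lambda>_. borel)"
    and r2: "\<And>j. j \<in> J \<Longrightarrow> r2 j \<in> PY \<rightarrow>\<^sub>M PiM {..<n} (\<lambda>_. borel)"
  defines "Q \<equiv> normal_block n v1 \<Otimes>\<^sub>M (normal_block n v2 \<Otimes>\<^sub>M PY)"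
  assumes m: "m \<in> Q \<rightarrow>\<^sub>M count_space J"
    and d1: "(\<integral>\<^sup>+q. ennreal (\<Sum>i<n. (fst q i - r1 (m q) (snd (snd q)) i)\<^sup>2) \<partial>Q) \<le> ennreal (n * (D1 * (1 + \<epsilon>)))"
    and d2: "(\<integral>\<^sup>+q. ennreal (\<Sum>i<n. (fst (snd q) i - r2 (m q) (snd (snd q)) i)\<^sup>2) \<partial>Q) \<le> ennreal (n * (D2 * (1 + \<epsilon>)))"
  shows "n * (gaussian_rate v1 D1 + gaussian_rate v2 D2 - \<epsilon>) \<le> ln (card J)"
proof -
  interpret PY: prob_space PY by fact
  interpret N1: prob_space "normal_block n v1" by (rule prob_space_normal_block)
  interpret N2: prob_space "normal_block n v2" by (rule prob_space_normal_block)
  interpret N2Y: pair_prob_space "normal_block n v2" PY ..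
  interpret N12Y: pair_prob_space "normal_block n v1" "normal_block n v2 \<Otimes>\<^sub>M PY" ..
  interpret Q: prob_space Q unfolding Q_def by (rule N12Y.prob_space_axioms)
  have mJ: "m q \<in> J" if "q \<in> space Q" for q using measurable_space[OF m that] by simp
  have "space Q \<noteq> {}" by (rule Q.not_empty)
  then have "J \<noteq> {}" using mJ by auto
  then have cJ: "0 < real (card J)" using J by (simp add: card_gt_0_iff)
  \<comment> \<open>The index set is finite, so the selected reproduction is a countable gluing of
    the measurable functions \<open>r j\<close>.\<close>
  have comp[measurable]: "(\<lambda>q. r (m q) (snd (snd q)) i) \<in> borel_measurable Q"
    if i: "i < n" and r: "\<And>j. j \<in> J \<Longrightarrow> r j \<in> PY \<rightarrow>\<^sub>M PiM {..<n} (\<lambda>_. borel)" for r :: "'j \<Rightarrow> 'y \<Rightarrow> nat \<Rightarrow> real" and i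
  proof (rule measurable_compose_countable'[OF _ m countable_finite[OF J]])
    fix j assume "j \<in> J"
    note r[OF this, measurable]
    show "(\<lambda>q. r j (snd (snd q)) i) \<in> borel_measurable Q"
      unfolding Q_def using i[folded lessThan_iff] by measurable
  qed
  have l1: "distr Q borel (\<lambda>q. fst q i) = centered_normal v1" if "i < n" for i
  proof -
    have "distr Q borel (\<lambda>q. fst q i) = distr (distr Q (normal_block n v1) fst) borel (\<lambda>z. z i)"
      unfolding Q_def using that by (subst distr_distr) (auto simp: comp_def)
    then show ?thesis
      unfolding Q_def N2Y.distr_pair_fst using that by (simp add: distr_normal_block_component)
  qed
  have l2: "distr Q borel (\<lambda>q. fst (snd q) i) = centered_normal v2" if "i < n" for i
  proof -
    have "distr Q borel (\<lambda>q. fst (snd q) i) = distr (distr (distr Q (normal_block n v2 \<Otimes>\<^sub>M PY) snd) (normal_block n v2) fst) borel (\<lambda>z. z i)"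
      unfolding Q_def using that by (simp add: distr_distr comp_def)
    also have "distr Q (normal_block n v2 \<Otimes>\<^sub>M PY) snd = normal_block n v2 \<Otimes>\<^sub>M PY"
      unfolding Q_def by (rule distr_pair_snd) unfold_locales
    finally show ?thesis
      unfolding PY.distr_pair_fst using that by (simp add: distr_normal_block_component)
  qed
  let ?g1 = "\<lambda>q. \<Sum>i<n. log_lik v1 D1 (fst q i) (r1 (m q) (snd (snd q)) i)"
  let ?g2 = "\<lambda>q. \<Sum>i<n. log_lik v2 D2 (fst (snd q) i) (r2 (m q) (snd (snd q)) i)"
  have f1: "(\<lambda>q. fst q i) \<in> borel_measurable Q" "(\<lambda>q. fst (snd q) i) \<in> borel_measurable Q" if "i < n" for i
    unfolding Q_def using that[folded lessThan_iff] by measurable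
  note e1 = Q.expectation_log_lik_ge[OF f1(1) comp[of _ r1, OF _ r1] l1 v(1) D(1) \<epsilon> d1]
  note e2 = Q.expectation_log_lik_ge[OF f1(2) comp[of _ r2, OF _ r2] l2 v(2) D(2) \<epsilon> d2]
  have "Q.expectation (\<lambda>q. ?g1 q + ?g2 q) \<le> ln (card J)"
  proof (rule Q.expectation_le_ln)
    show "integrable Q (\<lambda>q. ?g1 q + ?g2 q)" using e1(1) e2(1) by simp
    show "0 < real (card J)" by fact
    have "(\<integral>\<^sup>+q. ennreal (exp (\<Sum>i<n. log_lik v1 D1 (fst q i) (r1 (m q) (snd (snd q)) i)
        + log_lik v2 D2 (fst (snd q) i) (r2 (m q) (snd (snd q)) i))) \<partial>Q) \<le> of_nat (card J)"
      unfolding Q_def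
      by (rule nn_integral_exp_code_le_card)
        (use D J r1 r2 mJ in \<open>auto simp: prob_space_centered_normal PY nn_integral_exp_log_lik Q_def split_beta'\<close>)
    then show "(\<integral>\<^sup>+q. ennreal (exp (?g1 q + ?g2 q)) \<partial>Q) \<le> ennreal (real (card J))"
      by (simp add: sum.distrib ennreal_of_nat_eq_real_of_nat)
  qed
  moreover have "Q.expectation (\<lambda>q. ?g1 q + ?g2 q) = Q.expectation ?g1 + Q.expectation ?g2"
    using e1(1) e2(1) by simp
  ultimately have "n * (gaussian_rate v1 D1 - \<epsilon> / 2) + n * (gaussian_rate v2 D2 - \<epsilon> / 2) \<le> ln (card J)"
    using e1(2) e2(2) by linarith
  then show ?thesis by (simp add: algebra_simps)
qed

section \<open>Codes in residual coordinates\<close>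

abbreviation seqs3 :: "nat \<Rightarrow> ((nat \<Rightarrow> real) \<times> (nat \<Rightarrow> real) \<times> (nat \<Rightarrow> real)) measure" where
  "seqs3 n \<equiv> seqs n \<Otimes>\<^sub>M seqs n \<Otimes>\<^sub>M seqs n"

text \<open>The transmitted index as a function of the residual blocks. The block \<open>w\<close>
  is absent since the encoder does not see \<open>S\<close>. The restrictions to
  \<open>{..<n}\<close> match those in the block projections, whose values must be
  extensional.\<close>

definition code_msg :: "real \<Rightarrow> real \<Rightarrow> nat \<Rightarrow> encoder \<Rightarrow> (nat \<Rightarrow> real) \<times> (nat \<Rightarrow> real) \<times> (nat \<Rightarrow> real) \<Rightarrow> nat" where
  "code_msg a b n enc p = (case p of (z1, z2, y) \<Rightarrow>
     enc (\<lambda>i\<in>{..<n}. a * y i + z1 i, \<lambda>i\<in>{..<n}. b * y i + z2 i, \<lambda>i\<in>{..<n}. y i))"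

definition code_out where
  "code_out a b n enc dec p = dec (code_msg a b n enc p, \<lambda>i\<in>{..<n}. snd (snd p) i)"

lemma nn_integral_centered_normal_add_square:
  assumes w: "w \<ge> 0"
  shows "(\<integral>\<^sup>+x. ennreal ((x + h)\<^sup>2) \<partial>centered_normal w) = ennreal (w + h\<^sup>2)"
proof -
  interpret prob_space "centered_normal w" by (rule prob_space_centered_normal)
  note m = centered_normal_moments[OF w]
  have eq: "(\<lambda>x. (x + h)\<^sup>2) = (\<lambda>x. x\<^sup>2 + 2 * h * x + h\<^sup>2)"
    by (simp add: power2_eq_square algebra_simps)
  have i: "integrable (centered_normal w) (\<lambda>x. (x + h)\<^sup>2)" unfolding eq using m by simp
  have "(\<integral>x. (x + h)\<^sup>2 \<partial>centered_normal w) = w + h\<^sup>2"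
    unfolding eq using m prob_space by simp
  then show ?thesis by (subst nn_integral_eq_integral[OF i]) auto
qed

lemma nn_integral_normal_block_sq_distortion:
  assumes w: "w \<ge> 0" and n: "n > 0"
  shows "(\<integral>\<^sup>+x. ennreal ((1 / real n) * (\<Sum>i<n. (x i + h i)\<^sup>2)) \<partial>normal_block n w)
    = ennreal w + ennreal ((1 / real n) * (\<Sum>i<n. (h i)\<^sup>2))"
proof -
  have c: "(\<integral>\<^sup>+x. ennreal ((x i + h i)\<^sup>2) \<partial>normal_block n w) = ennreal (w + (h i)\<^sup>2)" if "i < n" for i
  proof -
    have "(\<integral>\<^sup>+x. ennreal ((x i + h i)\<^sup>2) \<partial>normal_block n w)
        = (\<integral>\<^sup>+x. ennreal ((x + h i)\<^sup>2) \<partial>distr (normal_block n w) borel (\<lambda>x. x i))"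
      using that by (subst nn_integral_distr) auto
    then show ?thesis
      using nn_integral_centered_normal_add_square[OF w] distr_normal_block_component[OF that] by simp
  qed
  have "(\<integral>\<^sup>+x. ennreal ((1 / real n) * (\<Sum>i<n. (x i + h i)\<^sup>2)) \<partial>normal_block n w)
      = (\<integral>\<^sup>+x. ennreal (1 / real n) * (\<Sum>i<n. ennreal ((x i + h i)\<^sup>2)) \<partial>normal_block n w)"
    by (intro nn_integral_cong, subst ennreal_mult) (auto simp: sum_nonneg)
  also have "\<dots> = ennreal (1 / real n) * (\<Sum>i<n. \<integral>\<^sup>+x. ennreal ((x i + h i)\<^sup>2) \<partial>normal_block n w)"
    by (subst nn_integral_cmult, simp, subst nn_integral_sum) auto
  also have "(\<Sum>i<n. \<integral>\<^sup>+x. ennreal ((x i + h i)\<^sup>2) \<partial>normal_block n w) = ennreal (\<Sum>i<n. w + (h i)\<^sup>2)"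
    using w by (subst sum_ennreal[symmetric]) (auto intro!: sum.cong simp: c simp del: ennreal_plus)
  also have "ennreal (1 / real n) * \<dots> = ennreal ((1 / real n) * (\<Sum>i<n. w + (h i)\<^sup>2))"
    using w by (subst ennreal_mult) (auto simp: sum_nonneg)
  also have "(1 / real n) * (\<Sum>i<n. w + (h i)\<^sup>2) = w + (1 / real n) * (\<Sum>i<n. (h i)\<^sup>2)"
    using n by (simp add: sum.distrib field_simps)
  finally show ?thesis using w by (simp add: sum_nonneg)
qed

lemma code_measurable:
  assumes code: "is_code n R enc dec"
  shows "code_msg a b n enc \<in> residual_block n v1 v2 vY \<rightarrow>\<^sub>M count_space (code_index n R)"
    and "code_out a b n enc dec \<in> residual_block n v1 v2 vY \<rightarrow>\<^sub>M seqs3 n"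
proof -
  have [measurable]: "enc \<in> seqs3 n \<rightarrow>\<^sub>M count_space (code_index n R)"
    "dec \<in> count_space (code_index n R) \<Otimes>\<^sub>M seqs n \<rightarrow>\<^sub>M seqs3 n"
    using code by (auto simp: is_code_def)
  show [measurable]: "code_msg a b n enc \<in> residual_block n v1 v2 vY \<rightarrow>\<^sub>M count_space (code_index n R)"
    unfolding code_msg_def split_beta' by measurable
  show "code_out a b n enc dec \<in> residual_block n v1 v2 vY \<rightarrow>\<^sub>M seqs3 n"
    unfolding code_out_def by measurable
qed

text \<open>The reconstruction depends only on \<open>(z1, z2, y)\<close>, so the block
  \<open>w\<close> can be integrated first. It drops out of \<open>expected_d1\<close> and
  \<open>expected_d2\<close>. In \<open>expected_ds\<close> it is centered noise independent of the
  remaining error, so the cross term vanishes and exactly the variance \<open>w\<close> is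
  added.\<close>

lemma expected_distortions:
  assumes law: "source_law M S X1 X2 Y w v1 v2 vY a b c"
    and w: "w \<ge> 0" and n: "n > 0" and code: "is_code n R enc dec"
  defines "Q \<equiv> residual_block n v1 v2 vY" and "out \<equiv> code_out a b n enc dec"
  shows "expected_d1 (iid_source M S X1 X2 Y n) n enc dec =
      (\<integral>\<^sup>+p. ennreal ((1 / real n) * (\<Sum>i<n. (a * snd (snd p) i + fst p i - fst (out p) i)\<^sup>2)) \<partial>Q)"
    and "expected_d2 (iid_source M S X1 X2 Y n) n enc dec =
      (\<integral>\<^sup>+p. ennreal ((1 / real n) * (\<Sum>i<n. (b * snd (snd p) i + fst (snd p) i - fst (snd (out p)) i)\<^sup>2)) \<partial>Q)"
    and "expected_ds (iid_source M S X1 X2 Y n) n enc dec = ennreal w +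
      (\<integral>\<^sup>+p. ennreal ((1 / real n) * (\<Sum>i<n. (c * (a * snd (snd p) i + fst p i) - snd (snd (out p)) i)\<^sup>2)) \<partial>Q)"
proof -
  let ?W = "normal_block n w" and ?N = "PiM {..<n} (\<lambda>_. borel :: (real \<times> real \<times> real \<times> real) measure)"
  let ?T = "\<lambda>(w, z1, z2, y). \<lambda>i\<in>{..<n}. source_map a b c (w i, z1 i, z2 i, y i)"
  note src = iid_source_eq[OF law, of n, folded Q_def]
  interpret W: prob_space ?W by (rule prob_space_normal_block)
  interpret N1: prob_space "normal_block n v1" by (rule prob_space_normal_block)
  interpret N2: prob_space "normal_block n v2" by (rule prob_space_normal_block)
  interpret NY: prob_space "normal_block n vY" by (rule prob_space_normal_block)
  interpret N2Y: pair_prob_space "normal_block n v2" "normal_block n vY" ..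
  interpret N12Y: pair_prob_space "normal_block n v1" "normal_block n v2 \<Otimes>\<^sub>M normal_block n vY" ..
  interpret Q: prob_space Q unfolding Q_def by (rule N12Y.prob_space_axioms)
  interpret WQ: pair_prob_space ?W Q ..
  have out[measurable]: "out \<in> Q \<rightarrow>\<^sub>M seqs3 n"
    unfolding Q_def out_def by (rule code_measurable[OF code])
  have [measurable]: "enc \<in> seqs3 n \<rightarrow>\<^sub>M count_space (code_index n R)"
    "dec \<in> count_space (code_index n R) \<Otimes>\<^sub>M seqs n \<rightarrow>\<^sub>M seqs3 n"
    using code by (auto simp: is_code_def)
  have T[measurable]: "?T \<in> ?W \<Otimes>\<^sub>M Q \<rightarrow>\<^sub>M ?N"
    unfolding Q_def source_map_def split_beta' borel_prod[symmetric] by measurable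
  have B[measurable]: "S_block n \<in> ?N \<rightarrow>\<^sub>M seqs n" "X1_block n \<in> ?N \<rightarrow>\<^sub>M seqs n"
      "X2_block n \<in> ?N \<rightarrow>\<^sub>M seqs n" "Y_block n \<in> ?N \<rightarrow>\<^sub>M seqs n"
    unfolding S_block_def X1_block_def X2_block_def Y_block_def split_beta' borel_prod[symmetric] by measurable
  have rec[measurable]: "reconstruct n enc dec \<in> ?N \<rightarrow>\<^sub>M seqs3 n"
    unfolding reconstruct_def by measurable
  have sq[measurable]: "(\<lambda>z. sq_distortion n (f z) (g z)) \<in> borel_measurable ?N"
    if [measurable]: "f \<in> ?N \<rightarrow>\<^sub>M seqs n" "g \<in> ?N \<rightarrow>\<^sub>M seqs n" for f g
    unfolding sq_distortion_def by measurable
  have recT: "reconstruct n enc dec (?T (x, p)) = out p" for x p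
    by (auto simp: reconstruct_def X1_block_def X2_block_def Y_block_def source_map_def out_def
        code_out_def code_msg_def split_beta' cong: restrict_cong)
  have d: "(\<integral>\<^sup>+z. ennreal (sq_distortion n (f z) (g (reconstruct n enc dec z))) \<partial>iid_source M S X1 X2 Y n)
      = (\<integral>\<^sup>+p. \<integral>\<^sup>+x. ennreal ((1 / real n) * (\<Sum>i<n. (f (?T (x, p)) i - g (out p) i)\<^sup>2)) \<partial>?W \<partial>Q)"
    if [measurable]: "f \<in> ?N \<rightarrow>\<^sub>M seqs n" "g \<in> seqs3 n \<rightarrow>\<^sub>M seqs n" for f g
  proof -
    have "(\<integral>\<^sup>+z. ennreal (sq_distortion n (f z) (g (reconstruct n enc dec z))) \<partial>iid_source M S X1 X2 Y n)
      = (\<integral>\<^sup>+q. ennreal (sq_distortion n (f (?T q)) (g (reconstruct n enc dec (?T q)))) \<partial>(?W \<Otimes>\<^sub>M Q))"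
      unfolding src by (rule nn_integral_distr) measurable
    also have "\<dots> = (\<integral>\<^sup>+p. \<integral>\<^sup>+x. ennreal (sq_distortion n (f (?T (x, p))) (g (reconstruct n enc dec (?T (x, p))))) \<partial>?W \<partial>Q)"
      by (rule WQ.nn_integral_snd[symmetric]) measurable
    finally show ?thesis unfolding recT sq_distortion_def .
  qed
  show "expected_d1 (iid_source M S X1 X2 Y n) n enc dec =
      (\<integral>\<^sup>+p. ennreal ((1 / real n) * (\<Sum>i<n. (a * snd (snd p) i + fst p i - fst (out p) i)\<^sup>2)) \<partial>Q)"
    unfolding expected_d1_def
    by (subst d) (auto simp: X1_block_def source_map_def split_beta' W.emeasure_space_1)
  show "expected_d2 (iid_source M S X1 X2 Y n) n enc dec =
      (\<integral>\<^sup>+p. ennreal ((1 / real n) * (\<Sum>i<n. (b * snd (snd p) i + fst (snd p) i - fst (snd (out p)) i)\<^sup>2)) \<partial>Q)"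
    unfolding expected_d2_def
    by (subst d) (auto simp: X2_block_def source_map_def split_beta' W.emeasure_space_1)
  have "expected_ds (iid_source M S X1 X2 Y n) n enc dec =
      (\<integral>\<^sup>+p. \<integral>\<^sup>+x. ennreal ((1 / real n) * (\<Sum>i<n. (x i + (c * (a * snd (snd p) i + fst p i) - snd (snd (out p)) i))\<^sup>2)) \<partial>?W \<partial>Q)"
    unfolding expected_ds_def
    by (subst d) (auto simp: S_block_def source_map_def split_beta' algebra_simps)
  also have "\<dots> = (\<integral>\<^sup>+p. ennreal w + ennreal ((1 / real n) * (\<Sum>i<n. (c * (a * snd (snd p) i + fst p i) - snd (snd (out p)) i)\<^sup>2)) \<partial>Q)"
    unfolding nn_integral_normal_block_sq_distortion[OF w n] ..
  also have "\<dots> = ennreal w +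
      (\<integral>\<^sup>+p. ennreal ((1 / real n) * (\<Sum>i<n. (c * (a * snd (snd p) i + fst p i) - snd (snd (out p)) i)\<^sup>2)) \<partial>Q)"
  proof (subst nn_integral_add)
    have Qm[measurable]: "(\<lambda>p. snd (snd p) i) \<in> borel_measurable Q" "(\<lambda>p. fst p i) \<in> borel_measurable Q" if "i \<in> {..<n}" for i
      unfolding Q_def using that by measurable
    show "(\<lambda>p. ennreal ((1 / real n) * (\<Sum>i<n. (c * (a * snd (snd p) i + fst p i) - snd (snd (out p)) i)\<^sup>2))) \<in> borel_measurable Q"
      by measurable
  qed (auto simp: Q.emeasure_space_1)
  finally show "expected_ds (iid_source M S X1 X2 Y n) n enc dec = ennreal w +
      (\<integral>\<^sup>+p. ennreal ((1 / real n) * (\<Sum>i<n. (c * (a * snd (snd p) i + fst p i) - snd (snd (out p)) i)\<^sup>2)) \<partial>Q)" .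
qed

lemma finite_code_index: "finite (code_index n R)"
  and card_code_index_le: "real (card (code_index n R)) \<le> 2 powr (real n * R)"
proof -
  let ?x = "2 powr (real n * R)"
  have sub: "code_index n R \<subseteq> {1..nat \<lfloor>?x\<rfloor>}"
    by (auto simp: code_index_def le_nat_floor)
  then show "finite (code_index n R)" by (rule finite_subset) simp
  have "card (code_index n R) \<le> nat \<lfloor>?x\<rfloor>" using card_mono[OF _ sub] by simp
  then show "real (card (code_index n R)) \<le> ?x" using of_nat_floor[of ?x] by (meson of_nat_mono order_trans powr_ge_zero)
qed

text \<open>The functions \<open>h1\<close> and \<open>h2\<close> turn the decoder output into
  estimates of \<open>X1\<close> and \<open>X2\<close>. Leaving \<open>h1\<close> open allows two
  uses: with the reproduction of \<open>X1\<close>, and with the reproduction of \<open>S\<close>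
  divided by \<open>c\<close>.\<close>

lemma converse_code:
  fixes a b vY :: real
  assumes code: "is_code n R enc dec" and n: "n > 0"
    and v: "v1 \<ge> 0" "v2 \<ge> 0" and D: "D1 > 0" "D2 > 0" and \<epsilon>: "\<epsilon> \<ge> 0"
    and h[measurable]: "h1 \<in> seqs3 n \<rightarrow>\<^sub>M seqs n" "h2 \<in> seqs3 n \<rightarrow>\<^sub>M seqs n"
  defines "Q \<equiv> residual_block n v1 v2 vY" and "out \<equiv> code_out a b n enc dec"
  assumes d1: "(\<integral>\<^sup>+p. ennreal ((1 / real n) * (\<Sum>i<n. (a * snd (snd p) i + fst p i - h1 (out p) i)\<^sup>2)) \<partial>Q) \<le> ennreal (D1 * (1 + \<epsilon>))"
    and d2: "(\<integral>\<^sup>+p. ennreal ((1 / real n) * (\<Sum>i<n. (b * snd (snd p) i + fst (snd p) i - h2 (out p) i)\<^sup>2)) \<partial>Q) \<le> ennreal (D2 * (1 + \<epsilon>))"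
  shows "gaussian_rate v1 D1 + gaussian_rate v2 D2 - \<epsilon> \<le> R * ln 2"
proof -
  let ?J = "code_index n R"
  \<comment> \<open>The decoder knows \<open>y\<close>, so subtracting \<open>a * y\<close> turns an
    estimate of \<open>X1\<close> into an estimate of \<open>Z1\<close> with the same error;
    likewise \<open>b * y\<close> and \<open>Z2\<close> below.\<close>
  define r1 where "r1 = (\<lambda>j y. \<lambda>i\<in>{..<n}. h1 (dec (j, \<lambda>i\<in>{..<n}. y i)) i - a * y i)"
  define r2 where "r2 = (\<lambda>j y. \<lambda>i\<in>{..<n}. h2 (dec (j, \<lambda>i\<in>{..<n}. y i)) i - b * y i)"
  have [measurable]: "dec \<in> count_space ?J \<Otimes>\<^sub>M seqs n \<rightarrow>\<^sub>M seqs3 n"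
    using code by (auto simp: is_code_def)
  have m[measurable]: "code_msg a b n enc \<in> Q \<rightarrow>\<^sub>M count_space ?J"
    unfolding Q_def by (rule code_measurable[OF code])
  have out[measurable]: "out \<in> Q \<rightarrow>\<^sub>M seqs3 n"
    unfolding Q_def out_def by (rule code_measurable[OF code])
  have Qm[measurable]: "(\<lambda>p. snd (snd p) i) \<in> borel_measurable Q" "(\<lambda>p. fst p i) \<in> borel_measurable Q"
      "(\<lambda>p. fst (snd p) i) \<in> borel_measurable Q" if "i \<in> {..<n}" for i
    unfolding Q_def using that by measurable
  have scale: "(\<integral>\<^sup>+p. ennreal (\<Sum>i<n. (g p i)\<^sup>2) \<partial>Q) \<le> ennreal (n * (D * (1 + \<epsilon>)))"
    if "(\<integral>\<^sup>+p. ennreal ((1 / real n) * (\<Sum>i<n. (g p i)\<^sup>2)) \<partial>Q) \<le> ennreal (D * (1 + \<epsilon>))"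
      and [measurable]: "\<And>i. i \<in> {..<n} \<Longrightarrow> (\<lambda>p. g p i) \<in> borel_measurable Q" for g and D :: real
  proof -
    have "(\<integral>\<^sup>+p. ennreal (\<Sum>i<n. (g p i)\<^sup>2) \<partial>Q)
        = (\<integral>\<^sup>+p. ennreal n * ennreal ((1 / real n) * (\<Sum>i<n. (g p i)\<^sup>2)) \<partial>Q)"
      using n by (intro nn_integral_cong, subst ennreal_mult[symmetric]) (auto simp: sum_nonneg)
    also have "\<dots> = ennreal n * (\<integral>\<^sup>+p. ennreal ((1 / real n) * (\<Sum>i<n. (g p i)\<^sup>2)) \<partial>Q)"
      by (rule nn_integral_cmult) measurable
    also have "\<dots> \<le> ennreal n * ennreal (D * (1 + \<epsilon>))" using that(1) by (rule mult_left_mono) simp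
    also have "\<dots> = ennreal (n * (D * (1 + \<epsilon>)))" by (simp add: ennreal_mult')
    finally show ?thesis .
  qed
  have oeq: "dec (code_msg a b n enc p, \<lambda>i\<in>{..<n}. snd (snd p) i) = out p" for p
    by (simp add: out_def code_out_def)
  have "n * (gaussian_rate v1 D1 + gaussian_rate v2 D2 - \<epsilon>) \<le> ln (card ?J)"
  proof (rule converse_block[OF prob_space_normal_block finite_code_index v D \<epsilon>])
    show "r1 j \<in> normal_block n vY \<rightarrow>\<^sub>M seqs n" "r2 j \<in> normal_block n vY \<rightarrow>\<^sub>M seqs n" if "j \<in> ?J" for j
    proof -
      have [measurable]: "j \<in> space (count_space ?J)" using that by simp
      show "r1 j \<in> normal_block n vY \<rightarrow>\<^sub>M seqs n" "r2 j \<in> normal_block n vY \<rightarrow>\<^sub>M seqs n"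
        unfolding r1_def r2_def by measurable
    qed
    show "code_msg a b n enc \<in> residual_block n v1 v2 vY \<rightarrow>\<^sub>M count_space ?J"
      using m by (simp add: Q_def)
    have "(\<integral>\<^sup>+p. ennreal (\<Sum>i<n. (fst p i - r1 (code_msg a b n enc p) (snd (snd p)) i)\<^sup>2) \<partial>Q)
        = (\<integral>\<^sup>+p. ennreal (\<Sum>i<n. (a * snd (snd p) i + fst p i - h1 (out p) i)\<^sup>2) \<partial>Q)"
      by (simp add: r1_def oeq algebra_simps)
    then show "(\<integral>\<^sup>+p. ennreal (\<Sum>i<n. (fst p i - r1 (code_msg a b n enc p) (snd (snd p)) i)\<^sup>2) \<partial>residual_block n v1 v2 vY)
        \<le> ennreal (n * (D1 * (1 + \<epsilon>)))"
      using scale[OF d1] unfolding Q_def[symmetric] by simp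
    have "(\<integral>\<^sup>+p. ennreal (\<Sum>i<n. (fst (snd p) i - r2 (code_msg a b n enc p) (snd (snd p)) i)\<^sup>2) \<partial>Q)
        = (\<integral>\<^sup>+p. ennreal (\<Sum>i<n. (b * snd (snd p) i + fst (snd p) i - h2 (out p) i)\<^sup>2) \<partial>Q)"
      by (simp add: r2_def oeq algebra_simps)
    then show "(\<integral>\<^sup>+p. ennreal (\<Sum>i<n. (fst (snd p) i - r2 (code_msg a b n enc p) (snd (snd p)) i)\<^sup>2) \<partial>residual_block n v1 v2 vY)
        \<le> ennreal (n * (D2 * (1 + \<epsilon>)))"
      using scale[OF d2] unfolding Q_def[symmetric] by simp
  qed
  also have "\<dots> \<le> n * (R * ln 2)"
  \<comment> \<open>The convention \<open>ln 0 = 0\<close> would violate the bound for negative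
    \<open>R\<close>. The empty index set is impossible, since the encoder maps a nonempty space
    into it.\<close>
  proof (cases "card ?J = 0")
    case True
    interpret N1: prob_space "normal_block n v1" by (rule prob_space_normal_block)
    interpret N2: prob_space "normal_block n v2" by (rule prob_space_normal_block)
    interpret NY: prob_space "normal_block n vY" by (rule prob_space_normal_block)
    have "space Q \<noteq> {}"
      using N1.not_empty N2.not_empty NY.not_empty by (simp add: Q_def space_pair_measure)
    then have "?J \<noteq> {}" using measurable_space[OF m] by auto
    then show ?thesis using True finite_code_index by simp
  next
    case False
    then have "ln (card ?J) \<le> ln (2 powr (real n * R))"
      using card_code_index_le by (subst ln_le_cancel_iff) auto
    then show ?thesis by (simp add: ln_powr mult.assoc)
  qed
  finally show ?thesis using n by simp
qed

text \<open>The converse holds at every block length, so one \<open>n\<close> suffices at which all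
  three distortions are within a factor \<open>1 + \<epsilon>\<close> of their targets. Such an
  \<open>n\<close> exists because the limits lie strictly below the enlarged targets, and \<epsilon>
  is arbitrary.\<close>

lemma achievable_rate_ge:
  assumes law: "source_law M S X1 X2 Y w v1 v2 vY a b c"
    and w: "w \<ge> 0" and v: "v1 \<ge> 0" "v2 \<ge> 0" and D: "D1 > 0" "D2 > 0" "Ds > w"
    and ach: "achievable M S X1 X2 Y R D1 D2 Ds"
  shows "gaussian_rate v1 D1 + gaussian_rate v2 D2 \<le> R * ln 2"
    and "c \<noteq> 0 \<Longrightarrow> gaussian_rate v1 ((Ds - w) / c\<^sup>2) + gaussian_rate v2 D2 \<le> R * ln 2"
proof -
  let ?P = "iid_source M S X1 X2 Y"
  obtain enc dec L1 L2 Ls where code: "\<forall>\<^sub>F n in sequentially. is_code n R (enc n) (dec n)"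
    and L1: "(\<lambda>n. expected_d1 (?P n) n (enc n) (dec n)) \<longlonglongrightarrow> L1" "L1 \<le> ennreal D1"
    and L2: "(\<lambda>n. expected_d2 (?P n) n (enc n) (dec n)) \<longlonglongrightarrow> L2" "L2 \<le> ennreal D2"
    and Ls: "(\<lambda>n. expected_ds (?P n) n (enc n) (dec n)) \<longlonglongrightarrow> Ls" "Ls \<le> ennreal Ds"
    using ach unfolding achievable_def by blast
  have *: "gaussian_rate v1 D1 + gaussian_rate v2 D2 - \<epsilon> \<le> R * ln 2 \<and>
      (c \<noteq> 0 \<longrightarrow> gaussian_rate v1 ((Ds - w) / c\<^sup>2) + gaussian_rate v2 D2 - \<epsilon> \<le> R * ln 2)" if \<epsilon>: "\<epsilon> > 0" for \<epsilon>
  proof -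
    have "L1 < ennreal (D1 * (1 + \<epsilon>))" "L2 < ennreal (D2 * (1 + \<epsilon>))"
      using L1(2) L2(2) D \<epsilon> by (auto intro!: le_less_trans[OF L1(2)] le_less_trans[OF L2(2)] ennreal_lessI simp: algebra_simps)
    \<comment> \<open>The factor is applied to \<open>Ds - w\<close> rather than to
      \<open>Ds\<close>, so that after removing \<open>w\<close> and dividing by \<open>c^2\<close>
      the target again has the form \<open>D * (1 + \<epsilon>)\<close>.\<close>
    moreover have "Ls < ennreal (w + (Ds - w) * (1 + \<epsilon>))"
    proof (intro le_less_trans[OF Ls(2)] ennreal_lessI)
      have "0 < (Ds - w) * \<epsilon>" using D \<epsilon> by simp
      then show "Ds < w + (Ds - w) * (1 + \<epsilon>)" by (simp add: algebra_simps)
      then show "0 < w + (Ds - w) * (1 + \<epsilon>)" using D w by linarith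
    qed
    ultimately have "\<forall>\<^sub>F n in sequentially. expected_d1 (?P n) n (enc n) (dec n) < ennreal (D1 * (1 + \<epsilon>)) \<and>
        expected_d2 (?P n) n (enc n) (dec n) < ennreal (D2 * (1 + \<epsilon>)) \<and>
        expected_ds (?P n) n (enc n) (dec n) < ennreal (w + (Ds - w) * (1 + \<epsilon>)) \<and>
        is_code n R (enc n) (dec n) \<and> n > 0"
      using order_tendstoD(2)[OF L1(1)] order_tendstoD(2)[OF L2(1)] order_tendstoD(2)[OF Ls(1)] code eventually_gt_at_top[of 0]
      by (simp add: eventually_conj_iff)
    then obtain n where n: "n > 0" and cd: "is_code n R (enc n) (dec n)"
      and d1: "expected_d1 (?P n) n (enc n) (dec n) \<le> ennreal (D1 * (1 + \<epsilon>))"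
      and d2: "expected_d2 (?P n) n (enc n) (dec n) \<le> ennreal (D2 * (1 + \<epsilon>))"
      and ds: "expected_ds (?P n) n (enc n) (dec n) \<le> ennreal (w + (Ds - w) * (1 + \<epsilon>))"
      by (auto dest: eventually_happens' [OF sequentially_bot] intro: less_imp_le)
    let ?Q = "residual_block n v1 v2 vY" and ?out = "code_out a b n (enc n) (dec n)"
    note e = expected_distortions[OF law w n cd]
    let ?t = "\<lambda>p. (1 / real n) * (\<Sum>i<n. (a * snd (snd p) i + fst p i - (\<lambda>i\<in>{..<n}. snd (snd (?out p)) i / c) i)\<^sup>2)"
    let ?u = "\<lambda>p. (1 / real n) * (\<Sum>i<n. (c * (a * snd (snd p) i + fst p i) - snd (snd (?out p)) i)\<^sup>2)"
    have 1: "gaussian_rate v1 D1 + gaussian_rate v2 D2 - \<epsilon> \<le> R * ln 2"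
      by (rule converse_code[OF cd n v D(1,2) less_imp_le[OF \<epsilon>], of fst "\<lambda>t. fst (snd t)" vY a b])
        (use d1 d2 in \<open>auto simp: e\<close>)
    \<comment> \<open>Dividing the reproduction of \<open>S\<close> by \<open>c\<close> estimates
      \<open>X1\<close>, with squared error reduced by the factor \<open>c^2\<close>.\<close>
    have 2: "gaussian_rate v1 ((Ds - w) / c\<^sup>2) + gaussian_rate v2 D2 - \<epsilon> \<le> R * ln 2" if c: "c \<noteq> 0"
    proof (rule converse_code[OF cd n v _ D(2) less_imp_le[OF \<epsilon>], of _ "\<lambda>t. \<lambda>i\<in>{..<n}. snd (snd t) i / c" "\<lambda>t. fst (snd t)" vY a b])
      show "0 < (Ds - w) / c\<^sup>2" using D c by simp
      have Qm[measurable]: "(\<lambda>p. snd (snd p) i) \<in> borel_measurable ?Q" "(\<lambda>p. fst p i) \<in> borel_measurable ?Q"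
        if "i \<in> {..<n}" for i using that by measurable
      have [measurable]: "?out \<in> ?Q \<rightarrow>\<^sub>M seqs3 n"
        by (rule code_measurable[OF cd])
      let ?E = "\<integral>\<^sup>+p. ennreal (?u p) \<partial>?Q"
      have "ennreal w + ?E \<le> ennreal w + ennreal ((Ds - w) * (1 + \<epsilon>))"
        using ds w D \<epsilon> unfolding e by (simp add: ennreal_plus[symmetric] del: ennreal_plus)
      then have E: "?E \<le> ennreal ((Ds - w) * (1 + \<epsilon>))" by (simp add: ennreal_add_left_cancel_le)
      have "(\<integral>\<^sup>+p. ennreal (?t p) \<partial>?Q)
        = (\<integral>\<^sup>+p. ennreal (1 / c\<^sup>2) * ennreal (?u p) \<partial>?Q)"
      proof (rule nn_integral_cong)
        fix p
        have t: "(x - s / c)\<^sup>2 = (1 / c\<^sup>2) * (c * x - s)\<^sup>2" for x s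
          using c by (simp add: power2_eq_square field_simps)
        have "?t p
          = (1 / c\<^sup>2) * (?u p)"
          by (simp add: t sum_distrib_left mult.commute)
        then show "ennreal (?t p)
          = ennreal (1 / c\<^sup>2) * ennreal (?u p)"
          by (simp only: ennreal_mult' zero_le_divide_iff) (simp add: ennreal_mult'[symmetric] sum_nonneg)
      qed
      also have "\<dots> = ennreal (1 / c\<^sup>2) * ?E" by (rule nn_integral_cmult) measurable
      also have "\<dots> \<le> ennreal (1 / c\<^sup>2) * ennreal ((Ds - w) * (1 + \<epsilon>))" using E by (rule mult_left_mono) simp
      also have "\<dots> = ennreal ((Ds - w) / c\<^sup>2 * (1 + \<epsilon>))" by (simp add: ennreal_mult'[symmetric])
      finally show "(\<integral>\<^sup>+p. ennreal (?t p) \<partial>?Q)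
        \<le> ennreal ((Ds - w) / c\<^sup>2 * (1 + \<epsilon>))" .
    qed (use d2 in \<open>auto simp: e\<close>)
    show ?thesis using 1 2 by blast
  qed
  show "gaussian_rate v1 D1 + gaussian_rate v2 D2 \<le> R * ln 2"
  proof (rule field_le_epsilon)
    fix e :: real assume "0 < e"
    from *[OF this] show "gaussian_rate v1 D1 + gaussian_rate v2 D2 \<le> R * ln 2 + e" by simp
  qed
  show "gaussian_rate v1 ((Ds - w) / c\<^sup>2) + gaussian_rate v2 D2 \<le> R * ln 2" if "c \<noteq> 0"
  proof (rule field_le_epsilon)
    fix e :: real assume "0 < e"
    from *[OF this] that
    show "gaussian_rate v1 ((Ds - w) / c\<^sup>2) + gaussian_rate v2 D2 \<le> R * ln 2 + e" by simp
  qed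
qed

subsection \<open>Random Gaussian codebooks\<close>

text \<open>Convexity on the segment from 0 to \<open>- x\<close>. It separates two causes of a
  covering failure: the atypical mass \<open>1 - p\<close>, and a codebook that is too
  small.\<close>

lemma exp_le_interpolate:
  fixes x p :: real
  assumes "0 \<le> p" "p \<le> 1"
  shows "exp (- (x * p)) \<le> 1 - p + p * exp (- x)"
  using convex_onD[OF exp_convex, of p 0 "- x"] assms by (simp add: mult.commute)

text \<open>Random coding: if every one of \<open>N\<close> independent codewords misses \<open>z\<close> with probability
  \<open>1 - Q\<close>, where \<open>Q \<ge> exp (-a) p\<close>, they all miss it with probability at most
  \<open>exp (- N exp (-a) p) \<le> 1 - p + exp (- N exp (-a))\<close>.\<close>

lemma random_covering:
  fixes F :: "'z \<Rightarrow> 'c \<Rightarrow> real" and T :: "'z \<Rightarrow> 'c \<Rightarrow> bool"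
  assumes "prob_space \<mu>" "prob_space q"
    and F[measurable]: "(\<lambda>(z, c). F z c) \<in> borel_measurable (\<mu> \<Otimes>\<^sub>M q)" and Fnn: "\<And>z c. 0 \<le> F z c"
    and T[measurable]: "Measurable.pred (\<mu> \<Otimes>\<^sub>M q) (\<lambda>(z, c). T z c)"
    and F1: "\<And>z. z \<in> space \<mu> \<Longrightarrow> (\<integral>\<^sup>+c. F z c \<partial>q) = 1"
    and FT: "\<And>z c. T z c \<Longrightarrow> F z c \<le> exp a"
  shows "\<exists>c. (\<forall>j<N. c j \<in> space q) \<and>
    (\<integral>\<^sup>+z. of_bool (\<forall>j<N. \<not> T z (c j)) \<partial>\<mu>)
      \<le> (\<integral>\<^sup>+z. \<integral>\<^sup>+c. ennreal (F z c) * of_bool (\<not> T z c) \<partial>q \<partial>\<mu>) + ennreal (exp (- (real N * exp (- a))))"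
proof -
  interpret \<mu>: prob_space \<mu> by fact
  interpret q: prob_space q by fact
  interpret C: product_prob_space "\<lambda>_. q" "{..<N}" by unfold_locales
  let ?C = "PiM {..<N} (\<lambda>_. q)"
  have CPs: "prob_space ?C" by (rule prob_space_PiM) (rule assms(2))
  note C_not_empty = prob_space.not_empty[OF CPs] and C_space = prob_space.emeasure_space_1[OF CPs]
  interpret CP: prob_space ?C by (rule CPs)
  interpret \<mu>C: pair_prob_space \<mu> ?C ..
  let ?miss = "\<lambda>z c. (\<Prod>j<N. of_bool (\<not> T z (c j))) :: ennreal"
  let ?B = "(\<integral>\<^sup>+z. \<integral>\<^sup>+c. ennreal (F z c) * of_bool (\<not> T z c) \<partial>q \<partial>\<mu>) + ennreal (exp (- (real N * exp (- a))))"
  have pw: "(\<integral>\<^sup>+c. ?miss z c \<partial>?C)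
      \<le> (\<integral>\<^sup>+c. ennreal (F z c) * of_bool (\<not> T z c) \<partial>q) + ennreal (exp (- (real N * exp (- a))))"
    if z: "z \<in> space \<mu>" for z
  proof -
    have [measurable]: "(\<lambda>c. F z c) \<in> borel_measurable q" "Measurable.pred q (\<lambda>c. T z c)"
      using measurable_compose[OF measurable_Pair1'[OF z] F] measurable_compose[OF measurable_Pair1'[OF z] T] by simp_all
    \<comment> \<open>\<open>F z\<close> is the density, relative to the codeword law, of a codeword
      conditioned on \<open>z\<close>. Its mass on typical codewords is \<open>p\<close> below, and
      since the density is at most \<open>exp a\<close> there, the unconditioned probability
      \<open>Q\<close> is at least \<open>exp (- a) * p\<close>.\<close>
    define Q where "Q = q.prob {c \<in> space q. T z c}"
    have Q: "0 \<le> Q" "Q \<le> 1" by (auto simp: Q_def)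
    let ?in = "\<integral>\<^sup>+c. ennreal (F z c) * of_bool (T z c) \<partial>q"
    let ?out = "\<integral>\<^sup>+c. ennreal (F z c) * of_bool (\<not> T z c) \<partial>q"
    have sum: "?in + ?out = 1"
      unfolding F1[OF z, symmetric] by (subst nn_integral_add[symmetric]) (auto intro!: nn_integral_cong)
    define p where "p = enn2real ?in"
    have inle: "?in \<le> 1" unfolding sum[symmetric] by simp
    then have pin: "?in = ennreal p" unfolding p_def by (subst ennreal_enn2real) (auto intro: le_less_trans)
    have p0: "0 \<le> p" by (simp add: p_def)
    have p1: "p \<le> 1" using inle p0 unfolding pin by simp
    have out: "?out = ennreal (1 - p)"
    proof -
      have "?out \<le> 1" unfolding sum[symmetric] by simp
      then obtain r where r: "0 \<le> r" "?out = ennreal r"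
        by (cases ?out) (auto simp: top_unique)
      have "ennreal (p + r) = ennreal 1" using sum p0 r by (simp add: pin)
      then have "p + r = 1" using p0 r(1) by (subst (asm) ennreal_inj) auto
      then have "r = 1 - p" by simp
      then show ?thesis using r(2) by simp
    qed
    have "?in \<le> (\<integral>\<^sup>+c. ennreal (exp a) * indicator {c \<in> space q. T z c} c \<partial>q)"
      by (intro nn_integral_mono) (auto intro: ennreal_leI FT)
    also have "\<dots> = ennreal (exp a * Q)"
      by (simp add: nn_integral_cmult_indicator Q_def q.emeasure_eq_measure ennreal_mult')
    finally have "p \<le> exp a * Q" unfolding pin using Q by simp
    then have pQ: "exp (- a) * p \<le> Q" by (simp add: exp_minus field_simps)
    have miss: "(\<integral>\<^sup>+c. of_bool (\<not> T z c) \<partial>q) = ennreal (1 - Q)"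
    proof -
      have "(\<integral>\<^sup>+c. of_bool (\<not> T z c) \<partial>q) = (\<integral>\<^sup>+c. indicator (space q - {c \<in> space q. T z c}) c \<partial>q)"
        by (intro nn_integral_cong) (auto split: split_indicator)
      also have "\<dots> = emeasure q (space q - {c \<in> space q. T z c})" by (rule nn_integral_indicator) simp
      also have "\<dots> = ennreal (1 - Q)"
        by (simp add: q.emeasure_eq_measure q.prob_compl Q_def)
      finally show ?thesis .
    qed
    have "(\<integral>\<^sup>+c. ?miss z c \<partial>?C) = (\<Prod>j<N. \<integral>\<^sup>+c. of_bool (\<not> T z c) \<partial>q)"
      by (rule C.product_nn_integral_prod) auto
    also have "\<dots> = ennreal ((1 - Q) ^ N)"
      using Q by (simp add: miss ennreal_power)
    also have "\<dots> \<le> ennreal (1 - p + exp (- (real N * exp (- a))))"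
    proof (rule ennreal_leI)
      have "1 - Q \<le> exp (- Q)" using exp_ge_add_one_self[of "- Q"] by simp
      then have "(1 - Q) ^ N \<le> exp (- Q) ^ N" using Q by (intro power_mono) auto
      also have "\<dots> = exp (- (real N * Q))" by (simp add: exp_of_nat_mult[symmetric])
      also have "\<dots> \<le> exp (- ((real N * exp (- a)) * p))"
        using mult_left_mono[OF pQ, of "real N"] by (simp add: mult.assoc)
      also have "\<dots> \<le> 1 - p + p * exp (- (real N * exp (- a)))" by (rule exp_le_interpolate[OF p0 p1])
      also have "\<dots> \<le> 1 - p + exp (- (real N * exp (- a)))" using p1 by (simp add: mult_left_le_one_le p0)
      finally show "(1 - Q) ^ N \<le> 1 - p + exp (- (real N * exp (- a)))" .
    qed
    also have "\<dots> = ?out + ennreal (exp (- (real N * exp (- a))))"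
      unfolding out using p1 by (simp add: ennreal_plus)
    finally show ?thesis .
  qed
  have prodb: "?miss z c = (of_bool (\<forall>j<N. \<not> T z (c j)) :: ennreal)" for z c
    by (induction N) (auto simp: less_Suc_eq)
  have [measurable]: "Measurable.pred (\<mu> \<Otimes>\<^sub>M ?C) (\<lambda>x. T (fst x) (snd x j))" if "j \<in> {..<N}" for j
    using that by (intro measurable_compose[OF _ T, of "\<lambda>x. (fst x, snd x j)", simplified]) measurable
  have m: "(\<lambda>(z, c). ?miss z c) \<in> borel_measurable (\<mu> \<Otimes>\<^sub>M ?C)"
    unfolding split_beta' by measurable
  have Bz: "(\<lambda>z. \<integral>\<^sup>+c. ennreal (F z c) * of_bool (\<not> T z c) \<partial>q) \<in> borel_measurable \<mu>"
  proof (rule q.borel_measurable_nn_integral)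
    show "(\<lambda>(z, c). ennreal (F z c) * of_bool (\<not> T z c)) \<in> borel_measurable (\<mu> \<Otimes>\<^sub>M q)"
      using F T unfolding split_beta' by measurable
  qed
  have "(\<integral>\<^sup>+c. \<integral>\<^sup>+z. ?miss z c \<partial>\<mu> \<partial>?C)
      = (\<integral>\<^sup>+z. \<integral>\<^sup>+c. ?miss z c \<partial>?C \<partial>\<mu>)"
    by (rule \<mu>C.Fubini'[OF m])
  also have "\<dots> \<le> (\<integral>\<^sup>+z. (\<integral>\<^sup>+c. ennreal (F z c) * of_bool (\<not> T z c) \<partial>q) + ennreal (exp (- (real N * exp (- a)))) \<partial>\<mu>)"
    by (intro nn_integral_mono pw)
  also have "\<dots> = ?B"
    using Bz by (subst nn_integral_add) (auto simp: \<mu>.emeasure_space_1)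
  finally have le: "(\<integral>\<^sup>+c. \<integral>\<^sup>+z. ?miss z c \<partial>\<mu> \<partial>?C) \<le> ?B" .
  \<comment> \<open>Some codebook does at least as well as the average. Strict comparison of
    integrals needs a finite smaller side, so an infinite bound is treated separately; any codebook
    satisfies it.\<close>
  have "\<exists>c\<in>space ?C. (\<integral>\<^sup>+z. ?miss z c \<partial>\<mu>) \<le> ?B"
  proof (cases "?B = \<infinity>")
    case True
    obtain c where c: "c \<in> space ?C" using C_not_empty by blast
    show ?thesis unfolding True by (rule bexI[OF _ c]) simp
  next
    case False
    show ?thesis
    proof (rule ccontr)
      assume "\<not> ?thesis"
      then have gt: "?B < (\<integral>\<^sup>+z. ?miss z c \<partial>\<mu>)" if "c \<in> space ?C" for c
        using that by (auto simp: not_le)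
      have "(\<integral>\<^sup>+c. ?B \<partial>?C) < (\<integral>\<^sup>+c. \<integral>\<^sup>+z. ?miss z c \<partial>\<mu> \<partial>?C)"
      proof (rule nn_integral_less)
        show "(\<lambda>c. \<integral>\<^sup>+z. ?miss z c \<partial>\<mu>) \<in> borel_measurable ?C"
          using measurable_pair_swap[OF m] by (intro \<mu>.borel_measurable_nn_integral) (simp add: split_beta')
        show "(\<integral>\<^sup>+c. ?B \<partial>?C) \<noteq> \<infinity>" using False by (simp add: C_space)
        show "AE c in ?C. ?B \<le> (\<integral>\<^sup>+z. ?miss z c \<partial>\<mu>)"
          using gt by (intro AE_I2) (auto intro: less_imp_le)
        show "\<not> (AE c in ?C. (\<integral>\<^sup>+z. ?miss z c \<partial>\<mu>) \<le> ?B)"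
        proof
          assume "AE c in ?C. (\<integral>\<^sup>+z. ?miss z c \<partial>\<mu>) \<le> ?B"
          then have "AE c in ?C. False" using AE_space by eventually_elim (use gt in \<open>auto simp: not_le[symmetric]\<close>)
          then show False by simp
        qed
      qed simp
      then show False using le by (simp add: C_space)
    qed
  qed
  then obtain c where c: "c \<in> space ?C" and le: "(\<integral>\<^sup>+z. ?miss z c \<partial>\<mu>) \<le> ?B" by blast
  then show ?thesis unfolding prodb by (intro exI[of _ c]) (auto simp: space_PiM)
qed

section \<open>Exponential moments of Gaussian squares\<close>

text \<open>The exponential tilt turns a normal density of variance \<open>d\<close> into a multiple
  of one of variance \<open>d / (1 - 2 * t)\<close>. Negative \<open>t\<close> is included, for
  lower tails.\<close>

lemma nn_integral_normal_exp_square: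
  assumes d: "d > 0" and t: "t < 1 / 2"
  shows "(\<integral>\<^sup>+x. ennreal (normal_density m (sqrt d) x * exp (t * ((x - m)\<^sup>2 / d))) \<partial>lborel) = ennreal (1 / sqrt (1 - 2 * t))"
proof -
  define e where "e = d / (1 - 2 * t)"
  have e: "e > 0" using assms by (simp add: e_def)
  interpret prob_space "density lborel (normal_density m (sqrt e))"
    using e by (simp add: prob_space_normal_density)
  have eq: "normal_density m (sqrt d) x * exp (t * ((x - m)\<^sup>2 / d)) = 1 / sqrt (1 - 2 * t) * normal_density m (sqrt e) x" for x
  proof -
    have "exp (- (x - m)\<^sup>2 / (2 * d)) * exp (t * ((x - m)\<^sup>2 / d)) = exp (- (x - m)\<^sup>2 / (2 * e))"
      using assms by (simp add: exp_add[symmetric] e_def field_simps)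
    moreover have "1 / sqrt (2 * pi * d) = 1 / sqrt (1 - 2 * t) * (1 / sqrt (2 * pi * e))"
      using assms by (simp add: e_def real_sqrt_divide real_sqrt_mult)
    ultimately show ?thesis using d e by (simp add: normal_density_def mult.assoc)
  qed
  have "(\<integral>\<^sup>+x. ennreal (normal_density m (sqrt d) x * exp (t * ((x - m)\<^sup>2 / d))) \<partial>lborel)
      = (\<integral>\<^sup>+x. ennreal (1 / sqrt (1 - 2 * t)) * ennreal (normal_density m (sqrt e) x) \<partial>lborel)"
    unfolding eq using t by (intro nn_integral_cong, subst ennreal_mult[symmetric]) auto
  also have "\<dots> = ennreal (1 / sqrt (1 - 2 * t)) * (\<integral>\<^sup>+x. ennreal (normal_density m (sqrt e) x) \<partial>lborel)"
    by (rule nn_integral_cmult) simp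
  also have "(\<integral>\<^sup>+x. ennreal (normal_density m (sqrt e) x) \<partial>lborel) = 1"
    using emeasure_space_1 by (simp add: emeasure_density)
  finally show ?thesis by simp
qed

text \<open>Now \<open>z\<close> is fixed and the codeword is averaged. A codeword of variance
  \<open>v - D\<close> plus independent noise of variance \<open>D\<close> has the source law
  \<open>N(0, v)\<close>, so the likelihood ratios average to 1; this is why codewords are drawn
  with variance \<open>v - D\<close>.\<close>

lemma nn_integral_exp_log_lik_code:
  assumes D: "D > 0" "v > D"
  shows "(\<integral>\<^sup>+c. ennreal (exp (log_lik v D z c)) \<partial>centered_normal (v - D)) = 1"
proof -
  have v: "v > 0" using D by simp
  let ?\<phi> = "normal_density 0 (sqrt v) z"
  have \<phi>: "?\<phi> > 0" using v by (simp add: normal_density_pos)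
  have eq: "normal_density 0 (sqrt (v - D)) c * exp (log_lik v D z c)
      = (1 / ?\<phi>) * (normal_density 0 (sqrt D) (z - c) * normal_density 0 (sqrt (v - D)) c)" for c
  proof -
    have "normal_density c (sqrt D) z = normal_density 0 (sqrt D) (z - c)" by (simp add: normal_density_def)
    then have "exp (log_lik v D z c) = normal_density 0 (sqrt D) (z - c) / ?\<phi>"
      using normal_density_log_lik[OF D, of z c] \<phi> by (simp add: field_simps)
    then show ?thesis by simp
  qed
  have "(\<integral>\<^sup>+c. ennreal (exp (log_lik v D z c)) \<partial>centered_normal (v - D))
      = (\<integral>\<^sup>+c. ennreal (normal_density 0 (sqrt (v - D)) c * exp (log_lik v D z c)) \<partial>lborel)"
    using D by (simp add: centered_normal_def nn_integral_density ennreal_mult')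
  also have "\<dots> = (\<integral>\<^sup>+c. ennreal (1 / ?\<phi>) * ennreal (normal_density 0 (sqrt D) (z - c) * normal_density 0 (sqrt (v - D)) c) \<partial>lborel)"
    unfolding eq using \<phi> by (intro nn_integral_cong ennreal_mult) auto
  also have "\<dots> = ennreal (1 / ?\<phi>) * (\<integral>\<^sup>+c. ennreal (normal_density 0 (sqrt D) (z - c) * normal_density 0 (sqrt (v - D)) c) \<partial>lborel)"
    by (rule nn_integral_cmult) simp
  also have "(\<integral>\<^sup>+c. ennreal (normal_density 0 (sqrt D) (z - c) * normal_density 0 (sqrt (v - D)) c) \<partial>lborel) = ennreal ?\<phi>"
    using fun_cong[OF conv_normal_density_zero_mean[of "sqrt D" "sqrt (v - D)"], of z] D by simp
  also have "ennreal (1 / ?\<phi>) * ennreal ?\<phi> = 1"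
    using \<phi> by (simp add: ennreal_mult[symmetric])
  finally show ?thesis .
qed

text \<open>The value of \<open>E exp (t (G\<^sup>2 - (1 + \<delta>)))\<close> for a standard normal \<open>G\<close>.\<close>

definition chernoff :: "real \<Rightarrow> real \<Rightarrow> real" where
  "chernoff t \<delta> = exp (- (t * (1 + \<delta>))) / sqrt (1 - 2 * t)"

text \<open>Minus the logarithm of \<open>chernoff t \<delta>\<close> is
  \<open>t * \<delta> + t + ln (1 - 2 * t) / 2\<close>. The quadratic lower bound
  \<open>- 2 * t - 8 * t^2\<close> for the logarithm, valid for
  \<open>\<bar>2 * t\<bar> \<le> 1 / 2\<close>, leaves at least
  \<open>t * \<delta> - 4 * t^2\<close>. Later uses have
  \<open>t = \<epsilon> / 8, \<delta> = \<epsilon>\<close>, or both with opposite sign, where this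
  is \<open>\<epsilon>^2 / 16\<close>.\<close>

lemma chernoff_less_1:
  assumes t: "\<bar>t\<bar> \<le> 1 / 4" and \<delta>: "t * \<delta> > 4 * t\<^sup>2"
  shows "chernoff t \<delta> < 1"
proof -
  have "\<bar>ln (1 + (- 2 * t)) - (- 2 * t)\<bar> \<le> 2 * (- 2 * t)\<^sup>2"
    by (rule abs_ln_one_plus_x_minus_x_bound) (use t in \<open>auto simp: abs_mult\<close>)
  then have "ln (1 - 2 * t) \<ge> - 2 * t - 8 * t\<^sup>2" by (simp add: power2_eq_square abs_le_iff)
  then have "- (t * (1 + \<delta>)) < ln (1 - 2 * t) / 2" using \<delta> by (simp add: algebra_simps)
  then have "exp (- (t * (1 + \<delta>))) < exp (ln (1 - 2 * t) / 2)" by simp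
  also have "\<dots> = sqrt (1 - 2 * t)"
  proof -
    have q: "0 < 1 - 2 * t" using t by (auto simp: abs_le_iff)
    then show ?thesis unfolding ln_sqrt[OF less_imp_le[OF q], symmetric] by (subst exp_ln) auto
  qed
  finally show ?thesis unfolding chernoff_def using t by (subst divide_less_eq_1_pos) (auto simp: abs_le_iff)
qed

lemma nn_integral_normal_block_prod:
  fixes g :: "real \<Rightarrow> real \<Rightarrow> ennreal"
  assumes [measurable]: "(\<lambda>(z, c). g z c) \<in> borel_measurable (borel \<Otimes>\<^sub>M borel)"
  shows "(\<integral>\<^sup>+z. \<integral>\<^sup>+c. (\<Prod>i<n. g (z i) (c i)) \<partial>normal_block n u \<partial>normal_block n v)
    = (\<integral>\<^sup>+z. \<integral>\<^sup>+c. g z c \<partial>centered_normal u \<partial>centered_normal v) ^ n"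
proof -
  interpret u: prob_space "centered_normal u" by (rule prob_space_centered_normal)
  interpret v: prob_space "centered_normal v" by (rule prob_space_centered_normal)
  interpret U: product_prob_space "\<lambda>_. centered_normal u" "{..<n}" by unfold_locales
  interpret V: product_prob_space "\<lambda>_. centered_normal v" "{..<n}" by unfold_locales
  have "(\<integral>\<^sup>+c. (\<Prod>i<n. g (z i) (c i)) \<partial>normal_block n u) = (\<Prod>i<n. \<integral>\<^sup>+c. g (z i) c \<partial>centered_normal u)" for z
    by (rule U.product_nn_integral_prod) auto
  then have "(\<integral>\<^sup>+z. \<integral>\<^sup>+c. (\<Prod>i<n. g (z i) (c i)) \<partial>normal_block n u \<partial>normal_block n v)
      = (\<integral>\<^sup>+z. (\<Prod>i<n. \<integral>\<^sup>+c. g (z i) c \<partial>centered_normal u) \<partial>normal_block n v)" by simp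
  also have "\<dots> = (\<Prod>i<n. \<integral>\<^sup>+z. \<integral>\<^sup>+c. g z c \<partial>centered_normal u \<partial>centered_normal v)"
    by (rule V.product_nn_integral_prod) auto
  finally show ?thesis by simp
qed

lemma nn_integral_chernoff:
  assumes v: "v > 0" and t: "t < 1 / 2"
  shows "(\<integral>\<^sup>+z. ennreal (exp (t * (z\<^sup>2 / v - (1 + \<delta>)))) \<partial>centered_normal v) = ennreal (chernoff t \<delta>)"
proof -
  have "(\<integral>\<^sup>+z. ennreal (exp (t * (z\<^sup>2 / v - (1 + \<delta>)))) \<partial>centered_normal v)
      = (\<integral>\<^sup>+z. ennreal (normal_density 0 (sqrt v) z * exp (t * (z\<^sup>2 / v - (1 + \<delta>)))) \<partial>lborel)"
    using v by (simp add: centered_normal_def nn_integral_density ennreal_mult')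
  also have "\<dots> = (\<integral>\<^sup>+z. ennreal (exp (- (t * (1 + \<delta>)))) * ennreal (normal_density 0 (sqrt v) z * exp (t * ((z - 0)\<^sup>2 / v))) \<partial>lborel)"
  proof (intro nn_integral_cong)
    fix z
    have "exp (t * (z\<^sup>2 / v - (1 + \<delta>))) = exp (- (t * (1 + \<delta>))) * exp (t * ((z - 0)\<^sup>2 / v))"
      by (simp add: exp_add[symmetric] algebra_simps)
    then show "ennreal (normal_density 0 (sqrt v) z * exp (t * (z\<^sup>2 / v - (1 + \<delta>))))
      = ennreal (exp (- (t * (1 + \<delta>)))) * ennreal (normal_density 0 (sqrt v) z * exp (t * ((z - 0)\<^sup>2 / v)))"
      by (simp only:) (simp add: ennreal_mult[symmetric] mult_ac)
  qed
  also have "\<dots> = ennreal (exp (- (t * (1 + \<delta>)))) * ennreal (1 / sqrt (1 - 2 * t))"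
    by (subst nn_integral_cmult, simp, subst nn_integral_normal_exp_square[OF v t]) (rule refl)
  also have "\<dots> = ennreal (chernoff t \<delta>)"
    using t by (subst ennreal_mult[symmetric]) (auto simp: chernoff_def)
  finally show ?thesis .
qed

text \<open>The weight turns the product law of source and codeword into their joint law under the
  Gaussian test channel. Integrating the codeword first shows that the source marginal is still
  \<open>N(0, v)\<close>.\<close>

lemma nn_integral_chernoff_source:
  assumes D: "D > 0" "v > D" and t: "t < 1 / 2"
  shows "(\<integral>\<^sup>+z. \<integral>\<^sup>+c. ennreal (exp (log_lik v D z c)) * ennreal (exp (t * (z\<^sup>2 / v - (1 + \<delta>)))) \<partial>centered_normal (v - D) \<partial>centered_normal v)
    = ennreal (chernoff t \<delta>)"
proof -
  have "(\<integral>\<^sup>+c. ennreal (exp (log_lik v D z c)) * ennreal (exp (t * (z\<^sup>2 / v - (1 + \<delta>)))) \<partial>centered_normal (v - D))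
      = ennreal (exp (t * (z\<^sup>2 / v - (1 + \<delta>))))" for z
    by (subst nn_integral_multc) (auto simp: nn_integral_exp_log_lik_code[OF D])
  then show ?thesis using nn_integral_chernoff[of v t \<delta>] D t by simp
qed

text \<open>For the same joint law the order is reversed: given the codeword \<open>c\<close>, the
  weighted source law is normal with mean \<open>c\<close> and variance \<open>D\<close>, so
  \<open>z - c\<close> is noise of variance \<open>D\<close>.\<close>

lemma nn_integral_chernoff_noise:
  assumes D: "D > 0" "v > D" and t: "t < 1 / 2"
  shows "(\<integral>\<^sup>+z. \<integral>\<^sup>+c. ennreal (exp (log_lik v D z c)) * ennreal (exp (t * ((z - c)\<^sup>2 / D - (1 + \<delta>)))) \<partial>centered_normal (v - D) \<partial>centered_normal v)
    = ennreal (chernoff t \<delta>)"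
proof -
  have v: "v > 0" using D by simp
  interpret u: prob_space "centered_normal (v - D)" by (rule prob_space_centered_normal)
  interpret v: prob_space "centered_normal v" by (rule prob_space_centered_normal)
  interpret P: pair_prob_space "centered_normal v" "centered_normal (v - D)" ..
  have "(\<integral>\<^sup>+z. ennreal (exp (log_lik v D z c)) * ennreal (exp (t * ((z - c)\<^sup>2 / D - (1 + \<delta>)))) \<partial>centered_normal v)
      = ennreal (chernoff t \<delta>)" for c
  proof -
    have "(\<integral>\<^sup>+z. ennreal (exp (log_lik v D z c)) * ennreal (exp (t * ((z - c)\<^sup>2 / D - (1 + \<delta>)))) \<partial>centered_normal v)
        = (\<integral>\<^sup>+z. ennreal (normal_density 0 (sqrt v) z) * (ennreal (exp (log_lik v D z c)) * ennreal (exp (t * ((z - c)\<^sup>2 / D - (1 + \<delta>))))) \<partial>lborel)"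
      using v by (simp add: centered_normal_def nn_integral_density)
    also have "\<dots> = (\<integral>\<^sup>+z. ennreal (exp (- (t * (1 + \<delta>)))) * ennreal (normal_density c (sqrt D) z * exp (t * ((z - c)\<^sup>2 / D))) \<partial>lborel)"
    proof (intro nn_integral_cong)
      fix z
      have "exp (t * ((z - c)\<^sup>2 / D - (1 + \<delta>))) = exp (- (t * (1 + \<delta>))) * exp (t * ((z - c)\<^sup>2 / D))"
        by (simp add: exp_add[symmetric] algebra_simps)
      then show "ennreal (normal_density 0 (sqrt v) z) * (ennreal (exp (log_lik v D z c)) * ennreal (exp (t * ((z - c)\<^sup>2 / D - (1 + \<delta>)))))
        = ennreal (exp (- (t * (1 + \<delta>)))) * ennreal (normal_density c (sqrt D) z * exp (t * ((z - c)\<^sup>2 / D)))"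
        unfolding normal_density_log_lik[OF D, of z c, symmetric]
        by (simp only:) (simp add: ennreal_mult[symmetric] mult_ac)
    qed
    also have "\<dots> = ennreal (exp (- (t * (1 + \<delta>)))) * ennreal (1 / sqrt (1 - 2 * t))"
      by (subst nn_integral_cmult, simp, subst nn_integral_normal_exp_square[OF D(1) t]) (rule refl)
    also have "\<dots> = ennreal (chernoff t \<delta>)"
      using t by (subst ennreal_mult[symmetric]) (auto simp: chernoff_def)
    finally show ?thesis .
  qed
  then show ?thesis by (subst P.Fubini'[symmetric]) (auto simp: u.emeasure_space_1[simplified])
qed

lemma prod_exp_affine:
  fixes t d k :: real
  shows "(\<Prod>i<n. exp (t * (f i / d - k))) = exp (t * ((\<Sum>i<n. f i) / d - real n * k))"
  by (simp add: exp_sum[symmetric] sum_distrib_left[symmetric] sum_subtractf sum_divide_distrib)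

section \<open>Typical pairs and Gaussian codebooks\<close>

text \<open>The upper bound on the source energy and the lower bound on the error energy cap the
  likelihood ratio. The upper bound on the error energy is the distortion guarantee.\<close>

definition typical :: "nat \<Rightarrow> real \<Rightarrow> real \<Rightarrow> real \<Rightarrow> (nat \<Rightarrow> real) \<Rightarrow> (nat \<Rightarrow> real) \<Rightarrow> bool" where
  "typical n v D \<epsilon> z c \<longleftrightarrow> (\<Sum>i<n. (z i)\<^sup>2) \<le> n * (v * (1 + \<epsilon>)) \<and>
     n * (D * (1 - \<epsilon>)) \<le> (\<Sum>i<n. (z i - c i)\<^sup>2) \<and> (\<Sum>i<n. (z i - c i)\<^sup>2) \<le> n * (D * (1 + \<epsilon>))"

text \<open>Markov's inequality before integration: a violated constraint makes its own exponential
  at least 1. The exponentials are written as products over letters so that their integrals factor;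
  the last one, with both signs reversed, is the lower tail.\<close>

lemma not_typical_le:
  assumes D: "D > 0" "v > 0" and s: "s > 0" and nt: "\<not> typical n v D \<epsilon> z c"
  shows "1 \<le> (\<Prod>i<n. exp (s * ((z i)\<^sup>2 / v - (1 + \<epsilon>)))) + (\<Prod>i<n. exp (s * ((z i - c i)\<^sup>2 / D - (1 + \<epsilon>))))
      + (\<Prod>i<n. exp (- s * ((z i - c i)\<^sup>2 / D - (1 + - \<epsilon>))))"
proof -
  let ?A = "(\<Sum>i<n. (z i)\<^sup>2) / v - n * (1 + \<epsilon>)"
  let ?B = "(\<Sum>i<n. (z i - c i)\<^sup>2) / D - n * (1 + \<epsilon>)"
  let ?C = "(\<Sum>i<n. (z i - c i)\<^sup>2) / D - n * (1 + - \<epsilon>)"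
  from nt consider "?A > 0" | "?B > 0" | "?C < 0"
    unfolding typical_def using D by (auto simp: not_le field_simps)
  then have "1 \<le> exp (s * ?A) \<or> 1 \<le> exp (s * ?B) \<or> 1 \<le> exp (- s * ?C)"
    using s by (cases; simp add: mult_nonneg_nonpos less_imp_le)
  then have "1 \<le> exp (s * ?A) + exp (s * ?B) + exp (- s * ?C)"
    using exp_gt_zero[of "s * ?A"] exp_gt_zero[of "s * ?B"] exp_gt_zero[of "- s * ?C"] by linarith
  moreover have "(\<Prod>i<n. exp (s * ((z i)\<^sup>2 / v - (1 + \<epsilon>)))) = exp (s * ?A)" by (rule prod_exp_affine)
  moreover have "(\<Prod>i<n. exp (s * ((z i - c i)\<^sup>2 / D - (1 + \<epsilon>)))) = exp (s * ?B)" by (rule prod_exp_affine)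
  moreover have "(\<Prod>i<n. exp (- s * ((z i - c i)\<^sup>2 / D - (1 + - \<epsilon>)))) = exp (- s * ?C)" by (rule prod_exp_affine)
  ultimately show ?thesis by (simp only:)
qed

text \<open>The source energy and the error energy each deviate by a relative \<epsilon> and enter
  with weight 1/2, so their joint effect is \<epsilon> per letter.\<close>

lemma typical_log_lik:
  assumes D: "D > 0" "v > D" and ty: "typical n v D \<epsilon> z c"
  shows "(\<Prod>i<n. exp (log_lik v D (z i) (c i))) \<le> exp (n * (ln (v / D) / 2 + \<epsilon>))"
proof -
  have "(\<Sum>i<n. log_lik v D (z i) (c i))
      = n * (ln (v / D) / 2) + (\<Sum>i<n. (z i)\<^sup>2) / (2 * v) - (\<Sum>i<n. (z i - c i)\<^sup>2) / (2 * D)"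
    using D by (simp add: log_lik_def sum.distrib sum_subtractf sum_divide_distrib)
  moreover have "(\<Sum>i<n. (z i)\<^sup>2) / (2 * v) \<le> n * (v * (1 + \<epsilon>)) / (2 * v)"
    using ty D by (intro divide_right_mono) (auto simp: typical_def)
  moreover have "n * (v * (1 + \<epsilon>)) / (2 * v) = n * (1 + \<epsilon>) / 2" using D by simp
  moreover have "n * (D * (1 - \<epsilon>)) / (2 * D) \<le> (\<Sum>i<n. (z i - c i)\<^sup>2) / (2 * D)"
    using ty D by (intro divide_right_mono) (auto simp: typical_def)
  moreover have "n * (D * (1 - \<epsilon>)) / (2 * D) = n * (1 - \<epsilon>) / 2" using D by simp
  ultimately have "(\<Sum>i<n. log_lik v D (z i) (c i)) \<le> n * (ln (v / D) / 2) + n * (1 + \<epsilon>) / 2 - n * (1 - \<epsilon>) / 2"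
    by linarith
  also have "\<dots> = n * (ln (v / D) / 2 + \<epsilon>)" by (simp add: field_simps)
  finally show ?thesis by (simp add: exp_sum[symmetric])
qed

text \<open>This is \<open>random_covering\<close> with the block likelihood ratio as
  \<open>F\<close> and the cap from \<open>typical_log_lik\<close>. The coefficient 2 arises because
  the upper tails of the source energy and of the error energy have the same Chernoff factor; the
  lower tail of the error has its own.\<close>

lemma gaussian_covering:
  assumes D: "D > 0" "v > D" and \<epsilon>: "0 < \<epsilon>" "\<epsilon> \<le> 1"
  shows "\<exists>c. (\<forall>j<N. c j \<in> space (seqs n)) \<and>
    (\<integral>\<^sup>+z. of_bool (\<forall>j<N. \<not> typical n v D \<epsilon> z (c j)) \<partial>normal_block n v)
      \<le> ennreal (2 * chernoff (\<epsilon> / 8) \<epsilon> ^ n + chernoff (- \<epsilon> / 8) (- \<epsilon>) ^ n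
          + exp (- (real N * exp (- (n * (ln (v / D) / 2 + \<epsilon>))))))"
proof -
  have v: "v > 0" using D by simp
  let ?F = "\<lambda>z c. \<Prod>i<n. exp (log_lik v D (z i) (c i))"
  let ?T = "typical n v D \<epsilon>"
  let ?\<mu> = "normal_block n v" and ?q = "normal_block n (v - D)"
  interpret u: prob_space "centered_normal (v - D)" by (rule prob_space_centered_normal)
  interpret U: product_prob_space "\<lambda>_. centered_normal (v - D)" "{..<n}" by unfold_locales
  have "\<exists>c. (\<forall>j<N. c j \<in> space ?q) \<and>
    (\<integral>\<^sup>+z. of_bool (\<forall>j<N. \<not> ?T z (c j)) \<partial>?\<mu>)
      \<le> (\<integral>\<^sup>+z. \<integral>\<^sup>+c. ennreal (?F z c) * of_bool (\<not> ?T z c) \<partial>?q \<partial>?\<mu>)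
        + ennreal (exp (- (real N * exp (- (n * (ln (v / D) / 2 + \<epsilon>))))))"
  proof (rule random_covering[OF prob_space_normal_block prob_space_normal_block])
    show "(\<lambda>(z, c). ?F z c) \<in> borel_measurable (?\<mu> \<Otimes>\<^sub>M ?q)"
      unfolding split_beta' by measurable
    show "Measurable.pred (?\<mu> \<Otimes>\<^sub>M ?q) (\<lambda>(z, c). ?T z c)"
      unfolding split_beta' typical_def by measurable
    show "0 \<le> ?F z c" for z c by (simp add: prod_nonneg)
    show "(\<integral>\<^sup>+c. ?F z c \<partial>?q) = 1" for z
    proof -
      have "(\<integral>\<^sup>+c. ?F z c \<partial>?q) = (\<integral>\<^sup>+c. (\<Prod>i<n. ennreal (exp (log_lik v D (z i) (c i)))) \<partial>?q)"
        by (simp add: prod_ennreal)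
      also have "\<dots> = (\<Prod>i<n. \<integral>\<^sup>+c. ennreal (exp (log_lik v D (z i) c)) \<partial>centered_normal (v - D))"
        by (rule U.product_nn_integral_prod) auto
      finally show ?thesis by (simp add: nn_integral_exp_log_lik_code[OF D])
    qed
    show "?F z c \<le> exp (n * (ln (v / D) / 2 + \<epsilon>))" if "?T z c" for z c
      by (rule typical_log_lik[OF D that])
  qed
  moreover have "(\<integral>\<^sup>+z. \<integral>\<^sup>+c. ennreal (?F z c) * of_bool (\<not> ?T z c) \<partial>?q \<partial>?\<mu>)
      \<le> ennreal (2 * chernoff (\<epsilon> / 8) \<epsilon> ^ n + chernoff (- \<epsilon> / 8) (- \<epsilon>) ^ n)"
  proof -
    let ?l = "\<lambda>z c. ennreal (exp (log_lik v D z c))"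
    let ?a = "\<lambda>z c. ?l z c * ennreal (exp (\<epsilon> / 8 * (z\<^sup>2 / v - (1 + \<epsilon>))))"
    let ?b = "\<lambda>z c. ?l z c * ennreal (exp (\<epsilon> / 8 * ((z - c)\<^sup>2 / D - (1 + \<epsilon>))))"
    let ?c = "\<lambda>z c. ?l z c * ennreal (exp (- \<epsilon> / 8 * ((z - c)\<^sup>2 / D - (1 + - \<epsilon>))))"
    have le: "ennreal (?F z c) * of_bool (\<not> ?T z c)
        \<le> (\<Prod>i<n. ?a (z i) (c i)) + (\<Prod>i<n. ?b (z i) (c i)) + (\<Prod>i<n. ?c (z i) (c i))" for z c
    proof (cases "?T z c")
      case False
      let ?A = "\<Prod>i<n. exp (\<epsilon> / 8 * ((z i)\<^sup>2 / v - (1 + \<epsilon>)))"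
      let ?B = "\<Prod>i<n. exp (\<epsilon> / 8 * ((z i - c i)\<^sup>2 / D - (1 + \<epsilon>)))"
      let ?C = "\<Prod>i<n. exp (- \<epsilon> / 8 * ((z i - c i)\<^sup>2 / D - (1 + - \<epsilon>)))"
      have nn: "0 \<le> ?A" "0 \<le> ?B" "0 \<le> ?C" "0 \<le> ?F z c" by (simp_all add: prod_nonneg)
      have "1 \<le> ?A + ?B + ?C"
        using not_typical_le[OF D(1) v _ False, of "\<epsilon> / 8"] \<epsilon> by simp
      from mult_left_mono[OF this nn(4)] have "?F z c \<le> ?F z c * ?A + ?F z c * ?B + ?F z c * ?C"
        by (simp add: algebra_simps)
      then have "ennreal (?F z c) \<le> ennreal (?F z c * ?A + ?F z c * ?B + ?F z c * ?C)" by (rule ennreal_leI)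
      also have "\<dots> = ennreal (?F z c) * ennreal ?A + ennreal (?F z c) * ennreal ?B + ennreal (?F z c) * ennreal ?C"
        using nn by (simp add: ennreal_plus ennreal_mult)
      finally show ?thesis using False by (simp add: prod_ennreal[symmetric] prod.distrib)
    qed simp
    have "(\<integral>\<^sup>+z. \<integral>\<^sup>+c. ennreal (?F z c) * of_bool (\<not> ?T z c) \<partial>?q \<partial>?\<mu>)
      \<le> (\<integral>\<^sup>+z. \<integral>\<^sup>+c. (\<Prod>i<n. ?a (z i) (c i)) + (\<Prod>i<n. ?b (z i) (c i)) + (\<Prod>i<n. ?c (z i) (c i)) \<partial>?q \<partial>?\<mu>)"
      by (intro nn_integral_mono le)
    also have "\<dots> = (\<integral>\<^sup>+z. \<integral>\<^sup>+c. (\<Prod>i<n. ?a (z i) (c i)) \<partial>?q \<partial>?\<mu>) + (\<integral>\<^sup>+z. \<integral>\<^sup>+c. (\<Prod>i<n. ?b (z i) (c i)) \<partial>?q \<partial>?\<mu>)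
        + (\<integral>\<^sup>+z. \<integral>\<^sup>+c. (\<Prod>i<n. ?c (z i) (c i)) \<partial>?q \<partial>?\<mu>)"
    proof -
      interpret Q: prob_space ?q by (rule prob_space_normal_block)
      have inner: "(\<integral>\<^sup>+c. f z c + g z c + h z c \<partial>?q) = (\<integral>\<^sup>+c. f z c \<partial>?q) + (\<integral>\<^sup>+c. g z c \<partial>?q) + (\<integral>\<^sup>+c. h z c \<partial>?q)"
        if "f z \<in> borel_measurable ?q" "g z \<in> borel_measurable ?q" "h z \<in> borel_measurable ?q"
        for f g h :: "(nat \<Rightarrow> real) \<Rightarrow> (nat \<Rightarrow> real) \<Rightarrow> ennreal" and z
        using that by (subst nn_integral_add, simp_all, subst nn_integral_add, simp_all)
      show ?thesis
        by (subst inner, measurable, subst nn_integral_add, measurable, subst nn_integral_add, measurable)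
    qed
    also have "\<dots> = ennreal (chernoff (\<epsilon> / 8) \<epsilon>) ^ n + ennreal (chernoff (\<epsilon> / 8) \<epsilon>) ^ n + ennreal (chernoff (- \<epsilon> / 8) (- \<epsilon>)) ^ n"
    proof -
      have a: "(\<lambda>(z, c). ?a z c) \<in> borel_measurable (borel \<Otimes>\<^sub>M borel)"
        and b: "(\<lambda>(z, c). ?b z c) \<in> borel_measurable (borel \<Otimes>\<^sub>M borel)"
        and c: "(\<lambda>(z, c). ?c z c) \<in> borel_measurable (borel \<Otimes>\<^sub>M borel)"
        unfolding split_beta' by measurable
      have t: "\<epsilon> / 8 < 1 / 2" "- \<epsilon> / 8 < 1 / 2" using \<epsilon> by auto
      show ?thesis
        unfolding nn_integral_normal_block_prod[OF a] nn_integral_normal_block_prod[OF b] nn_integral_normal_block_prod[OF c]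
          nn_integral_chernoff_source[OF D t(1)] nn_integral_chernoff_noise[OF D t(1)] nn_integral_chernoff_noise[OF D t(2)] ..
    qed
    also have "\<dots> = ennreal (2 * chernoff (\<epsilon> / 8) \<epsilon> ^ n + chernoff (- \<epsilon> / 8) (- \<epsilon>) ^ n)"
      using \<epsilon> by (simp add: chernoff_def ennreal_power ennreal_plus[symmetric] del: ennreal_plus)
    finally show ?thesis .
  qed
  ultimately obtain c where "\<forall>j<N. c j \<in> space ?q"
    and "(\<integral>\<^sup>+z. of_bool (\<forall>j<N. \<not> ?T z (c j)) \<partial>?\<mu>)
      \<le> ennreal (2 * chernoff (\<epsilon> / 8) \<epsilon> ^ n + chernoff (- \<epsilon> / 8) (- \<epsilon>) ^ n)
        + ennreal (exp (- (real N * exp (- (n * (ln (v / D) / 2 + \<epsilon>))))))"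
    by (meson add_right_mono order_trans)
  then show ?thesis
    using \<epsilon> by (intro exI[of _ c]) (auto simp: space_PiM chernoff_def ennreal_plus[symmetric] simp del: ennreal_plus)
qed

text \<open>Covered blocks have distortion at most \<open>D * (1 + \<epsilon>)\<close>. Uncovered
  ones are reproduced by zero, so their distortion is the block energy, which is unbounded. It is
  split at \<open>v * (1 + \<epsilon>)\<close>: the part below is charged to the failure
  probability, and the excess to an exponential moment of the energy.\<close>

lemma codebook_distortion:
  assumes D: "D > 0" "v > D" and \<epsilon>: "0 < \<epsilon>" "\<epsilon> \<le> 1" and n: "n > 0"
  shows "\<exists>c sel. (\<forall>j\<le>N. c j \<in> space (seqs n)) \<and> sel \<in> seqs n \<rightarrow>\<^sub>M count_space {..N} \<and>
    (\<integral>\<^sup>+z. ennreal ((1 / real n) * (\<Sum>i<n. (z i - c (sel z) i)\<^sup>2)) \<partial>normal_block n v)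
      \<le> ennreal (D * (1 + \<epsilon>) + v * (1 + \<epsilon>) * (2 * chernoff (\<epsilon> / 8) \<epsilon> ^ n + chernoff (- \<epsilon> / 8) (- \<epsilon>) ^ n
          + exp (- (real N * exp (- (n * (ln (v / D) / 2 + \<epsilon>)))))) + v * (1 + \<epsilon> + 8 / \<epsilon>) * chernoff (\<epsilon> / 8) \<epsilon> ^ n)"
proof -
  have v: "v > 0" using D by simp
  let ?T = "typical n v D \<epsilon>" and ?\<mu> = "normal_block n v"
  let ?P = "2 * chernoff (\<epsilon> / 8) \<epsilon> ^ n + chernoff (- \<epsilon> / 8) (- \<epsilon>) ^ n + exp (- (real N * exp (- (n * (ln (v / D) / 2 + \<epsilon>)))))"
  obtain c0 where c0: "\<forall>j<N. c0 j \<in> space (seqs n)"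
    and fail: "(\<integral>\<^sup>+z. of_bool (\<forall>j<N. \<not> ?T z (c0 j)) \<partial>?\<mu>) \<le> ennreal ?P"
    using gaussian_covering[OF D \<epsilon>, of N n] by blast
  \<comment> \<open>Position \<open>N\<close> holds the zero codeword used when no codeword fits, so
    \<open>N\<close> random codewords need \<open>N + 1\<close> indices.\<close>
  define c where "c = (\<lambda>j. if j < N then c0 j else (\<lambda>i\<in>{..<n}. 0))"
  define sel where "sel = (\<lambda>z. if \<exists>j<N. ?T z (c0 j) then LEAST j. j < N \<and> ?T z (c0 j) else N)"
  have Tm[measurable]: "Measurable.pred (seqs n) (\<lambda>z. ?T z x)" for x
    unfolding typical_def by measurable
  have "sel \<in> seqs n \<rightarrow>\<^sub>M count_space UNIV" unfolding sel_def by measurable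
  have selT: "sel z < N \<and> ?T z (c0 (sel z))" if "\<exists>j<N. ?T z (c0 j)" for z
  proof -
    have "(\<lambda>j. j < N \<and> ?T z (c0 j)) (LEAST j. j < N \<and> ?T z (c0 j))"
      by (rule LeastI_ex) (rule that)
    then show ?thesis using that by (simp add: sel_def)
  qed
  have selN: "sel z = N" if "\<not> (\<exists>j<N. ?T z (c0 j))" for z unfolding sel_def if_not_P[OF that] ..
  have sel_le: "sel z \<le> N" for z
    using selT[THEN conjunct1, THEN less_imp_le] selN[THEN eq_imp_le] by blast
  have selm: "sel \<in> seqs n \<rightarrow>\<^sub>M count_space {..N}"
    by (rule measurable_count_space_extend[of _ UNIV]) (use sel_le \<open>sel \<in> seqs n \<rightarrow>\<^sub>M count_space UNIV\<close> in auto)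
  have cs: "c j \<in> space (seqs n)" for j using c0 by (auto simp: c_def space_PiM)
  let ?s = "\<epsilon> / 8"
  let ?E = "\<lambda>z. \<Prod>i<n. exp (?s * ((z i)\<^sup>2 / v - (1 + \<epsilon>)))"
  let ?d = "\<lambda>z. (1 / real n) * (\<Sum>i<n. (z i - c (sel z) i)\<^sup>2)" and ?K = "v * (1 + \<epsilon> + 8 / \<epsilon>)"
  let ?G = "\<lambda>z. \<Prod>i<n. ennreal (exp (?s * ((z i)\<^sup>2 / v - (1 + \<epsilon>))))"
  have pw: "?d z
      \<le> D * (1 + \<epsilon>) + v * (1 + \<epsilon>) * of_bool (\<forall>j<N. \<not> ?T z (c0 j)) + ?K * ?E z" for z
  proof -
    have E: "?E z = exp (?s * ((\<Sum>i<n. (z i)\<^sup>2) / v - n * (1 + \<epsilon>)))"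
      by (rule prod_exp_affine)
    have K: "0 < ?K" using v \<epsilon> by (intro mult_pos_pos add_pos_pos) auto
    have E0: "0 \<le> ?K * ?E z"
      unfolding E using K by simp
    have nn: "0 \<le> D * (1 + \<epsilon>)" "0 \<le> v * (1 + \<epsilon>)" using D v \<epsilon> by auto
    show ?thesis
    proof (cases "\<exists>j<N. ?T z (c0 j)")
      case True
      from selT[OF this] have "(\<Sum>i<n. (z i - c (sel z) i)\<^sup>2) \<le> n * (D * (1 + \<epsilon>))"
        by (simp add: c_def typical_def)
      then have "?d z \<le> D * (1 + \<epsilon>)"
        using n by (simp add: field_simps)
      then show ?thesis using E0 nn by (simp add: True[simplified])
    next
      case False
      have "?d z = (1 / real n) * (\<Sum>i<n. (z i)\<^sup>2)"
        by (simp add: selN[OF False] c_def)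
      also have "\<dots> \<le> v * (1 + \<epsilon>) + ?K * ?E z"
      proof -
        define x where "x = (1 / real n) * (\<Sum>i<n. (z i)\<^sup>2) / v - (1 + \<epsilon>)"
        have xe: "(1 / real n) * (\<Sum>i<n. (z i)\<^sup>2) = v * (1 + \<epsilon>) + v * x" using v by (simp add: x_def field_simps)
        have "?E z = exp (n * (?s * x))"
          unfolding E x_def using n by (simp add: field_simps)
        then have Ex: "?E z \<ge> 1 + n * (?s * x)" using exp_ge_add_one_self[of "n * (?s * x)"] by simp
        \<comment> \<open>The constant \<open>8 / \<epsilon>\<close> is the reciprocal of the
          Chernoff parameter \<open>?s\<close>: an excess \<open>x > 0\<close> is at most
          \<open>n * x\<close>, and \<open>n * (?s * x)\<close> is below its own
          exponential.\<close>
        have "x \<le> (1 + \<epsilon> + 8 / \<epsilon>) * ?E z"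
        proof (cases "x \<le> 0")
          case True
          moreover have "0 \<le> (1 + \<epsilon> + 8 / \<epsilon>) * ?E z" unfolding E using \<epsilon> by simp
          ultimately show ?thesis by linarith
        next
          case False
          then have "x \<le> n * x" using n by simp
          also have "\<dots> = (8 / \<epsilon>) * (n * (?s * x))" using \<epsilon> by simp
          also have "\<dots> \<le> (8 / \<epsilon>) * ?E z" using Ex \<epsilon> by (intro mult_left_mono) auto
          also have "\<dots> \<le> (1 + \<epsilon> + 8 / \<epsilon>) * ?E z" unfolding E using \<epsilon> by (intro mult_right_mono) auto
          finally show ?thesis .
        qed
        from mult_left_mono[OF this less_imp_le[OF v]] show ?thesis unfolding xe by (simp add: mult.assoc)
      qed
      finally show ?thesis using nn False by auto
    qed
  qed
  have nn: "0 \<le> D * (1 + \<epsilon>)" "0 \<le> v * (1 + \<epsilon>)" "0 \<le> ?K" using D v \<epsilon> by auto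
  interpret V: prob_space "centered_normal v" by (rule prob_space_centered_normal)
  interpret VP: product_prob_space "\<lambda>_. centered_normal v" "{..<n}" by unfold_locales
  note \<mu>1 = prob_space.emeasure_space_1[OF prob_space_normal_block[of n v]]
  have "(\<integral>\<^sup>+z. ennreal (?d z) \<partial>?\<mu>)
      \<le> (\<integral>\<^sup>+z. ennreal (D * (1 + \<epsilon>)) + ennreal (v * (1 + \<epsilon>)) * of_bool (\<forall>j<N. \<not> ?T z (c0 j))
          + ennreal (?K) * ?G z \<partial>?\<mu>)"
  proof (rule nn_integral_mono)
    fix z
    have "ennreal (?d z)
      \<le> ennreal (D * (1 + \<epsilon>) + v * (1 + \<epsilon>) * of_bool (\<forall>j<N. \<not> ?T z (c0 j)) + ?K * ?E z)"
      by (rule ennreal_leI[OF pw])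
    also have "\<dots> = ennreal (D * (1 + \<epsilon>)) + ennreal (v * (1 + \<epsilon>)) * of_bool (\<forall>j<N. \<not> ?T z (c0 j))
          + ennreal (?K) * ?G z"
      using nn by (simp add: prod_ennreal ennreal_mult prod_nonneg)
    finally show "ennreal (?d z) \<le> \<dots>" .
  qed
  also have "\<dots> = ennreal (D * (1 + \<epsilon>)) + ennreal (v * (1 + \<epsilon>)) * (\<integral>\<^sup>+z. of_bool (\<forall>j<N. \<not> ?T z (c0 j)) \<partial>?\<mu>)
      + ennreal (?K) * (\<integral>\<^sup>+z. ?G z \<partial>?\<mu>)"
  proof -
    have [measurable]: "Measurable.pred ?\<mu> (\<lambda>z. ?T z x)" for x
      unfolding typical_def by measurable
    have split: "(\<integral>\<^sup>+z. k + g z + h z \<partial>?\<mu>) = k + (\<integral>\<^sup>+z. g z \<partial>?\<mu>) + (\<integral>\<^sup>+z. h z \<partial>?\<mu>)"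
      if "g \<in> borel_measurable ?\<mu>" "h \<in> borel_measurable ?\<mu>" for k g h
      using that by (subst nn_integral_add, simp_all, subst nn_integral_add, simp_all add: \<mu>1)
    show ?thesis
      by (subst split, measurable, subst nn_integral_cmult, measurable, subst nn_integral_cmult, measurable)
  qed
  also have "(\<integral>\<^sup>+z. ?G z \<partial>?\<mu>) = ennreal (chernoff ?s \<epsilon> ^ n)"
  proof -
    have "(\<integral>\<^sup>+z. ?G z \<partial>?\<mu>)
        = (\<Prod>i<n. \<integral>\<^sup>+z. ennreal (exp (?s * (z\<^sup>2 / v - (1 + \<epsilon>)))) \<partial>centered_normal v)"
      by (rule VP.product_nn_integral_prod) auto
    also have "\<dots> = ennreal (chernoff ?s \<epsilon>) ^ n"
      using \<epsilon> by (subst nn_integral_chernoff[OF v]) auto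
    finally show ?thesis using \<epsilon> by (simp add: ennreal_power chernoff_def)
  qed
  also have "ennreal (D * (1 + \<epsilon>)) + ennreal (v * (1 + \<epsilon>)) * (\<integral>\<^sup>+z. of_bool (\<forall>j<N. \<not> ?T z (c0 j)) \<partial>?\<mu>)
      + ennreal (?K) * ennreal (chernoff ?s \<epsilon> ^ n)
    \<le> ennreal (D * (1 + \<epsilon>)) + ennreal (v * (1 + \<epsilon>)) * ennreal ?P
      + ennreal (?K) * ennreal (chernoff ?s \<epsilon> ^ n)"
    by (intro add_mono mult_left_mono fail) auto
  also have "\<dots> = ennreal (D * (1 + \<epsilon>) + v * (1 + \<epsilon>) * ?P + ?K * chernoff ?s \<epsilon> ^ n)"
  proof -
    have "0 \<le> chernoff ?s \<epsilon>" "0 \<le> chernoff (- \<epsilon> / 8) (- \<epsilon>)" using \<epsilon> by (auto simp: chernoff_def)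
    then have "0 \<le> ?P" "0 \<le> chernoff ?s \<epsilon> ^ n" by simp_all
    then show ?thesis using nn by (simp only: ennreal_mult[symmetric] ennreal_plus[symmetric] mult_nonneg_nonneg add_nonneg_nonneg)
  qed
  finally show ?thesis using cs selm by blast
qed

definition has_codebook :: "nat \<Rightarrow> real \<Rightarrow> real \<Rightarrow> real \<Rightarrow> bool" where
  "has_codebook n v D R \<longleftrightarrow> (\<exists>K c sel. 1 \<le> K \<and> real K \<le> exp (n * R) \<and> (\<forall>j<K. c j \<in> space (seqs n)) \<and>
     sel \<in> seqs n \<rightarrow>\<^sub>M count_space {..<K} \<and>
     (\<integral>\<^sup>+z. ennreal ((1 / real n) * (\<Sum>i<n. (z i - c (sel z) i)\<^sup>2)) \<partial>normal_block n v) \<le> ennreal D)"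

text \<open>For \<open>v \<le> D\<close> the single zero codeword suffices. Otherwise the codebook
  aims at the smaller distortion \<open>D0\<close>, for which even
  \<open>D0 * (1 + \<epsilon>)\<close> is strictly below \<open>D\<close>; the gap absorbs the terms
  that vanish as the block length grows.\<close>

lemma eventually_has_codebook:
  assumes v: "v \<ge> 0" and D: "D > 0" and R: "R > gaussian_rate v D"
  shows "\<forall>\<^sub>F n in sequentially. has_codebook n v D R"
proof (cases "v > D")
  case False
  then have R0: "R > 0" using R by (simp add: gaussian_rate_def)
  show ?thesis
    using eventually_gt_at_top[of 0]
  proof eventually_elim
    case (elim n)
    have "(\<integral>\<^sup>+z. ennreal ((1 / real n) * (\<Sum>i<n. (z i - (\<lambda>i\<in>{..<n}. 0) i)\<^sup>2)) \<partial>normal_block n v) = ennreal v"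
      using nn_integral_normal_block_sq_distortion[OF v elim, of "\<lambda>_. 0"] by simp
    then have "(\<integral>\<^sup>+z. ennreal ((1 / real n) * (\<Sum>i<n. (z i - (\<lambda>i\<in>{..<n}. 0) i)\<^sup>2)) \<partial>normal_block n v) \<le> ennreal D"
      using False by (simp add: ennreal_leI)
    then show ?case
      unfolding has_codebook_def using R0
      by (intro exI[of _ "1::nat"] exI[of _ "\<lambda>_. \<lambda>i\<in>{..<n}. 0"] exI[of _ "\<lambda>_. 0"]) (auto simp: space_PiM)
  qed
next
  case True
  define I where "I = ln (v / D) / 2"
  have IR: "I < R" using R True by (simp add: gaussian_rate_def I_def)
  \<comment> \<open>Passing from \<open>D\<close> to \<open>D0\<close> raises the rate by
    \<open>ln (1 + \<epsilon>) \<le> \<epsilon>\<close>, and typicality costs another \<epsilon>. A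
    quarter of the available gap therefore leaves at least \<open>2 * \<epsilon>\<close> for the
    exponent \<eta> that makes the codebook large enough.\<close>
  define \<epsilon> where "\<epsilon> = min 1 ((R - I) / 4)"
  have \<epsilon>: "0 < \<epsilon>" "\<epsilon> \<le> 1" "4 * \<epsilon> \<le> R - I" using IR by (auto simp: \<epsilon>_def min_def)
  define D0 where "D0 = D / (1 + \<epsilon>)\<^sup>2"
  have q: "1 < (1 + \<epsilon>)\<^sup>2" using \<epsilon> by (simp add: power2_eq_square algebra_simps add_pos_pos)
  have D0: "0 < D0" using D \<epsilon> by (simp add: D0_def)
  have D0D: "D0 < D" unfolding D0_def using D q by (simp add: divide_less_eq)
  then have D0v: "D0 < v" using True by simp
  have D0e: "D0 * (1 + \<epsilon>) < D"
    using D \<epsilon> by (simp add: D0_def power2_eq_square divide_less_eq)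
  define J where "J = ln (v / D0) / 2 + \<epsilon>"
  have "ln (v / D0) = ln (v / D) + 2 * ln (1 + \<epsilon>)"
  proof -
    have "v / D0 = (v / D) * (1 + \<epsilon>)\<^sup>2" by (simp add: D0_def)
    moreover have "ln ((v / D) * (1 + \<epsilon>)\<^sup>2) = ln (v / D) + ln ((1 + \<epsilon>)\<^sup>2)"
      using True D \<epsilon> by (intro ln_mult_pos) auto
    moreover have "ln ((1 + \<epsilon>)\<^sup>2) = 2 * ln (1 + \<epsilon>)" using \<epsilon> by (simp add: ln_realpow)
    ultimately show ?thesis by (simp only:)
  qed
  moreover have "ln (1 + \<epsilon>) \<le> \<epsilon>" using \<epsilon> by (intro ln_add_one_self_le_self) simp
  ultimately have J: "J \<le> I + 2 * \<epsilon>" by (simp add: J_def I_def)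
  have J0: "0 \<le> J" using D0 D0v \<epsilon> by (simp add: J_def)
  define \<eta> where "\<eta> = R - J"
  have \<eta>: "0 < \<eta>" using J \<epsilon> by (simp add: \<eta>_def)
  have R0: "R > 0" using \<eta> J0 by (simp add: \<eta>_def)
  define \<rho>1 where "\<rho>1 = chernoff (\<epsilon> / 8) \<epsilon>"
  define \<rho>2 where "\<rho>2 = chernoff (- \<epsilon> / 8) (- \<epsilon>)"
  have \<rho>: "0 \<le> \<rho>1" "\<rho>1 < 1" "0 \<le> \<rho>2" "\<rho>2 < 1"
  proof -
    show "0 \<le> \<rho>1" "0 \<le> \<rho>2" using \<epsilon> by (auto simp: \<rho>1_def \<rho>2_def chernoff_def)
    show "\<rho>1 < 1" unfolding \<rho>1_def
      by (rule chernoff_less_1) (use \<epsilon> in \<open>auto simp: power2_eq_square\<close>)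
    show "\<rho>2 < 1" unfolding \<rho>2_def
      by (rule chernoff_less_1) (use \<epsilon> in \<open>auto simp: power2_eq_square\<close>)
  qed
  \<comment> \<open>One index is reserved for the zero codeword. Together with rounding this loses
    at most 2, so \<open>N n \<ge> exp (n * R) - 2\<close>; this is the 2 in the doubly exponential
    term of \<open>B\<close>.\<close>
  define N where "N = (\<lambda>n::nat. nat \<lfloor>exp (real n * R)\<rfloor> - 1)"
  define B where "B = (\<lambda>n. D0 * (1 + \<epsilon>) + v * (1 + \<epsilon>) * (2 * \<rho>1 ^ n + \<rho>2 ^ n + exp (2 - exp (real n * \<eta>)))
    + v * (1 + \<epsilon> + 8 / \<epsilon>) * \<rho>1 ^ n)"
  have "(\<lambda>n. exp (2 - exp (real n * \<eta>))) \<longlonglongrightarrow> 0" using \<eta> by real_asymp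
  moreover have "(\<lambda>n. \<rho>1 ^ n) \<longlonglongrightarrow> 0" "(\<lambda>n. \<rho>2 ^ n) \<longlonglongrightarrow> 0" using \<rho> by (auto intro: LIMSEQ_realpow_zero)
  ultimately have "B \<longlonglongrightarrow> D0 * (1 + \<epsilon>) + v * (1 + \<epsilon>) * (2 * 0 + 0 + 0) + v * (1 + \<epsilon> + 8 / \<epsilon>) * 0"
    unfolding B_def by (intro tendsto_add tendsto_mult tendsto_const)
  then have "B \<longlonglongrightarrow> D0 * (1 + \<epsilon>)" by simp
  from order_tendstoD(2)[OF this D0e] have "\<forall>\<^sub>F n in sequentially. B n < D" .
  then show ?thesis
    using eventually_gt_at_top[of 0]
  proof eventually_elim
    case (elim n)
    let ?x = "exp (real n * R)"
    have x1: "1 \<le> ?x" using R0 by simp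
    then have fl: "1 \<le> nat \<lfloor>?x\<rfloor>" by (simp add: le_nat_floor)
    have NS: "real (Suc (N n)) \<le> ?x"
    proof -
      have "Suc (N n) = nat \<lfloor>?x\<rfloor>" using fl by (simp add: N_def)
      then show ?thesis using of_nat_floor[of ?x] by simp
    qed
    have Nge: "?x - 2 \<le> real (N n)"
    proof -
      have "?x < real (nat \<lfloor>?x\<rfloor>) + 1" by linarith
      moreover have "real (N n) = real (nat \<lfloor>?x\<rfloor>) - 1"
        using fl unfolding N_def by (subst of_nat_diff) auto
      ultimately show ?thesis by linarith
    qed
    have "exp (real n * \<eta>) - 2 \<le> real (N n) * exp (- (n * J))"
    proof -
      have "exp (real n * \<eta>) - 2 \<le> exp (real n * \<eta>) - 2 * exp (- (n * J))" using J0 by simp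
      also have "\<dots> = (?x - 2) * exp (- (n * J))"
        by (simp add: \<eta>_def left_diff_distrib exp_add[symmetric] right_diff_distrib)
      also have "\<dots> \<le> real (N n) * exp (- (n * J))" using Nge by (intro mult_right_mono) auto
      finally show ?thesis .
    qed
    then have ex: "exp (- (real (N n) * exp (- (n * J)))) \<le> exp (2 - exp (real n * \<eta>))" by simp
    obtain c sel where c: "\<forall>j\<le>N n. c j \<in> space (seqs n)" and sel: "sel \<in> seqs n \<rightarrow>\<^sub>M count_space {..N n}"
      and d: "(\<integral>\<^sup>+z. ennreal ((1 / real n) * (\<Sum>i<n. (z i - c (sel z) i)\<^sup>2)) \<partial>normal_block n v)
        \<le> ennreal (D0 * (1 + \<epsilon>) + v * (1 + \<epsilon>) * (2 * \<rho>1 ^ n + \<rho>2 ^ n + exp (- (real (N n) * exp (- (n * J)))))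
           + v * (1 + \<epsilon> + 8 / \<epsilon>) * \<rho>1 ^ n)"
      using codebook_distortion[OF D0 D0v \<epsilon>(1,2) elim(2), of "N n"] unfolding \<rho>1_def \<rho>2_def J_def by blast
    note d
    also have "ennreal (D0 * (1 + \<epsilon>) + v * (1 + \<epsilon>) * (2 * \<rho>1 ^ n + \<rho>2 ^ n + exp (- (real (N n) * exp (- (n * J)))))
           + v * (1 + \<epsilon> + 8 / \<epsilon>) * \<rho>1 ^ n) \<le> ennreal (B n)"
      unfolding B_def using ex v \<epsilon> by (intro ennreal_leI add_mono mult_left_mono order_refl) auto
    also have "\<dots> \<le> ennreal D" using elim(1) by (intro ennreal_leI) simp
    finally show ?case
      unfolding has_codebook_def using c sel NS
      by (intro exI[of _ "Suc (N n)"] exI[of _ c] exI[of _ sel]) (auto simp: less_Suc_eq_le lessThan_Suc_atMost)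
  qed
qed

text \<open>Achievability asks for convergent distortions.  Shifting the reconstruction by a constant turns
  a distortion of at most \<open>D\<close> into one of exactly \<open>D\<close>, which makes the sequence constant.\<close>

lemma (in prob_space) exists_offset:
  fixes f :: "nat \<Rightarrow> 'a \<Rightarrow> real"
  assumes [measurable]: "\<And>i. i \<in> {..<n} \<Longrightarrow> f i \<in> borel_measurable M"
    and n: "n > 0" and D: "D \<ge> 0"
    and le: "(\<integral>\<^sup>+x. ennreal ((1 / real n) * (\<Sum>i<n. (f i x)\<^sup>2)) \<partial>M) \<le> ennreal D"
  shows "\<exists>\<delta>. (\<integral>\<^sup>+x. ennreal ((1 / real n) * (\<Sum>i<n. (f i x - \<delta>)\<^sup>2)) \<partial>M) = ennreal D"
proof -
  let ?q = "\<lambda>x. (1 / real n) * (\<Sum>i<n. (f i x)\<^sup>2)"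
  let ?l = "\<lambda>x. (1 / real n) * (\<Sum>i<n. f i x)"
  have iq: "integrable M ?q"
  proof (rule integrableI_bounded)
    show "(\<integral>\<^sup>+x. ennreal (norm (?q x)) \<partial>M) < \<infinity>"
      using le_less_trans[OF le ennreal_less_top] by (simp add: sum_nonneg)
  qed measurable
  have if1: "integrable M (f i)" if i: "i \<in> {..<n}" for i
  proof (rule square_integrable_imp_integrable)
    show "f i \<in> borel_measurable M" using i by measurable
    have "integrable M (\<lambda>x. n * ?q x)" using iq by (rule integrable_mult_right)
    then show "integrable M (\<lambda>x. (f i x)\<^sup>2)"
    proof (rule Bochner_Integration.integrable_bound)
      have "(f i x)\<^sup>2 \<le> (\<Sum>i<n. (f i x)\<^sup>2)" for x using i by (intro member_le_sum) auto
      then show "AE x in M. norm ((f i x)\<^sup>2) \<le> norm (n * ?q x)" using n by (auto simp: sum_nonneg)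
    qed (use i in measurable)
  qed
  have il: "integrable M ?l"
    by (intro integrable_mult_right Bochner_Integration.integrable_sum if1)
  define d where "d = expectation ?q"
  define m where "m = expectation ?l"
  have "ennreal d \<le> ennreal D"
    unfolding d_def using le by (subst nn_integral_eq_integral[OF iq, symmetric]) (auto simp: sum_nonneg)
  then have dD: "d \<le> D" using D by simp
  \<comment> \<open>The larger root of \<open>\<delta>^2 - 2 * m * \<delta> + d = D\<close>, which
    says that the shifted distortion equals \<open>D\<close>. The radicand is nonnegative because
    \<open>d \<le> D\<close>.\<close>
  define \<delta> where "\<delta> = m + sqrt (m\<^sup>2 + (D - d))"
  have "(\<delta> - m)\<^sup>2 = m\<^sup>2 + (D - d)" using dD by (simp add: \<delta>_def)
  then have \<delta>: "d - 2 * \<delta> * m + \<delta>\<^sup>2 = D" by (simp add: power2_eq_square algebra_simps)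
  have eq: "(1 / real n) * (\<Sum>i<n. (f i x - \<delta>)\<^sup>2) = ?q x - 2 * \<delta> * ?l x + \<delta>\<^sup>2" for x
  proof -
    have "(\<Sum>i<n. (f i x - \<delta>)\<^sup>2) = (\<Sum>i<n. (f i x)\<^sup>2 - 2 * \<delta> * f i x + \<delta>\<^sup>2)"
      by (simp add: power2_eq_square algebra_simps)
    also have "\<dots> = (\<Sum>i<n. (f i x)\<^sup>2) - 2 * \<delta> * (\<Sum>i<n. f i x) + n * \<delta>\<^sup>2"
      by (simp add: sum.distrib sum_subtractf sum_distrib_left)
    finally show ?thesis using n by (simp add: field_simps)
  qed
  have lin: "integrable M (\<lambda>x. q x - 2 * \<delta> * l x + \<delta>\<^sup>2) \<and>
      expectation (\<lambda>x. q x - 2 * \<delta> * l x + \<delta>\<^sup>2) = expectation q - 2 * \<delta> * expectation l + \<delta>\<^sup>2"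
    if "integrable M q" "integrable M l" for q l
    using that by (simp add: prob_space)
  have i: "integrable M (\<lambda>x. (1 / real n) * (\<Sum>i<n. (f i x - \<delta>)\<^sup>2))"
    unfolding eq using lin[OF iq il] by (rule conjunct1)
  have "expectation (\<lambda>x. (1 / real n) * (\<Sum>i<n. (f i x - \<delta>)\<^sup>2)) = D"
    unfolding eq using lin[OF iq il, THEN conjunct2] unfolding d_def[symmetric] m_def[symmetric] \<delta> .
  then show ?thesis
    by (intro exI[of _ \<delta>]) (subst nn_integral_eq_integral[OF i], auto simp: sum_nonneg)
qed

subsection \<open>Codes and the rate-distortion function\<close>

text \<open>One codebook for \<open>Z1\<close> at distortion \<theta> yields the reproductions of
  both \<open>X1\<close> and \<open>S\<close>, and a second codebook describes \<open>Z2\<close>.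
  The three outputs receive separate offsets, so each distortion can be adjusted to its target
  without disturbing the others.\<close>

lemma exists_code:
  assumes law: "source_law M S X1 X2 Y w v1 v2 vY a b c"
    and w: "w \<ge> 0" and n: "n > 0"
    and \<theta>: "0 \<le> \<theta>" "\<theta> \<le> D1" "c\<^sup>2 * \<theta> \<le> Ds - w" and D2: "0 \<le> D2"
    and cb: "has_codebook n v1 \<theta> R1" "has_codebook n v2 D2 R2" and R: "R1 + R2 \<le> R * ln 2"
  shows "\<exists>enc dec. is_code n R enc dec \<and>
    expected_d1 (iid_source M S X1 X2 Y n) n enc dec = ennreal D1 \<and>
    expected_d2 (iid_source M S X1 X2 Y n) n enc dec = ennreal D2 \<and>
    expected_ds (iid_source M S X1 X2 Y n) n enc dec = ennreal Ds"
proof -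
  obtain K1 c1 s1 where K1: "1 \<le> K1" "real K1 \<le> exp (n * R1)" and s1: "s1 \<in> seqs n \<rightarrow>\<^sub>M count_space {..<K1}"
    and d1: "(\<integral>\<^sup>+z. ennreal ((1 / real n) * (\<Sum>i<n. (z i - c1 (s1 z) i)\<^sup>2)) \<partial>normal_block n v1) \<le> ennreal \<theta>"
    using cb(1) unfolding has_codebook_def by blast
  obtain K2 c2 s2 where K2: "1 \<le> K2" "real K2 \<le> exp (n * R2)" and s2: "s2 \<in> seqs n \<rightarrow>\<^sub>M count_space {..<K2}"
    and d2: "(\<integral>\<^sup>+z. ennreal ((1 / real n) * (\<Sum>i<n. (z i - c2 (s2 z) i)\<^sup>2)) \<partial>normal_block n v2) \<le> ennreal D2"
    using cb(2) unfolding has_codebook_def by blast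
  have s1U[measurable]: "s1 \<in> seqs n \<rightarrow>\<^sub>M count_space UNIV" and s2U[measurable]: "s2 \<in> seqs n \<rightarrow>\<^sub>M count_space UNIV"
    using measurable_compose[OF s1, of "\<lambda>x. x" "count_space UNIV"] measurable_compose[OF s2, of "\<lambda>x. x" "count_space UNIV"]
    by auto
  have s1K: "s1 z < K1" if "z \<in> space (seqs n)" for z using measurable_space[OF s1 that] by simp
  have s2K: "s2 z < K2" if "z \<in> space (seqs n)" for z using measurable_space[OF s2 that] by simp
  \<comment> \<open>The pair of codeword indices is packed in mixed radix with base
    \<open>K1\<close>, shifted by 1 because the index set starts at 1. The decoder recovers it as
    remainder and quotient of \<open>m - 1\<close>.\<close>
  define enc :: encoder where "enc = (\<lambda>(x1, x2, y).
    1 + s1 (\<lambda>i\<in>{..<n}. x1 i - a * y i) + K1 * s2 (\<lambda>i\<in>{..<n}. x2 i - b * y i))"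
  let ?J = "code_index n R"
  have idx: "1 + k + K1 * l \<in> ?J" if "k < K1" "l < K2" for k l
  proof -
    have "1 + k + K1 * l \<le> K1 + K1 * l" using that by simp
    also have "\<dots> = K1 * Suc l" by simp
    also have "\<dots> \<le> K1 * K2" using that by (intro mult_le_mono2) simp
    finally have "real (1 + k + K1 * l) \<le> real K1 * real K2" by (metis of_nat_le_iff of_nat_mult)
    also have "\<dots> \<le> exp (n * R1) * exp (n * R2)" using K1 K2 by (intro mult_mono) auto
    also have "\<dots> = exp (n * (R1 + R2))" by (simp add: exp_add[symmetric] algebra_simps)
    also have "\<dots> \<le> exp (n * (R * ln 2))" using R by (simp add: mult_left_mono)
    also have "\<dots> = 2 powr (real n * R)" by (simp add: powr_def mult.assoc)
    finally show ?thesis by (simp add: code_index_def)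
  qed
  have encU: "enc \<in> seqs3 n \<rightarrow>\<^sub>M count_space UNIV"
    unfolding enc_def split_beta' by measurable
  have encJ: "enc \<in> seqs3 n \<rightarrow>\<^sub>M count_space ?J"
  proof (rule measurable_count_space_extend[OF subset_UNIV _ encU], rule funcsetI)
    fix x
    show "enc x \<in> ?J" unfolding enc_def split_beta' by (intro idx s1K s2K) (auto simp: space_PiM)
  qed
  \<comment> \<open>The reproduction of \<open>S\<close> is \<open>c\<close> times the estimate of
    \<open>X1\<close> before the offset \<delta>1, so its error apart from \<open>w\<close> is
    \<open>c\<close> times the codebook error.\<close>
  define dec0 :: "real \<times> real \<times> real \<Rightarrow> decoder" where "dec0 = (\<lambda>(\<delta>1, \<delta>2, \<delta>s) (m, y).
    (\<lambda>i\<in>{..<n}. a * y i + c1 ((m - 1) mod K1) i + \<delta>1,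
     \<lambda>i\<in>{..<n}. b * y i + c2 ((m - 1) div K1) i + \<delta>2,
     \<lambda>i\<in>{..<n}. c * (a * y i + c1 ((m - 1) mod K1) i) + \<delta>s))"
  have code: "is_code n R enc (dec0 \<delta>)" for \<delta>
    unfolding is_code_def
  proof (intro conjI encJ)
    show "dec0 \<delta> \<in> count_space ?J \<Otimes>\<^sub>M seqs n \<rightarrow>\<^sub>M seqs3 n"
    proof (rule measurable_pair_measure_countable1)
      show "countable ?J" by (rule countable_finite[OF finite_code_index])
      show "(\<lambda>y. dec0 \<delta> (m, y)) \<in> seqs n \<rightarrow>\<^sub>M seqs3 n" for m
        unfolding dec0_def split_beta' by simp measurable
    qed
  qed
  let ?Q = "residual_block n v1 v2 vY"
  interpret N1: prob_space "normal_block n v1" by (rule prob_space_normal_block)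
  interpret N2: prob_space "normal_block n v2" by (rule prob_space_normal_block)
  interpret NY: prob_space "normal_block n vY" by (rule prob_space_normal_block)
  interpret N2Y: pair_prob_space "normal_block n v2" "normal_block n vY" ..
  interpret Q: pair_prob_space "normal_block n v1" "normal_block n v2 \<Otimes>\<^sub>M normal_block n vY" ..
  have out: "code_out a b n enc (dec0 (\<delta>1, \<delta>2, \<delta>s)) p =
      (\<lambda>i\<in>{..<n}. a * snd (snd p) i + c1 (s1 (fst p)) i + \<delta>1,
       \<lambda>i\<in>{..<n}. b * snd (snd p) i + c2 (s2 (fst (snd p))) i + \<delta>2,
       \<lambda>i\<in>{..<n}. c * (a * snd (snd p) i + c1 (s1 (fst p)) i) + \<delta>s)"
    if p: "p \<in> space ?Q" for p \<delta>1 \<delta>2 \<delta>s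
  proof -
    have z: "fst p \<in> space (seqs n)" "fst (snd p) \<in> space (seqs n)"
      using p by (auto simp: space_pair_measure space_PiM)
    have r: "(\<lambda>i\<in>{..<n}. fst p i) = fst p" "(\<lambda>i\<in>{..<n}. fst (snd p) i) = fst (snd p)"
      using z by (auto simp: space_PiM PiE_def extensional_restrict)
    have "code_msg a b n enc p = 1 + s1 (\<lambda>i\<in>{..<n}. fst p i) + K1 * s2 (\<lambda>i\<in>{..<n}. fst (snd p) i)"
      by (simp add: code_msg_def enc_def split_beta' cong: restrict_cong)
    then have m: "code_msg a b n enc p = 1 + s1 (fst p) + K1 * s2 (fst (snd p))" by (simp only: r)
    have "(code_msg a b n enc p - 1) mod K1 = s1 (fst p)" "(code_msg a b n enc p - 1) div K1 = s2 (fst (snd p))"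
      unfolding m using s1K[OF z(1)] by simp_all
    then show ?thesis by (simp add: code_out_def dec0_def cong: restrict_cong)
  qed
  let ?e1 = "\<lambda>i p. fst p i - c1 (s1 (fst p)) i" and ?e2 = "\<lambda>i p. fst (snd p) i - c2 (s2 (fst (snd p))) i"
  let ?m1 = "\<lambda>p. (1 / real n) * (\<Sum>i<n. (?e1 i p)\<^sup>2)"
  have m1: "?e1 i \<in> borel_measurable ?Q" if "i \<in> {..<n}" for i
  proof (rule borel_measurable_diff)
    show "(\<lambda>p. fst p i) \<in> borel_measurable ?Q" using that by measurable
    show "(\<lambda>p. c1 (s1 (fst p)) i) \<in> borel_measurable ?Q"
      by (rule measurable_compose[of "\<lambda>p. s1 (fst p)" _ "count_space UNIV" "\<lambda>j. c1 j i"]) measurable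
  qed
  have m2: "?e2 i \<in> borel_measurable ?Q" if "i \<in> {..<n}" for i
  proof (rule borel_measurable_diff)
    show "(\<lambda>p. fst (snd p) i) \<in> borel_measurable ?Q" using that by measurable
    show "(\<lambda>p. c2 (s2 (fst (snd p))) i) \<in> borel_measurable ?Q"
      by (rule measurable_compose[of "\<lambda>p. s2 (fst (snd p))" _ "count_space UNIV" "\<lambda>j. c2 j i"]) measurable
  qed
  have q: "(\<lambda>z. \<Sum>i<n. (z i - cc (ss z) i)\<^sup>2) \<in> borel_measurable (normal_block n v)"
    if "ss \<in> seqs n \<rightarrow>\<^sub>M count_space UNIV" for ss cc v
  proof (intro borel_measurable_sum borel_measurable_power borel_measurable_diff)
    fix i assume i: "i \<in> {..<n}"
    show "(\<lambda>z. z i) \<in> borel_measurable (normal_block n v)" using i by measurable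
    have "ss \<in> normal_block n v \<rightarrow>\<^sub>M count_space UNIV" using that by measurable
    then show "(\<lambda>z. cc (ss z) i) \<in> borel_measurable (normal_block n v)"
      by (rule measurable_compose[of ss _ "count_space UNIV" "\<lambda>j. cc j i"]) simp
  qed
  have E1: "(\<integral>\<^sup>+p. ennreal (?m1 p) \<partial>?Q) \<le> ennreal \<theta>"
  proof -
    have "(\<integral>\<^sup>+z. ennreal ((1 / real n) * (\<Sum>i<n. (z i - c1 (s1 z) i)\<^sup>2)) \<partial>normal_block n v1)
      = (\<integral>\<^sup>+z. ennreal ((1 / real n) * (\<Sum>i<n. (z i - c1 (s1 z) i)\<^sup>2)) \<partial>distr ?Q (normal_block n v1) fst)"
      unfolding N2Y.distr_pair_fst ..
    also have "\<dots> = (\<integral>\<^sup>+p. ennreal (?m1 p) \<partial>?Q)"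
      using q[OF s1U] by (subst nn_integral_distr) auto
    finally show ?thesis using d1 by simp
  qed
  have E2: "(\<integral>\<^sup>+p. ennreal ((1 / real n) * (\<Sum>i<n. (?e2 i p)\<^sup>2)) \<partial>?Q) \<le> ennreal D2"
  proof -
    have dd: "distr ?Q (normal_block n v2) (\<lambda>p. fst (snd p)) = normal_block n v2"
    proof -
      have "distr ?Q (normal_block n v2) (\<lambda>p. fst (snd p))
          = distr (distr ?Q (normal_block n v2 \<Otimes>\<^sub>M normal_block n vY) snd) (normal_block n v2) fst"
        by (subst distr_distr) (auto simp: comp_def)
      also have "distr ?Q (normal_block n v2 \<Otimes>\<^sub>M normal_block n vY) snd = normal_block n v2 \<Otimes>\<^sub>M normal_block n vY"
        by (rule distr_pair_snd) unfold_locales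
      also have "distr (normal_block n v2 \<Otimes>\<^sub>M normal_block n vY) (normal_block n v2) fst = normal_block n v2"
        by (rule NY.distr_pair_fst)
      finally show ?thesis .
    qed
    have "(\<integral>\<^sup>+z. ennreal ((1 / real n) * (\<Sum>i<n. (z i - c2 (s2 z) i)\<^sup>2)) \<partial>normal_block n v2)
      = (\<integral>\<^sup>+z. ennreal ((1 / real n) * (\<Sum>i<n. (z i - c2 (s2 z) i)\<^sup>2)) \<partial>distr ?Q (normal_block n v2) (\<lambda>p. fst (snd p)))"
      unfolding dd ..
    also have "\<dots> = (\<integral>\<^sup>+p. ennreal ((1 / real n) * (\<Sum>i<n. (?e2 i p)\<^sup>2)) \<partial>?Q)"
      using q[OF s2U] by (subst nn_integral_distr) auto
    finally show ?thesis using d2 by simp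
  qed
  have Es: "(\<integral>\<^sup>+p. ennreal ((1 / real n) * (\<Sum>i<n. (c * ?e1 i p)\<^sup>2)) \<partial>?Q) \<le> ennreal (Ds - w)"
  proof -
    have mm: "(\<lambda>p. ennreal (?m1 p)) \<in> borel_measurable ?Q"
      by (intro measurable_compose[OF _ measurable_ennreal] borel_measurable_times borel_measurable_const
          borel_measurable_sum borel_measurable_power m1)
    have "(\<integral>\<^sup>+p. ennreal ((1 / real n) * (\<Sum>i<n. (c * ?e1 i p)\<^sup>2)) \<partial>?Q)
      = (\<integral>\<^sup>+p. ennreal (c\<^sup>2) * ennreal (?m1 p) \<partial>?Q)"
    proof (rule nn_integral_cong)
      fix p
      have "(1 / real n) * (\<Sum>i<n. (c * ?e1 i p)\<^sup>2) = c\<^sup>2 * (?m1 p)"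
        by (simp add: power_mult_distrib sum_distrib_left[symmetric])
      then show "ennreal ((1 / real n) * (\<Sum>i<n. (c * ?e1 i p)\<^sup>2)) = ennreal (c\<^sup>2) * ennreal (?m1 p)"
        by (simp only: ennreal_mult' zero_le_power2)
    qed
    also have "\<dots> = ennreal (c\<^sup>2) * (\<integral>\<^sup>+p. ennreal (?m1 p) \<partial>?Q)"
      by (rule nn_integral_cmult[OF mm])
    also have "\<dots> \<le> ennreal (c\<^sup>2) * ennreal \<theta>" by (rule mult_left_mono[OF E1]) simp
    also have "\<dots> = ennreal (c\<^sup>2 * \<theta>)" by (simp add: ennreal_mult')
    also have "\<dots> \<le> ennreal (Ds - w)" by (rule ennreal_leI[OF \<theta>(3)])
    finally show ?thesis .
  qed
  have Ds: "0 \<le> Ds - w" using \<theta> by (meson mult_nonneg_nonneg order_trans zero_le_power2)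
  obtain \<delta>1 where \<delta>1: "(\<integral>\<^sup>+p. ennreal ((1 / real n) * (\<Sum>i<n. (?e1 i p - \<delta>1)\<^sup>2)) \<partial>?Q) = ennreal D1"
    using Q.exists_offset[of n ?e1 D1, OF m1 n _ order_trans[OF E1 ennreal_leI[OF \<theta>(2)]]] \<theta> by auto
  obtain \<delta>2 where \<delta>2: "(\<integral>\<^sup>+p. ennreal ((1 / real n) * (\<Sum>i<n. (?e2 i p - \<delta>2)\<^sup>2)) \<partial>?Q) = ennreal D2"
    using Q.exists_offset[of n ?e2 D2, OF m2 n D2 E2] by auto
  have ms: "(\<lambda>p. c * ?e1 i p) \<in> borel_measurable ?Q" if "i \<in> {..<n}" for i
    by (intro borel_measurable_times borel_measurable_const m1 that)
  obtain \<delta>s where \<delta>s: "(\<integral>\<^sup>+p. ennreal ((1 / real n) * (\<Sum>i<n. (c * ?e1 i p - \<delta>s)\<^sup>2)) \<partial>?Q) = ennreal (Ds - w)"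
    using Q.exists_offset[of n "\<lambda>i p. c * ?e1 i p" "Ds - w", OF ms n Ds Es] by auto
  let ?dec = "dec0 (\<delta>1, \<delta>2, \<delta>s)"
  note e = expected_distortions[OF law w n code[of "(\<delta>1, \<delta>2, \<delta>s)"]]
  have "expected_d1 (iid_source M S X1 X2 Y n) n enc ?dec = ennreal D1"
    unfolding e(1) \<delta>1[symmetric]
    by (intro nn_integral_cong) (simp add: out algebra_simps)
  moreover have "expected_d2 (iid_source M S X1 X2 Y n) n enc ?dec = ennreal D2"
    unfolding e(2) \<delta>2[symmetric]
    by (intro nn_integral_cong) (simp add: out algebra_simps)
  moreover have "expected_ds (iid_source M S X1 X2 Y n) n enc ?dec = ennreal Ds"
  proof -
    have "expected_ds (iid_source M S X1 X2 Y n) n enc ?dec = ennreal w + ennreal (Ds - w)"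
      unfolding e(3) \<delta>s[symmetric]
      by (intro arg_cong2[where f="(+)"] refl nn_integral_cong) (simp add: out algebra_simps)
    then show ?thesis using w Ds by (simp add: ennreal_plus[symmetric] del: ennreal_plus)
  qed
  ultimately show ?thesis using code by blast
qed

lemma achievable_if_rate_gt:
  assumes law: "source_law M S X1 X2 Y w v1 v2 vY a b c"
    and w: "w \<ge> 0" and v: "v1 \<ge> 0" "v2 \<ge> 0"
    and \<theta>: "0 < \<theta>" "\<theta> \<le> D1" "c\<^sup>2 * \<theta> \<le> Ds - w" and D2: "0 < D2"
    and R: "0 \<le> R" "gaussian_rate v1 \<theta> + gaussian_rate v2 D2 < R * ln 2"
  shows "achievable M S X1 X2 Y R D1 D2 Ds"
proof -
  let ?P = "iid_source M S X1 X2 Y"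
  \<comment> \<open>Half of the spare rate goes to each codebook. Since \<open>exists_code\<close>
    attains the targets exactly, the distortion sequences are eventually constant and their limits
    exist.\<close>
  define \<eta> where "\<eta> = (R * ln 2 - (gaussian_rate v1 \<theta> + gaussian_rate v2 D2)) / 2"
  have \<eta>: "\<eta> > 0" using R by (simp add: \<eta>_def)
  have "\<forall>\<^sub>F n in sequentially. has_codebook n v1 \<theta> (gaussian_rate v1 \<theta> + \<eta>)"
    using \<eta> by (intro eventually_has_codebook v \<theta>) simp
  moreover have "\<forall>\<^sub>F n in sequentially. has_codebook n v2 D2 (gaussian_rate v2 D2 + \<eta>)"
    using \<eta> by (intro eventually_has_codebook v D2) simp
  ultimately have ev: "\<forall>\<^sub>F n in sequentially. \<exists>x. is_code n R (fst x) (snd x) \<and>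
    expected_d1 (?P n) n (fst x) (snd x) = ennreal D1 \<and>
    expected_d2 (?P n) n (fst x) (snd x) = ennreal D2 \<and>
    expected_ds (?P n) n (fst x) (snd x) = ennreal Ds" (is "\<forall>\<^sub>F n in _. \<exists>x. ?C n x")
    using eventually_gt_at_top[of 0]
  proof eventually_elim
    case (elim n)
    have "gaussian_rate v1 \<theta> + \<eta> + (gaussian_rate v2 D2 + \<eta>) \<le> R * ln 2"
      by (simp add: \<eta>_def field_simps)
    from exists_code[OF law w elim(3) less_imp_le[OF \<theta>(1)] \<theta>(2,3) less_imp_le[OF D2] elim(1,2) this]
    show ?case by auto
  qed
  define f where "f = (\<lambda>n. SOME x. ?C n x)"
  have f: "\<forall>\<^sub>F n in sequentially. ?C n (f n)"
    using ev by eventually_elim (unfold f_def, rule someI_ex)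
  have "0 \<le> c\<^sup>2 * \<theta>" using \<theta> by simp
  then have "0 \<le> Ds" using \<theta> w by linarith
  then show ?thesis
    unfolding achievable_def using R \<theta> D2
    by (intro conjI exI[of _ "\<lambda>n. fst (f n)"] exI[of _ "\<lambda>n. snd (f n)"]
        exI[of _ "ennreal D1"] exI[of _ "ennreal D2"] exI[of _ "ennreal Ds"] tendsto_eventually
        eventually_mono[OF f]) auto
qed

section \<open>Closed form and minimum mean squared error\<close>

text \<open>Division by \<open>ln 2\<close> converts nats to bits. For \<open>v = 0\<close> the
  logarithm is \<open>-\<infinity>\<close> and its positive part is 0, in agreement with
  \<open>gaussian_rate\<close>.\<close>

lemma half_pos_part_elog2:
  assumes "v \<ge> 0" "D > 0"
  shows "ereal (1/2) * pos_part (elog2 (v / D)) = ereal (gaussian_rate v D / ln 2)"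
proof (cases "v = 0")
  case True
  then show ?thesis using assms by (simp add: elog2_def pos_part_def gaussian_rate_def zero_ereal_def)
next
  case False
  then have v: "v > 0" using assms by simp
  have "max (log 2 (v / D)) 0 = 2 * (gaussian_rate v D / ln 2)"
  proof (cases "v > D")
    case True
    then have "0 < ln (v / D)" using assms by simp
    then show ?thesis using True by (simp add: gaussian_rate_def log_def)
  next
    case False
    then have "ln (v / D) \<le> 0" using assms v by (simp add: ln_le_zero_iff)
    then show ?thesis using False by (simp add: gaussian_rate_def log_def divide_nonpos_pos max_def)
  qed
  then show ?thesis
    using v assms by (simp add: elog2_def pos_part_def zero_ereal_def flip: ereal_max)
qed

text \<open>\<theta> is the largest distortion for \<open>X1\<close> compatible with both
  \<open>D1\<close> and \<open>Ds\<close>, so the two lower bounds of the converse combine into the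
  rate at \<theta>, which the codes approach. The case \<open>c = 0\<close> is separate:
  \<open>S\<close> then imposes no bound on the error of \<open>X1\<close>, whereas division by zero
  would give 0.\<close>

lemma rate_distortion_eq:
  assumes law: "source_law M S X1 X2 Y w v1 v2 vY a b c"
    and w: "w \<ge> 0" and v: "v1 \<ge> 0" "v2 \<ge> 0" and D: "D1 > 0" "D2 > 0" "Ds > w"
  defines "\<theta> \<equiv> if c = 0 then D1 else min D1 ((Ds - w) / c\<^sup>2)"
  shows "rate_distortion M S X1 X2 Y D1 D2 Ds = ereal ((gaussian_rate v1 \<theta> + gaussian_rate v2 D2) / ln 2)"
proof (rule antisym)
  let ?r = "(gaussian_rate v1 \<theta> + gaussian_rate v2 D2) / ln 2"
  have \<theta>: "0 < \<theta>" "\<theta> \<le> D1" "c\<^sup>2 * \<theta> \<le> Ds - w"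
  proof -
    show "0 < \<theta>" "\<theta> \<le> D1" using D by (auto simp: \<theta>_def)
    show "c\<^sup>2 * \<theta> \<le> Ds - w"
    proof (cases "c = 0")
      case False
      then have "\<theta> \<le> (Ds - w) / c\<^sup>2" by (simp add: \<theta>_def)
      then show ?thesis using False by (simp add: field_simps)
    qed (use D in simp)
  qed
  have nn: "0 \<le> gaussian_rate v D" if "D > 0" for v D using that by (simp add: gaussian_rate_def)
  have r0: "0 \<le> ?r" using nn[OF \<theta>(1)] nn[OF D(2)] by simp
  show "rate_distortion M S X1 X2 Y D1 D2 Ds \<le> ereal ?r"
  proof (rule ereal_le_epsilon2)
    fix e :: real assume e: "0 < e"
    have "achievable M S X1 X2 Y (?r + e) D1 D2 Ds"
    proof (rule achievable_if_rate_gt[OF law w v \<theta> D(2)])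
      show "0 \<le> ?r + e" using r0 e by simp
      show "gaussian_rate v1 \<theta> + gaussian_rate v2 D2 < (?r + e) * ln 2" using e by (simp add: field_simps)
    qed
    then show "rate_distortion M S X1 X2 Y D1 D2 Ds \<le> ereal ?r + ereal e"
      unfolding rate_distortion_def by (intro INF_lower2[of "?r + e"]) auto
  qed
  show "ereal ?r \<le> rate_distortion M S X1 X2 Y D1 D2 Ds"
    unfolding rate_distortion_def
  proof (rule INF_greatest)
    fix R assume "R \<in> {R. achievable M S X1 X2 Y R D1 D2 Ds}"
    then have "achievable M S X1 X2 Y R D1 D2 Ds" by simp
    note ge = achievable_rate_ge[OF law w v D this]
    have "gaussian_rate v1 \<theta> + gaussian_rate v2 D2 \<le> R * ln 2"
      using ge unfolding \<theta>_def min_def by (auto split: if_splits)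
    then show "ereal ?r \<le> ereal R" by (simp add: field_simps)
  qed
qed

text \<open>\<open>S - c * X\<close> is centered and independent of \<open>X\<close>, so the error
  of any estimator \<open>g\<close> splits into \<open>w\<close> and the mean square of
  \<open>c * X - g X\<close>. The linear estimator makes the second part vanish.\<close>

lemma (in prob_space) min_mean_square_error_eq:
  fixes S X :: "'a \<Rightarrow> real"
  assumes [measurable]: "S \<in> borel_measurable M" "X \<in> borel_measurable M"
    and law: "distr M (borel \<Otimes>\<^sub>M borel) (\<lambda>\<omega>. (S \<omega> - c * X \<omega>, X \<omega>)) = centered_normal w \<Otimes>\<^sub>M distr M borel X"
    and w: "0 \<le> w"
  shows "min_mean_square_error M S X = ennreal w"
proof -
  interpret W: prob_space "centered_normal w" by (rule prob_space_centered_normal)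
  interpret X: prob_space "distr M borel X" by (rule prob_space_distr) simp
  interpret WX: pair_prob_space "centered_normal w" "distr M borel X" ..
  have mse: "(\<integral>\<^sup>+\<omega>. ennreal ((S \<omega> - g (X \<omega>))\<^sup>2) \<partial>M) = (\<integral>\<^sup>+\<omega>. ennreal (w + (c * X \<omega> - g (X \<omega>))\<^sup>2) \<partial>M)"
    if [measurable]: "g \<in> borel_measurable borel" for g
  proof -
    have "(\<integral>\<^sup>+\<omega>. ennreal ((S \<omega> - g (X \<omega>))\<^sup>2) \<partial>M)
        = (\<integral>\<^sup>+q. ennreal ((fst q + (c * snd q - g (snd q)))\<^sup>2) \<partial>distr M (borel \<Otimes>\<^sub>M borel) (\<lambda>\<omega>. (S \<omega> - c * X \<omega>, X \<omega>)))"
      by (subst nn_integral_distr) (auto simp: algebra_simps)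
    also have "\<dots> = (\<integral>\<^sup>+x. \<integral>\<^sup>+z. ennreal ((z + (c * x - g x))\<^sup>2) \<partial>centered_normal w \<partial>distr M borel X)"
      unfolding law by (subst WX.nn_integral_snd[symmetric]) auto
    also have "\<dots> = (\<integral>\<^sup>+\<omega>. ennreal (w + (c * X \<omega> - g (X \<omega>))\<^sup>2) \<partial>M)"
      unfolding nn_integral_centered_normal_add_square[OF w] by (subst nn_integral_distr) auto
    finally show ?thesis .
  qed
  show ?thesis
  proof (rule antisym)
    have "(\<integral>\<^sup>+\<omega>. ennreal ((S \<omega> - c * X \<omega>)\<^sup>2) \<partial>M) = ennreal w"
      by (subst mse[of "\<lambda>x. c * x"]) (auto simp: emeasure_space_1)
    then show "min_mean_square_error M S X \<le> ennreal w"
      unfolding min_mean_square_error_def by (intro INF_lower2[of "\<lambda>x. c * x"]) auto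
    show "ennreal w \<le> min_mean_square_error M S X"
      unfolding min_mean_square_error_def
    proof (rule INF_greatest)
      fix g :: "real \<Rightarrow> real" assume g: "g \<in> borel_measurable borel"
      have "ennreal w = (\<integral>\<^sup>+\<omega>. ennreal w \<partial>M)" by (simp add: emeasure_space_1)
      also have "\<dots> \<le> (\<integral>\<^sup>+\<omega>. ennreal (w + (c * X \<omega> - g (X \<omega>))\<^sup>2) \<partial>M)"
        by (intro nn_integral_mono ennreal_leI) simp
      finally show "ennreal w \<le> (\<integral>\<^sup>+\<omega>. ennreal ((S \<omega> - g (X \<omega>))\<^sup>2) \<partial>M)" by (simp add: mse[OF g])
    qed
  qed
qed

theorem theorem8:
  fixes M :: "'a measure" and S X1 X2 Y :: "'a \<Rightarrow> real"
    and \<sigma>S \<sigma>X1 \<sigma>X2 \<sigma>Y \<sigma>SX1 \<sigma>X1Y \<sigma>X2Y mmse D1 D2 Ds :: real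
  assumes "prob_space M"
    and "jointly_gaussian M [S, X1, X2, Y]"
    and "prob_space.expectation M S = 0" and "prob_space.expectation M X1 = 0"
    and "prob_space.expectation M X2 = 0" and "prob_space.expectation M Y = 0"
    and "\<sigma>S = prob_space.variance M S" and "\<sigma>X1 = prob_space.variance M X1"
    and "\<sigma>X2 = prob_space.variance M X2" and "\<sigma>Y = prob_space.variance M Y"
    and "\<sigma>S > 0" and "\<sigma>X1 > 0" and "\<sigma>X2 > 0" and "\<sigma>Y > 0"
    and "\<sigma>SX1 = covariance M S X1" and "\<sigma>X1Y = covariance M X1 Y" and "\<sigma>X2Y = covariance M X2 Y"
    and "markov_chain M borel S borel X1 borel (\<lambda>\<omega>. (X2 \<omega>, Y \<omega>))"
    and "markov_chain M borel X1 borel Y borel X2"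
    and "mmse = \<sigma>S - \<sigma>SX1\<^sup>2 / \<sigma>X1"
    and "D1 > 0" and "D2 > 0" and "Ds > mmse"
  shows "min_mean_square_error M S X1 = ennreal mmse \<and>
    rate_distortion M S X1 X2 Y D1 D2 Ds =
      ereal (1/2) * pos_part (elog2 ((\<sigma>X2 - \<sigma>X2Y\<^sup>2 / \<sigma>Y) / D2)) +
      ereal (1/2) * pos_part (elog2 (max ((\<sigma>X1 - \<sigma>X1Y\<^sup>2 / \<sigma>Y) / D1)
                                     (\<sigma>SX1\<^sup>2 * (\<sigma>X1 - \<sigma>X1Y\<^sup>2 / \<sigma>Y) / (\<sigma>X1\<^sup>2 * (Ds - mmse)))))"
proof -
  interpret prob_space M by fact
  define a where "a = \<sigma>X1Y / \<sigma>Y"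
  define b where "b = \<sigma>X2Y / \<sigma>Y"
  define c where "c = \<sigma>SX1 / \<sigma>X1"
  define v1 where "v1 = \<sigma>X1 - \<sigma>X1Y\<^sup>2 / \<sigma>Y"
  define v2 where "v2 = \<sigma>X2 - \<sigma>X2Y\<^sup>2 / \<sigma>Y"
  note src = gaussian_source_law[OF assms(2-6) assms(12)[unfolded assms(8)] assms(14)[unfolded assms(10)] assms(18,19),
      folded assms(7-10) assms(15-17), folded a_def b_def c_def v1_def v2_def assms(20)]
  have "S \<in> borel_measurable M" "X1 \<in> borel_measurable M"
    using assms(18) by (auto simp: markov_chain_def)
  then have mse: "min_mean_square_error M S X1 = ennreal mmse"
    using src(5,2) by (rule min_mean_square_error_eq)
  define \<theta> where "\<theta> = (if c = 0 then D1 else min D1 ((Ds - mmse) / c\<^sup>2))"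
  have \<theta>: "\<theta> > 0" using assms(21,23) by (simp add: \<theta>_def)
  \<comment> \<open>Both fractions are \<open>v1 \<ge> 0\<close> over an admissible distortion, so
    the maximum belongs to the smaller denominator. For \<open>c = 0\<close> the second fraction is
    0 and \<theta> is \<open>D1\<close>.\<close>
  have "max (v1 / D1) (\<sigma>SX1\<^sup>2 * v1 / (\<sigma>X1\<^sup>2 * (Ds - mmse))) = v1 / \<theta>"
  proof -
    have "\<sigma>SX1\<^sup>2 * v1 / (\<sigma>X1\<^sup>2 * (Ds - mmse)) = c\<^sup>2 * v1 / (Ds - mmse)"
      by (simp add: c_def power_divide)
    moreover have "max (v1 / D1) (c\<^sup>2 * v1 / (Ds - mmse)) = v1 / \<theta>"
    proof (cases "c = 0")
      case True
      then show ?thesis using src(3) assms(21) by (simp add: \<theta>_def)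
    next
      case False
      then have K: "0 < (Ds - mmse) / c\<^sup>2" using assms(23) by simp
      have eq: "c\<^sup>2 * v1 / (Ds - mmse) = v1 / ((Ds - mmse) / c\<^sup>2)" by simp
      have m: "max (v1 / x) (v1 / y) = v1 / min x y" if "0 < x" "0 < y" for x y
        using that src(3) by (auto simp: max_def min_def intro: order.antisym divide_left_mono dest: divide_left_mono[of _ _ v1])
      show ?thesis
        unfolding eq m[OF assms(21) K] \<theta>_def if_not_P[OF False] ..
    qed
    ultimately show ?thesis by simp
  qed
  then have "ereal (1/2) * pos_part (elog2 (v2 / D2)) +
      ereal (1/2) * pos_part (elog2 (max (v1 / D1) (\<sigma>SX1\<^sup>2 * v1 / (\<sigma>X1\<^sup>2 * (Ds - mmse)))))
    = ereal ((gaussian_rate v1 \<theta> + gaussian_rate v2 D2) / ln 2)"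
    using half_pos_part_elog2[OF src(4) assms(22)] half_pos_part_elog2[OF src(3) \<theta>]
    by (simp add: add_divide_distrib add.commute)
  moreover have "rate_distortion M S X1 X2 Y D1 D2 Ds = ereal ((gaussian_rate v1 \<theta> + gaussian_rate v2 D2) / ln 2)"
    unfolding \<theta>_def by (rule rate_distortion_eq[OF src(1-4) assms(21-23)])
  ultimately show ?thesis using mse unfolding v1_def v2_def by simp
qed

end
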